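(* Let $S\subseteq\{1,\dots,n\}$ with $|S|=s$, let $x\in\mathbb{R}^n$ or $\mathbb{C}^n$ be supported on $S$ and satisfy the random sign assumption, and let $A$ be the random sensing matrix of the setting with parameter $\Theta(S,F)$. Let $y=Ax+\epsilon$ with $\|\epsilon\|_2\le\eta$ for a given $\eta>0$. There exist numerical constants $C_1,C_2>0$ such that for every $0<\varepsilon<1$, if $$m\ge 889\,\Theta(S,F)\,\ln^2\!\left(\tfrac{6n}{\varepsilon}\right),$$ then with probability at least $1-\varepsilon$ every minimizer $x^\sharp$ of (qBP) satisfies $\|x-x^\sharp\|_2\le (C_1+C_2\sqrt s)\,\eta$.
   Context: Setting: Let $n,m\ge 1$. For $\ell=1,\dots,m$ let $F_\ell$ be a probability distribution on $\mathbb{C}^{p_\ell\times n}$ ($p_\ell\ge1$), $F=(F_\ell)_{\ell=1}^m$, let $B_1,\dots,B_m$ be independent random matrices with $B_\ell\sim F_\ell$, and $A=\frac{1}{\sqrt m}\begin{pmatrix}B_1\\ \vdots\\ B_m\end{pmatrix}$. Isotropy is assumed: $\mathbb{E}(A^*A)=\frac1m\sum_{\ell=1}^m\mathbb{E}(B_\ell^*B_\ell)=\mathrm{Id}_n$. For $S\subseteq\{1,\dots,n\}$, $P_S$ is the restriction $P_Sx=x_S$ and $M_S:=MP_S^*$; $B_{\ell,S}=B_\ell P_S^*$. $\|M\|_{p\to q}=\sup_{\|v\|_p\le1}\|Mv\|_q$; in particular $\|M\|_{\infty\to\infty}$ is the maximal $\ell^1$ norm of a row of $M$. $\Theta(S,F)$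 denotes any positive real number such that almost surely $\|B_\ell^*B_{\ell,S}\|_{\infty\to\infty}\le\Theta(S,F)$ for all $\ell$. Random sign assumption: the vector $(x_i/|x_i|)_{i\in S}$ is a Rademacher sequence (independent uniform $\pm1$ entries) if $x$ is real, or a Steinhaus sequence (independent entries uniform on the complex unit circle) if $x$ is complex, independent of $A$. (qBP) is the problem $\min_{z\in\mathbb{C}^n}\|z\|_1$ subject to $\|y-Az\|_2\le\eta$. *)

theory Defs
  imports "HOL-Probability.Probability"
begin

text \<open>Conventions. Indices are 0-based: columns j < n, blocks l < m, rows of block l are i < p l,
  S is a subset of {..<n}. A matrix B_l in C^{p_l x n} is a function cmat with entry B i j;
  only entries i < p l, j < n are ever used. A vector of C^n is a function cvec, only the
  components j < n are used. Vectors in the range of A are indexed by pairs (l,i).\<close>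

type_synonym cmat = "nat \<Rightarrow> nat \<Rightarrow> complex"
type_synonym cvec = "nat \<Rightarrow> complex"

definition rows :: "nat \<Rightarrow> (nat \<Rightarrow> nat) \<Rightarrow> (nat \<times> nat) set" where
  "rows m p = Sigma {..<m} (\<lambda>l. {..<p l})"

definition Amul :: "nat \<Rightarrow> nat \<Rightarrow> (nat \<Rightarrow> cmat) \<Rightarrow> cvec \<Rightarrow> nat \<times> nat \<Rightarrow> complex" where
  "Amul n m Bs z = (\<lambda>(l, i). (1 / complex_of_real (sqrt (real m))) * (\<Sum>j<n. Bs l i j * z j))"

definition norm2_rows :: "nat \<Rightarrow> (nat \<Rightarrow> nat) \<Rightarrow> (nat \<times> nat \<Rightarrow> complex) \<Rightarrow> real" where
  "norm2_rows m p v = sqrt (\<Sum>r\<in>rows m p. (cmod (v r))\<^sup>2)"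

definition l1norm :: "nat \<Rightarrow> cvec \<Rightarrow> real" where
  "l1norm n z = (\<Sum>j<n. cmod (z j))"

definition l2norm :: "nat \<Rightarrow> cvec \<Rightarrow> real" where
  "l2norm n z = sqrt (\<Sum>j<n. (cmod (z j))\<^sup>2)"

definition qBP_feasible :: "nat \<Rightarrow> nat \<Rightarrow> (nat \<Rightarrow> nat) \<Rightarrow> (nat \<Rightarrow> cmat) \<Rightarrow> (nat \<times> nat \<Rightarrow> complex)
    \<Rightarrow> real \<Rightarrow> cvec \<Rightarrow> bool" where
  "qBP_feasible n m p Bs y \<eta> z \<longleftrightarrow> norm2_rows m p (\<lambda>r. y r - Amul n m Bs z r) \<le> \<eta>"

definition qBP_minimizer :: "nat \<Rightarrow> nat \<Rightarrow> (nat \<Rightarrow> nat) \<Rightarrow> (nat \<Rightarrow> cmat) \<Rightarrow> (nat \<times> nat \<Rightarrow> complex)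
    \<Rightarrow> real \<Rightarrow> cvec \<Rightarrow> bool" where
  "qBP_minimizer n m p Bs y \<eta> z \<longleftrightarrow>
     qBP_feasible n m p Bs y \<eta> z \<and> (\<forall>w. qBP_feasible n m p Bs y \<eta> w \<longrightarrow> l1norm n z \<le> l1norm n w)"

definition gram :: "nat \<Rightarrow> cmat \<Rightarrow> nat \<Rightarrow> nat \<Rightarrow> complex" where
  "gram p B j k = (\<Sum>i<p. cnj (B i j) * B i k)"

text \<open>||B^* B_S||_{\<infinity>\<rightarrow>\<infinity>}: maximal l1 norm of a row of the n x |S| matrix B^* B P_S^*.\<close>
definition inf_norm_gram_S :: "nat \<Rightarrow> nat \<Rightarrow> nat set \<Rightarrow> cmat \<Rightarrow> real" where
  "inf_norm_gram_S p n S B = Max ((\<lambda>j. \<Sum>k\<in>S. cmod (gram p B j k)) ` {..<n})"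

text \<open>Isotropy: E(A^* A) = (1/m) \<Sum>_l E(B_l^* B_l) = Id_n (with the expectations existing).\<close>
definition isotropic :: "nat \<Rightarrow> nat \<Rightarrow> (nat \<Rightarrow> nat) \<Rightarrow> (nat \<Rightarrow> cmat measure) \<Rightarrow> bool" where
  "isotropic n m p F \<longleftrightarrow>
     (\<forall>l<m. \<forall>j<n. \<forall>k<n. integrable (F l) (\<lambda>B. gram (p l) B j k)) \<and>
     (\<forall>j<n. \<forall>k<n. (1 / of_nat m) * (\<Sum>l<m. integral\<^sup>L (F l) (\<lambda>B. gram (p l) B j k))
                   = (if j = k then 1 else (0::complex)))"

definition theta_bound :: "nat \<Rightarrow> nat \<Rightarrow> (nat \<Rightarrow> nat) \<Rightarrow> (nat \<Rightarrow> cmat measure) \<Rightarrow> nat set \<Rightarrow> real \<Rightarrow> bool" where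
  "theta_bound n m p F S \<Theta> \<longleftrightarrow> \<Theta> > 0 \<and> (\<forall>l<m. AE B in F l. inf_norm_gram_S (p l) n S B \<le> \<Theta>)"

definition rademacher_seq :: "nat set \<Rightarrow> cvec measure" where
  "rademacher_seq S = PiM S (\<lambda>_. measure_pmf (pmf_of_set {1, -1 :: complex}))"

definition steinhaus_seq :: "nat set \<Rightarrow> cvec measure" where
  "steinhaus_seq S = PiM S (\<lambda>_. distr (uniform_measure lborel {0..<2*pi}) borel (\<lambda>t. cis t))"

text \<open>Joint probability space: B_l ~ F_l independent (product), and the sign sequence
  independent of A (product); Rademacher in the real case, Steinhaus in the complex case.\<close>
definition sample_space :: "nat \<Rightarrow> (nat \<Rightarrow> cmat measure) \<Rightarrow> nat set \<Rightarrow> bool \<Rightarrow> ((nat \<Rightarrow> cmat) \<times> cvec) measure" where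
  "sample_space m F S is_real =
     (PiM {..<m} F) \<Otimes>\<^sub>M (if is_real then rademacher_seq S else steinhaus_seq S)"

text \<open>The signal: x_j = r_j sigma_j on S (r_j = |x_j| > 0), 0 off S.\<close>
definition signal :: "nat set \<Rightarrow> (nat \<Rightarrow> real) \<Rightarrow> cvec \<Rightarrow> cvec" where
  "signal S r \<sigma> = (\<lambda>j. if j \<in> S then complex_of_real (r j) * \<sigma> j else 0)"

end

theory Submission
  imports Defs
begin

text \<open>Write \<open>H = A\<^sup>*A\<close>, \<open>X = H\<^sub>S - I\<close>, \<open>L = ln (6n/\<epsilon>)\<close> and \<open>sgn x = \<sigma>\<close>. A dual certificate is
  \<open>A\<^sup>*A\<^sub>S \<tau>\<close>, where \<open>\<tau>\<close> is the Neumann series for \<open>(I + X)\<^sup>-\<^sup>1 \<sigma>\<close> truncated after \<open>n\<close> terms. It gives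
  recovery as soon as \<open>\<parallel>X\<parallel> \<le> 1/2\<close>, the columns of \<open>H\<close> outside \<open>S\<close> have norm at most \<open>\<beta> = 1/(8 \<surd>L)\<close> on \<open>S\<close>,
  and the certificate is at most \<open>1/2\<close> off \<open>S\<close>.

  The second and third event follow from Pinelis' inequality
  \<open>E cosh \<parallel>\<Sum>Y\<^sub>i\<parallel> \<le> \<Prod> E (exp \<parallel>Y\<^sub>i\<parallel> - \<parallel>Y\<^sub>i\<parallel>)\<close> for independent centred vectors, which has no dimensional factor.

  Because \<open>m\<close> is of order \<open>\<Theta> L\<^sup>2\<close> rather than \<open>\<Theta> L\<close>, the first event needs no matrix Bernstein inequality.
  Replacing one block by an independent copy (the method of exchangeable pairs) yields
  \<open>E tr X\<^sup>2\<^sup>r\<^sup>+\<^sup>2 \<le> 2(2r+1) (\<Theta>/m) E tr ((2I + X) X\<^sup>2\<^sup>r)\<close>, hence \<open>E tr X\<^sup>2\<^sup>q \<le> s 16\<^sup>-\<^sup>q\<close> for \<open>q\<close> of order \<open>L\<close>.\<close>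

section \<open>Matrix polynomials on a finite index set\<close>

text \<open>The square of \<open>L\<close> comes from the two vector bounds. With the blocks fixed,
  the certificate off \<open>S\<close> is a sign sum whose coefficient vector has norm at most
  \<open>2 * \<beta>\<close>; its Hoeffding exponent at level 1/2 is 1 / (64 \<beta>^2), and
  equating this to \<open>L\<close> gives the stated \<beta>. The Bernstein exponent of the columns,
  \<beta>^2 m / (4 \<Theta>) = m / (256 \<Theta> L), must then reach \<open>L\<close>. The moments
  of \<open>X\<close>, with q <= 2 L, only ask for m >= 336 \<Theta> L. All failure events together
  cost 5 n exp (-L) = 5 \<epsilon> / 6.

  The obstacle in the moment method is noncommutativity: exchanging a block turns P into Q, and
  P^(2r+1) - Q^(2r+1) consists of mixed terms P^i (P - Q) Q^(2r-i). Left multiplication by P and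
  right multiplication by Q, however, commute and are self-adjoint for the Frobenius inner product,
  so a convexity argument in i bounds every mixed term by the pure ones. The relation Z^2 <=
  (\<Theta>/m) Z for a block then makes the bound linear in the blocks, whose sum is known.

  The truncated certificate agrees with the signs on \<open>S\<close> only up to an error of norm at
  most 1; the recovery constants absorb it.\<close>

lemma discrete_max_principle:
  fixes h :: "nat \<Rightarrow> real"
  assumes "\<And>i. 0 < i \<Longrightarrow> i < r \<Longrightarrow> 2 * h i \<le> h (i - 1) + h (Suc i)" and "i \<le> r"
  shows "h i \<le> max (h 0) (h r)"
proof -
  define M where "M = Max (h ` {..r})"
  have M: "h j \<le> M" if "j \<le> r" for j using that unfolding M_def by (intro Max_ge) auto
  have "M \<in> h ` {..r}" unfolding M_def by (intro Max_in) auto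
  then have ex: "\<exists>j. j \<le> r \<and> h j = M" by auto
  \<comment> \<open>The leftmost maximiser: at an interior one, convexity would make the left
    neighbour a maximiser too.\<close>
  define j where "j = (LEAST j. j \<le> r \<and> h j = M)"
  have j: "j \<le> r" "h j = M" using LeastI_ex[OF ex] unfolding j_def by auto
  have "j = 0 \<or> j = r"
  proof (rule ccontr)
    assume *: "\<not> (j = 0 \<or> j = r)"
    then have "2 * h j \<le> h (j - 1) + h (Suc j)" using assms(1) j by auto
    moreover have "h (Suc j) \<le> M" using M j * by auto
    moreover have "h (j - 1) \<noteq> M"
      using not_less_Least[of "j - 1" "\<lambda>j. j \<le> r \<and> h j = M"] * j unfolding j_def[symmetric] by auto
    moreover have "h (j - 1) \<le> M" using M j by auto
    ultimately show False using j by linarith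
  qed
  then show ?thesis using M[OF assms(2)] j by auto
qed

text \<open>The inner product of L^i R^(r-i) D and L^j R^(r-j) D depends only on i + j. Hence the
  squared norm \<open>h i\<close> equals the inner product of the neighbours i - 1 and i + 1, and
  AM-GM makes \<open>h\<close> convex, so it is largest at an end. A mixed term k = i + j is again
  bounded by AM-GM. Keeping \<open>ip\<close> abstract means that no vector space structure on the
  matrices is called for.\<close>

lemma commuting_selfadjoint_mixed_power_le:
  fixes ip :: "'v \<Rightarrow> 'v \<Rightarrow> real" and L R :: "'v \<Rightarrow> 'v"
  assumes L: "\<And>x y. ip (L x) y = ip x (L y)" and R: "\<And>x y. ip (R x) y = ip x (R y)"
    and LR: "\<And>x. L (R x) = R (L x)" and amgm: "\<And>x y. 2 * ip x y \<le> ip x x + ip y y"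
    and nonneg: "\<And>x. 0 \<le> ip x x"
    and k: "k \<le> 2 * r"
  shows "ip D ((L ^^ k) ((R ^^ (2 * r - k)) D))
    \<le> ip ((L ^^ r) D) ((L ^^ r) D) + ip ((R ^^ r) D) ((R ^^ r) D)"
proof -
  define a where "a i = (L ^^ i) ((R ^^ (r - i)) D)" for i
  define h where "h i = ip (a i) (a i)" for i
  have Li: "ip ((L ^^ i) x) y = ip x ((L ^^ i) y)" for i x y
    by (induction i arbitrary: x y) (simp_all add: L funpow_swap1)
  have Ri: "ip ((R ^^ i) x) y = ip x ((R ^^ i) y)" for i x y
    by (induction i arbitrary: x y) (simp_all add: R funpow_swap1)
  have LRi1: "L ((R ^^ j) x) = (R ^^ j) (L x)" for j x
    by (induction j) (simp_all add: LR)
  have LRij: "(L ^^ i) ((R ^^ j) x) = (R ^^ j) ((L ^^ i) x)" for i j x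
    by (induction i) (simp_all add: LRi1)
  have aa: "ip (a i) (a j) = ip D ((L ^^ (i + j)) ((R ^^ (2 * r - (i + j))) D))"
    if "i \<le> r" "j \<le> r" for i j
  proof -
    have "ip (a i) (a j) = ip D ((R ^^ (r - i)) ((L ^^ i) ((L ^^ j) ((R ^^ (r - j)) D))))"
      unfolding a_def Li Ri ..
    also have "\<dots> = ip D ((L ^^ i) ((L ^^ j) ((R ^^ (r - i)) ((R ^^ (r - j)) D))))"
      by (simp add: LRij)
    also have "\<dots> = ip D ((L ^^ (i + j)) ((R ^^ (r - i + (r - j))) D))"
      by (simp add: funpow_add)
    also have "r - i + (r - j) = 2 * r - (i + j)" using that by simp
    finally show ?thesis .
  qed
  have h: "h i \<le> max (h 0) (h r)" if "i \<le> r" for i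
  proof (rule discrete_max_principle[OF _ that])
    fix i assume i: "0 < i" "i < r"
    have "h i = ip (a (i - 1)) (a (Suc i))"
      unfolding h_def using i by (subst (1 2) aa) (auto intro!: arg_cong2[of _ _ _ _ ip])
    then show "2 * h i \<le> h (i - 1) + h (Suc i)" using amgm unfolding h_def by metis
  qed
  have hm: "max (h 0) (h r) \<le> h 0 + h r" using nonneg unfolding h_def by simp
  obtain i j where ij: "k = i + j" "i \<le> r" "j \<le> r"
  proof
    show "k = k div 2 + (k - k div 2)" "k div 2 \<le> r" "k - k div 2 \<le> r" using k by auto
  qed
  have "2 * ip (a i) (a j) \<le> h i + h j" using amgm unfolding h_def .
  also have "\<dots> \<le> 2 * (h 0 + h r)" using order_trans[OF h[OF ij(2)] hm] order_trans[OF h[OF ij(3)] hm] by simp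
  finally have "ip (a i) (a j) \<le> h 0 + h r" by simp
  then show ?thesis unfolding aa[OF ij(2,3)] ij(1)[symmetric] by (simp add: h_def a_def add.commute)
qed

section \<open>Matrix algebra with the real Frobenius inner product\<close>

definition mm :: "'a set \<Rightarrow> ('a \<Rightarrow> 'a \<Rightarrow> complex) \<Rightarrow> ('a \<Rightarrow> 'a \<Rightarrow> complex) \<Rightarrow> 'a \<Rightarrow> 'a \<Rightarrow> complex" where
  "mm K X Y = (\<lambda>j k. \<Sum>i\<in>K. X j i * Y i k)"

definition adj :: "('a \<Rightarrow> 'a \<Rightarrow> complex) \<Rightarrow> 'a \<Rightarrow> 'a \<Rightarrow> complex" where
  "adj X = (\<lambda>j k. cnj (X k j))"

text \<open>This is Re tr (X^* Y). Taking the real part makes it symmetric and loses nothing for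
  traces of powers of Hermitian matrices.\<close>

definition fip :: "'a set \<Rightarrow> ('a \<Rightarrow> 'a \<Rightarrow> complex) \<Rightarrow> ('a \<Rightarrow> 'a \<Rightarrow> complex) \<Rightarrow> real" where
  "fip K X Y = Re (\<Sum>j\<in>K. \<Sum>k\<in>K. cnj (X j k) * Y j k)"

definition idm :: "'a set \<Rightarrow> 'a \<Rightarrow> 'a \<Rightarrow> complex" where
  "idm K = (\<lambda>j k. if j = k \<and> j \<in> K then 1 else 0)"

text \<open>Matrices are total functions; vanishing outside K x K is what makes \<open>idm K\<close>
  a two-sided unit as an equation between functions.\<close>

definition supported :: "'a set \<Rightarrow> ('a \<Rightarrow> 'a \<Rightarrow> complex) \<Rightarrow> bool" where
  "supported K X \<longleftrightarrow> (\<forall>j k. j \<notin> K \<or> k \<notin> K \<longrightarrow> X j k = 0)"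

definition pow :: "'a set \<Rightarrow> ('a \<Rightarrow> 'a \<Rightarrow> complex) \<Rightarrow> nat \<Rightarrow> 'a \<Rightarrow> 'a \<Rightarrow> complex" where
  "pow K X k = ((\<lambda>Y. mm K Y X) ^^ k) (idm K)"

lemma mm_assoc: "mm K (mm K X Y) W = mm K X (mm K Y W)"
proof (intro ext)
  fix j k
  have "mm K (mm K X Y) W j k = (\<Sum>i\<in>K. \<Sum>l\<in>K. X j l * Y l i * W i k)"
    by (simp add: mm_def sum_distrib_right)
  also have "\<dots> = (\<Sum>l\<in>K. \<Sum>i\<in>K. X j l * Y l i * W i k)" by (rule sum.swap)
  also have "\<dots> = mm K X (mm K Y W) j k" by (simp add: mm_def sum_distrib_left mult.assoc)
  finally show "mm K (mm K X Y) W j k = mm K X (mm K Y W) j k" .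
qed

lemma mm_add_left: "mm K (\<lambda>j k. X j k + Y j k) W = (\<lambda>j k. mm K X W j k + mm K Y W j k)"
  by (simp add: mm_def algebra_simps sum.distrib)

lemma mm_diff_left: "mm K (\<lambda>j k. X j k - Y j k) W = (\<lambda>j k. mm K X W j k - mm K Y W j k)"
  by (simp add: mm_def algebra_simps sum_subtractf)

lemma mm_diff_right: "mm K W (\<lambda>j k. X j k - Y j k) = (\<lambda>j k. mm K W X j k - mm K W Y j k)"
  by (simp add: mm_def algebra_simps sum_subtractf)

lemma mm_sum_left: "mm K (\<lambda>j k. \<Sum>i\<in>I. X i j k) W = (\<lambda>j k. \<Sum>i\<in>I. mm K (X i) W j k)"
  unfolding mm_def sum_distrib_right by (intro ext sum.swap)

lemma mm_idm_right: "finite K \<Longrightarrow> supported K X \<Longrightarrow> mm K X (idm K) = X"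
  by (intro ext) (auto simp: mm_def idm_def supported_def if_distrib sum.delta cong: if_cong)

lemma mm_idm_left: "finite K \<Longrightarrow> supported K X \<Longrightarrow> mm K (idm K) X = X"
proof (intro ext)
  fix j k assume K: "finite K" "supported K X"
  have "mm K (idm K) X j k = (\<Sum>i\<in>K. if i = j then X i k else 0)"
    unfolding mm_def idm_def by (intro sum.cong) auto
  then show "mm K (idm K) X j k = X j k" using K by (auto simp: supported_def sum.delta)
qed

lemma supported_idm: "supported K (idm K)"
  by (auto simp: supported_def idm_def)

lemma supported_mm: "supported K X \<Longrightarrow> supported K Y \<Longrightarrow> supported K (mm K X Y)"
  unfolding supported_def mm_def by (auto intro!: sum.neutral)

lemma supported_pow: "supported K X \<Longrightarrow> supported K (pow K X k)"
  unfolding pow_def by (induction k) (auto simp: supported_idm supported_mm)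

lemma adj_mm: "adj (mm K X Y) = mm K (adj Y) (adj X)"
  by (simp add: adj_def mm_def mult.commute)

lemma adj_adj: "adj (adj X) = X" by (simp add: adj_def)

lemma fip_adj: "fip K (adj X) (adj Y) = fip K Y X"
  unfolding fip_def adj_def by (subst sum.swap) (simp add: mult.commute)

lemma fip_commute: "fip K X Y = fip K Y X"
  unfolding fip_def Re_sum by (intro sum.cong refl) (simp add: algebra_simps)

lemma fip_add_right: "fip K X (\<lambda>j k. Y j k + W j k) = fip K X Y + fip K X W"
  by (simp add: fip_def algebra_simps sum.distrib)

lemma fip_diff_right: "fip K X (\<lambda>j k. Y j k - W j k) = fip K X Y - fip K X W"
  by (simp add: fip_def algebra_simps sum_subtractf sum.distrib)

lemma fip_add_left: "fip K (\<lambda>j k. Y j k + W j k) X = fip K Y X + fip K W X"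
  by (simp add: fip_def algebra_simps sum.distrib)

lemma fip_diff_left: "fip K (\<lambda>j k. Y j k - W j k) X = fip K Y X - fip K W X"
  by (simp add: fip_def algebra_simps sum_subtractf sum.distrib)

lemma fip_sum_right: "fip K X (\<lambda>j k. \<Sum>i\<in>I. Y i j k) = (\<Sum>i\<in>I. fip K X (Y i))"
proof -
  have "(\<Sum>j\<in>K. \<Sum>k\<in>K. cnj (X j k) * (\<Sum>i\<in>I. Y i j k))
      = (\<Sum>j\<in>K. \<Sum>i\<in>I. \<Sum>k\<in>K. cnj (X j k) * Y i j k)"
    unfolding sum_distrib_left by (intro sum.cong refl sum.swap)
  also have "\<dots> = (\<Sum>i\<in>I. \<Sum>j\<in>K. \<Sum>k\<in>K. cnj (X j k) * Y i j k)" by (rule sum.swap)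
  finally show ?thesis unfolding fip_def by simp
qed

lemma fip_sum_left: "fip K (\<lambda>j k. \<Sum>i\<in>I. Y i j k) X = (\<Sum>i\<in>I. fip K (Y i) X)"
  using fip_sum_right[of K X Y I] by (simp add: fip_commute[of K _ X])

lemma fip_self: "fip K X X = (\<Sum>j\<in>K. \<Sum>k\<in>K. (cmod (X j k))\<^sup>2)"
  unfolding fip_def Re_sum by (intro sum.cong refl) (simp add: cmod_power2, simp add: power2_eq_square)

lemma fip_self_nonneg: "0 \<le> fip K X X"
  unfolding fip_self by (intro sum_nonneg) auto

lemma fip_amgm: "2 * fip K X Y \<le> fip K X X + fip K Y Y"
  using fip_self_nonneg[of K "\<lambda>j k. X j k - Y j k"]
  by (simp add: fip_diff_right fip_diff_left fip_commute[of K Y X])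

lemma fip_diff_self_le: "fip K (\<lambda>j k. X j k - Y j k) (\<lambda>j k. X j k - Y j k) \<le> 2 * fip K X X + 2 * fip K Y Y"
  using fip_self_nonneg[of K "\<lambda>j k. X j k + Y j k"]
  by (simp add: fip_diff_right fip_diff_left fip_add_right fip_add_left fip_commute[of K Y X])

lemma fip_mm_left: "fip K (mm K P X) Y = fip K X (mm K (adj P) Y)"
proof -
  have "(\<Sum>j\<in>K. \<Sum>k\<in>K. cnj (\<Sum>i\<in>K. P j i * X i k) * Y j k)
     = (\<Sum>k\<in>K. \<Sum>j\<in>K. \<Sum>i\<in>K. cnj (P j i) * cnj (X i k) * Y j k)"
    by (subst sum.swap) (simp add: sum_distrib_right)
  also have "\<dots> = (\<Sum>k\<in>K. \<Sum>i\<in>K. \<Sum>j\<in>K. cnj (P j i) * cnj (X i k) * Y j k)"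
    by (intro sum.cong refl sum.swap)
  also have "\<dots> = (\<Sum>i\<in>K. \<Sum>k\<in>K. cnj (X i k) * (\<Sum>j\<in>K. cnj (P j i) * Y j k))"
    by (subst sum.swap) (simp add: sum_distrib_left algebra_simps)
  finally show ?thesis unfolding fip_def mm_def adj_def by simp
qed

lemma fip_mm_right: "fip K (mm K X Q) Y = fip K X (mm K Y (adj Q))"
proof -
  have "fip K (mm K X Q) Y = fip K (mm K (adj Q) (adj X)) (adj Y)"
    using fip_adj[of K Y "mm K X Q"] by (simp add: adj_mm fip_commute)
  also have "\<dots> = fip K (adj X) (mm K Q (adj Y))" by (simp add: fip_mm_left adj_adj)
  also have "\<dots> = fip K (adj X) (adj (mm K Y (adj Q)))" by (simp add: adj_mm adj_adj)
  also have "\<dots> = fip K X (mm K Y (adj Q))" by (simp add: fip_adj fip_commute)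
  finally show ?thesis .
qed

lemma pow_0: "pow K X 0 = idm K" by (simp add: pow_def)

lemma pow_Suc: "pow K X (Suc k) = mm K (pow K X k) X" by (simp add: pow_def)

lemma iterate_right_mult:
  assumes "finite K" "supported K D"
  shows "((\<lambda>Y. mm K Y X) ^^ k) D = mm K D (pow K X k)"
  using assms by (induction k) (simp_all add: pow_0 pow_Suc mm_idm_right mm_assoc)

lemma pow_commute:
  assumes "finite K" "supported K X" shows "mm K X (pow K X k) = mm K (pow K X k) X"
  using assms by (induction k) (simp_all add: pow_0 pow_Suc mm_idm_right mm_idm_left mm_assoc[symmetric])

lemma adj_idm: "adj (idm K) = idm K"
  by (auto simp: adj_def idm_def fun_eq_iff)

lemma adj_pow:
  assumes "finite K" "supported K X" "adj X = X" shows "adj (pow K X k) = pow K X k"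
  using assms by (induction k) (simp_all add: adj_idm pow_0 pow_Suc adj_mm pow_commute)

lemma iterate_left_mult:
  assumes "finite K" "supported K X" "supported K D"
  shows "((\<lambda>Y. mm K X Y) ^^ k) D = mm K (pow K X k) D"
  using assms by (induction k) (simp_all add: pow_0 pow_Suc mm_idm_left mm_assoc[symmetric] pow_commute)

lemma fip_pow_pow:
  assumes "finite K" "supported K X" "adj X = X"
  shows "fip K (pow K X a) (pow K X b) = fip K (idm K) (pow K X (a + b))"
proof -
  have "fip K (((\<lambda>Y. mm K Y X) ^^ a) U) V = fip K U (((\<lambda>Y. mm K Y X) ^^ a) V)" for U V
  proof (induction a arbitrary: U V)
    case (Suc a)
    then show ?case using funpow_swap1[of "\<lambda>Y. mm K Y X" a V] by (simp add: fip_mm_right assms)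
  qed simp
  then show ?thesis by (simp add: pow_def funpow_add)
qed

section \<open>Differences of odd powers\<close>

lemma pow_diff_telescope:
  assumes K: "finite K" and P: "supported K P" and Q: "supported K Q"
  shows "(\<lambda>j k. pow K P (Suc N) j k - pow K Q (Suc N) j k)
    = (\<lambda>j k. \<Sum>i\<le>N. mm K (pow K P i) (mm K (\<lambda>j k. P j k - Q j k) (pow K Q (N - i))) j k)"
proof -
  let ?D = "\<lambda>j k. P j k - Q j k"
  have D: "supported K ?D" using P Q by (simp add: supported_def)
  show ?thesis
  proof (induction N)
    case 0
    show ?case using D K P Q by (simp add: pow_0 pow_Suc mm_idm_left mm_idm_right)
  next
    case (Suc N)
    have eq: "(\<lambda>j k. \<Sum>i\<le>Suc N. mm K (pow K P i) (mm K ?D (pow K Q (Suc N - i))) j k)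
      = (\<lambda>j k. (\<Sum>i\<le>N. mm K (mm K (pow K P i) (mm K ?D (pow K Q (N - i)))) Q j k)
             + mm K (pow K P (Suc N)) ?D j k)"
      using D K by (auto simp: fun_eq_iff pow_0 mm_idm_right Suc_diff_le pow_Suc mm_assoc intro!: sum.cong)
    have "(\<lambda>j k. pow K P (Suc (Suc N)) j k - pow K Q (Suc (Suc N)) j k)
      = (\<lambda>j k. mm K (\<lambda>j k. pow K P (Suc N) j k - pow K Q (Suc N) j k) Q j k
             + mm K (pow K P (Suc N)) ?D j k)"
      by (simp only: pow_Suc[of K _ "Suc N"] mm_diff_left mm_diff_right) (simp add: fun_eq_iff)
    then show ?case unfolding eq Suc.IH mm_sum_left .
  qed
qed

text \<open>Each of the 2r + 1 telescope terms is \<open>D\<close> under i left multiplications by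
  \<open>P\<close> and 2r - i right multiplications by \<open>Q\<close>. These operations commute
  and are self-adjoint for \<open>fip\<close>, so
  \<open>commuting_selfadjoint_mixed_power_le\<close> gives the same bound for all i.\<close>

lemma fip_pow_diff_le:
  assumes K: "finite K" and P: "supported K P" "adj P = P" and Q: "supported K Q" "adj Q = Q"
  defines "D \<equiv> \<lambda>j k. P j k - Q j k"
  shows "fip K D (\<lambda>j k. pow K P (Suc (2 * r)) j k - pow K Q (Suc (2 * r)) j k)
    \<le> (2 * r + 1) * (fip K (mm K D (pow K P r)) (mm K D (pow K P r))
                  + fip K (mm K D (pow K Q r)) (mm K D (pow K Q r)))"
proof -
  have D: "supported K D" "adj D = D" using P Q by (auto simp: supported_def D_def adj_def fun_eq_iff)
  let ?L = "\<lambda>Y. mm K P Y" and ?R = "\<lambda>Y. mm K Y Q"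
  let ?b = "fip K (mm K D (pow K P r)) (mm K D (pow K P r))
                  + fip K (mm K D (pow K Q r)) (mm K D (pow K Q r))"
  have "fip K D (mm K (pow K P i) (mm K D (pow K Q (2 * r - i)))) \<le> ?b" if "i \<le> 2 * r" for i
  proof -
    have "fip K D ((?L ^^ i) ((?R ^^ (2 * r - i)) D))
      \<le> fip K ((?L ^^ r) D) ((?L ^^ r) D) + fip K ((?R ^^ r) D) ((?R ^^ r) D)"
      using that by (intro commuting_selfadjoint_mixed_power_le[where ip="fip K"])
        (simp_all only: fip_mm_left[of K P] fip_mm_right[of K _ Q] P(2) Q(2) mm_assoc fip_amgm fip_self_nonneg)
    \<comment> \<open>Taking adjoints moves the power of \<open>P\<close> to the right of
      \<open>D\<close>, so that both pure terms have the same shape.\<close>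
    moreover have "fip K (mm K (pow K P r) D) (mm K (pow K P r) D)
        = fip K (mm K D (pow K P r)) (mm K D (pow K P r))"
      using fip_adj[of K "mm K (pow K P r) D" "mm K (pow K P r) D"]
      by (simp add: adj_mm D adj_pow[OF K P])
    ultimately show ?thesis using D K P Q
      by (simp add: iterate_left_mult iterate_right_mult supported_mm supported_pow)
  qed
  then have "(\<Sum>i\<le>2*r. fip K D (mm K (pow K P i) (mm K D (pow K Q (2 * r - i))))) \<le> (\<Sum>i\<le>2*r. ?b)"
    by (intro sum_mono) auto
  then show ?thesis
    unfolding pow_diff_telescope[OF K P(1) Q(1), folded D_def] fip_sum_right by (simp add: algebra_simps)
qed

text \<open>The last hypotheses say \<open>0 \<le> Z\<^sup>2 \<le> \<rho> Z\<close> as quadratic forms.\<close>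
lemma fip_pow_diff_psd_le:
  assumes K: "finite K" and R: "supported K R" "adj R = R"
    and Z: "supported K Z" "adj Z = Z" and Z': "supported K Z'" "adj Z' = Z'"
    and Zr: "\<And>X. fip K (mm K Z X) (mm K Z X) \<le> \<rho> * fip K X (mm K Z X)"
    and Zr': "\<And>X. fip K (mm K Z' X) (mm K Z' X) \<le> \<rho> * fip K X (mm K Z' X)"
  defines "P \<equiv> \<lambda>j k. R j k + Z j k" and "Q \<equiv> \<lambda>j k. R j k + Z' j k"
  shows "fip K (\<lambda>j k. Z j k - Z' j k) (\<lambda>j k. pow K P (Suc (2 * r)) j k - pow K Q (Suc (2 * r)) j k)
    \<le> (2 * r + 1) * (2 * \<rho>) *
       (fip K (pow K P r) (mm K Z (pow K P r)) + fip K (pow K P r) (mm K Z' (pow K P r))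
      + fip K (pow K Q r) (mm K Z (pow K Q r)) + fip K (pow K Q r) (mm K Z' (pow K Q r)))"
proof -
  have P: "supported K P" "adj P = P" using R Z by (auto simp: supported_def P_def adj_def fun_eq_iff)
  have Q: "supported K Q" "adj Q = Q" using R Z' by (auto simp: supported_def Q_def adj_def fun_eq_iff)
  have D: "(\<lambda>j k. P j k - Q j k) = (\<lambda>j k. Z j k - Z' j k)" by (simp add: P_def Q_def)
  \<comment> \<open>In terms of quadratic forms: (Z - Z')^2 <= 2 Z^2 + 2 Z'^2 <= 2 \<rho> (Z +
    Z').\<close>
  have *: "fip K (mm K (\<lambda>j k. Z j k - Z' j k) X) (mm K (\<lambda>j k. Z j k - Z' j k) X)
      \<le> 2 * \<rho> * (fip K X (mm K Z X) + fip K X (mm K Z' X))" for X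
    using fip_diff_self_le[of K "mm K Z X" "mm K Z' X"] Zr[of X] Zr'[of X]
    by (simp add: mm_diff_left algebra_simps)
  have "real (2 * r + 1) * (fip K (mm K (\<lambda>j k. Z j k - Z' j k) (pow K P r)) (mm K (\<lambda>j k. Z j k - Z' j k) (pow K P r))
      + fip K (mm K (\<lambda>j k. Z j k - Z' j k) (pow K Q r)) (mm K (\<lambda>j k. Z j k - Z' j k) (pow K Q r)))
     \<le> real (2 * r + 1) * (2 * \<rho> * (fip K (pow K P r) (mm K Z (pow K P r)) + fip K (pow K P r) (mm K Z' (pow K P r)))
      + 2 * \<rho> * (fip K (pow K Q r) (mm K Z (pow K Q r)) + fip K (pow K Q r) (mm K Z' (pow K Q r))))"
    by (intro mult_left_mono add_mono *) auto
  with fip_pow_diff_le[OF K P Q, of r] show ?thesis unfolding D by (simp add: algebra_simps)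
qed

section \<open>Vectors, Neumann series and the deterministic recovery bound\<close>

definition cin :: "'a set \<Rightarrow> ('a \<Rightarrow> complex) \<Rightarrow> ('a \<Rightarrow> complex) \<Rightarrow> complex" where
  "cin K x y = (\<Sum>k\<in>K. cnj (x k) * y k)"

definition nrm :: "'a set \<Rightarrow> ('a \<Rightarrow> complex) \<Rightarrow> real" where
  "nrm K x = L2_set (\<lambda>k. cmod (x k)) K"

definition mv :: "'a set \<Rightarrow> ('a \<Rightarrow> 'a \<Rightarrow> complex) \<Rightarrow> ('a \<Rightarrow> complex) \<Rightarrow> 'a \<Rightarrow> complex" where
  "mv K X v = (\<lambda>j. \<Sum>k\<in>K. X j k * v k)"

lemma nrm_nonneg [simp]: "0 \<le> nrm K x" by (simp add: nrm_def L2_set_nonneg)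

lemma nrm_sq: "(nrm K x)\<^sup>2 = (\<Sum>k\<in>K. (cmod (x k))\<^sup>2)"
  unfolding nrm_def L2_set_def by (simp add: sum_nonneg)

lemma nrm_cong: "(\<And>k. k \<in> K \<Longrightarrow> x k = y k) \<Longrightarrow> nrm K x = nrm K y"
  unfolding nrm_def by (intro L2_set_cong) auto

lemma nrm_uminus: "nrm K (\<lambda>k. - x k) = nrm K x"
  by (simp add: nrm_def)

lemma nrm_triangle: "nrm K (\<lambda>k. x k + y k) \<le> nrm K x + nrm K y"
  unfolding nrm_def
  by (rule order_trans[OF L2_set_mono L2_set_triangle_ineq]) (auto simp: norm_triangle_ineq)

lemma nrm_triangle_diff: "nrm K (\<lambda>k. x k - y k) \<le> nrm K x + nrm K y"
  using nrm_triangle[of K x "\<lambda>k. - y k"] by (simp add: nrm_uminus)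

lemma nrm_scale: "nrm K (\<lambda>k. c * x k) = cmod c * nrm K x"
  unfolding nrm_def by (simp add: norm_mult L2_set_right_distrib)

lemma nrm_sum: "nrm K (\<lambda>k. \<Sum>i\<in>I. x i k) \<le> (\<Sum>i\<in>I. nrm K (x i))"
proof (induction I rule: infinite_finite_induct)
  case (insert i I)
  then show ?case using nrm_triangle[of K "x i" "\<lambda>k. \<Sum>i\<in>I. x i k"] by simp
qed (auto simp: nrm_def L2_set_def)

lemma nrm_le_l1: "nrm K x \<le> (\<Sum>k\<in>K. cmod (x k))"
  unfolding nrm_def by (rule L2_set_le_sum) auto

lemma cin_self: "cin K x x = of_real ((nrm K x)\<^sup>2)"
  unfolding cin_def nrm_sq of_real_sum by (intro sum.cong refl) (metis complex_norm_square mult.commute)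

lemma cin_cauchy: "cmod (cin K x y) \<le> nrm K x * nrm K y"
proof -
  have "cmod (cin K x y) \<le> (\<Sum>k\<in>K. \<bar>cmod (x k)\<bar> * \<bar>cmod (y k)\<bar>)"
    unfolding cin_def by (rule order_trans[OF norm_sum]) (simp add: norm_mult)
  also have "\<dots> \<le> nrm K x * nrm K y" unfolding nrm_def by (rule L2_set_mult_ineq)
  finally show ?thesis .
qed

lemma cin_commute: "cin K x y = cnj (cin K y x)"
  by (simp add: cin_def mult.commute)

lemma cin_add_right: "cin K x (\<lambda>k. y k + z k) = cin K x y + cin K x z"
  by (simp add: cin_def algebra_simps sum.distrib)

lemma cin_diff_right: "cin K x (\<lambda>k. y k - z k) = cin K x y - cin K x z"
  by (simp add: cin_def algebra_simps sum_subtractf)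

lemma cin_scale_right: "cin K x (\<lambda>k. c * y k) = c * cin K x y"
  by (simp add: cin_def sum_distrib_left algebra_simps)

lemma cin_scale_left: "cin K (\<lambda>k. c * y k) x = cnj c * cin K y x"
  by (simp add: cin_def sum_distrib_left algebra_simps)

lemma cin_sum_right: "cin K x (\<lambda>k. \<Sum>i\<in>I. y i k) = (\<Sum>i\<in>I. cin K x (y i))"
  unfolding cin_def sum_distrib_left by (rule sum.swap)

lemma cin_sum_left: "cin K (\<lambda>k. \<Sum>i\<in>I. y i k) x = (\<Sum>i\<in>I. cin K (y i) x)"
  unfolding cin_def cnj_sum sum_distrib_right by (rule sum.swap)

lemma cin_mv_left: "cin K (mv K X v) w = cin K v (mv K (adj X) w)"
proof -
  have "cin K (mv K X v) w = (\<Sum>j\<in>K. \<Sum>k\<in>K. cnj (X j k) * cnj (v k) * w j)"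
    by (simp add: cin_def mv_def sum_distrib_right)
  also have "\<dots> = (\<Sum>k\<in>K. \<Sum>j\<in>K. cnj (X j k) * cnj (v k) * w j)" by (rule sum.swap)
  also have "\<dots> = cin K v (mv K (adj X) w)"
    by (simp add: cin_def mv_def adj_def sum_distrib_left algebra_simps)
  finally show ?thesis .
qed

lemma mv_mm: "mv K (mm K X Y) v = mv K X (mv K Y v)"
proof
  fix j
  have "mv K (mm K X Y) v j = (\<Sum>k\<in>K. \<Sum>i\<in>K. X j i * Y i k * v k)"
    by (simp add: mv_def mm_def sum_distrib_right)
  also have "\<dots> = (\<Sum>i\<in>K. \<Sum>k\<in>K. X j i * Y i k * v k)" by (rule sum.swap)
  finally show "mv K (mm K X Y) v j = mv K X (mv K Y v) j"
    by (simp add: mv_def sum_distrib_left mult.assoc)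
qed

lemma nrm_mv_le_frobenius: "(nrm K (mv K X v))\<^sup>2 \<le> fip K X X * (nrm K v)\<^sup>2"
proof -
  have "(cmod (mv K X v j))\<^sup>2 \<le> (\<Sum>k\<in>K. (cmod (X j k))\<^sup>2) * (nrm K v)\<^sup>2" for j
  proof -
    have "mv K X v j = cin K (\<lambda>k. cnj (X j k)) v" by (simp add: mv_def cin_def)
    then have "cmod (mv K X v j) \<le> nrm K (\<lambda>k. cnj (X j k)) * nrm K v" using cin_cauchy by metis
    then have "(cmod (mv K X v j))\<^sup>2 \<le> (nrm K (\<lambda>k. cnj (X j k)) * nrm K v)\<^sup>2"
      by (intro power_mono) auto
    then show ?thesis by (simp add: power_mult_distrib nrm_sq)
  qed
  then have "(\<Sum>j\<in>K. (cmod (mv K X v j))\<^sup>2) \<le> (\<Sum>j\<in>K. (\<Sum>k\<in>K. (cmod (X j k))\<^sup>2) * (nrm K v)\<^sup>2)"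
    by (intro sum_mono)
  then show ?thesis by (simp add: nrm_sq[of K "mv K X v"] fip_self sum_distrib_right)
qed

section \<open>Operator norm bounds and Neumann series\<close>

lemma mv_pow: "finite K \<Longrightarrow> j \<in> K \<Longrightarrow> mv K (pow K X q) v j = (mv K X ^^ q) v j"
proof (induction q arbitrary: v)
  case 0
  have "mv K (idm K) v j = (\<Sum>k\<in>K. if k = j then v k else 0)"
    unfolding mv_def idm_def using 0 by (intro sum.cong) auto
  then show ?case using 0 by (simp add: pow_0)
next
  case (Suc q)
  then show ?case by (simp add: pow_Suc mv_mm funpow_swap1)
qed

text \<open>Since \<open>\<parallel>X\<^sup>k\<^sup>+\<^sup>1v\<parallel>\<^sup>2 = \<langle>X\<^sup>kv, X\<^sup>k\<^sup>+\<^sup>2v\<rangle>\<close>, the ratios \<open>\<parallel>X\<^sup>k\<^sup>+\<^sup>1v\<parallel> / \<parallel>X\<^sup>kv\<parallel>\<close> increase with \<open>k\<close>.\<close>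
lemma hermitian_power_norm_growth:
  assumes X: "adj X = X" and d: "0 \<le> d" "d * nrm K v < nrm K (mv K X v)"
  shows "d ^ q * nrm K v \<le> nrm K ((mv K X ^^ q) v)"
proof -
  define u where "u k = nrm K ((mv K X ^^ k) v)" for k
  have lc: "(u (Suc k))\<^sup>2 \<le> u k * u (Suc (Suc k))" for k
  proof -
    let ?w = "(mv K X ^^ k) v"
    have "(u (Suc k))\<^sup>2 = cmod (cin K (mv K X ?w) (mv K X ?w))"
      by (simp add: u_def cin_self norm_power)
    also have "\<dots> = cmod (cin K ?w (mv K X (mv K X ?w)))" by (simp add: cin_mv_left X)
    also have "\<dots> \<le> u k * u (Suc (Suc k))" unfolding u_def using cin_cauchy[of K ?w] by simp
    finally show ?thesis .
  qed
  \<comment> \<open>The strict inequality is carried along because it keeps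
    \<open>u (Suc k)\<close>, and by log-convexity also \<open>u k\<close>, positive;
    \<open>u k\<close> can then be cancelled.\<close>
  have "d * u k < u (Suc k) \<and> 0 \<le> u k" for k
  proof (induction k)
    case 0
    then show ?case using d by (simp add: u_def)
  next
    case (Suc k)
    have p: "u (Suc k) > 0" using Suc d by (smt (verit) mult_nonneg_nonneg)
    have "u k \<noteq> 0"
      using lc[of k] p by auto
    then have k: "u k > 0" using Suc by linarith
    have "d * u k * u (Suc k) < u (Suc k) * u (Suc k)" using Suc p by (intro mult_strict_right_mono) auto
    also have "\<dots> \<le> u k * u (Suc (Suc k))" using lc[of k] by (simp add: power2_eq_square)
    finally show ?case using k p by (simp add: mult.assoc mult.left_commute)
  qed
  then have step: "d * u k \<le> u (Suc k)" for k by (simp add: less_imp_le)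
  have "d ^ q * u 0 \<le> u q"
  proof (induction q)
    case (Suc q)
    have "d ^ Suc q * u 0 \<le> d * u q" using mult_left_mono[OF Suc d(1)] by (simp add: mult.assoc)
    then show ?case using step[of q] by linarith
  qed simp
  then show ?thesis by (simp add: u_def)
qed

text \<open>A substitute for the spectral theorem: a vector stretched by more than \<open>d\<close>
  under \<open>X\<close> is stretched by at least \<open>d ^ q\<close> under the q-th power, whereas
  the Frobenius norm of that power bounds the stretch. For Hermitian \<open>X\<close> supported on
  \<open>K\<close>, the quantity in the hypothesis is tr X^(2q).\<close>

lemma hermitian_norm_le_of_pow:
  assumes K: "finite K" and X: "adj X = X" and d: "0 < d" and q: "fip K (pow K X q) (pow K X q) < (d ^ q)\<^sup>2"
  shows "nrm K (mv K X v) \<le> d * nrm K v"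
proof (rule ccontr)
  assume *: "\<not> ?thesis"
  then have "nrm K v \<noteq> 0"
  proof (rule contrapos_nn)
    assume "nrm K v = 0"
    then show "nrm K (mv K X v) \<le> d * nrm K v" using nrm_mv_le_frobenius[of K X v] by simp
  qed
  then have v: "nrm K v > 0" using nrm_nonneg[of K v] by linarith
  have "(d ^ q * nrm K v)\<^sup>2 \<le> (nrm K ((mv K X ^^ q) v))\<^sup>2"
    using hermitian_power_norm_growth[OF X, of d K v q] * d by (intro power_mono) auto
  also have "nrm K ((mv K X ^^ q) v) = nrm K (mv K (pow K X q) v)"
    by (intro nrm_cong) (simp add: mv_pow K)
  also have "(nrm K (mv K (pow K X q) v))\<^sup>2 \<le> fip K (pow K X q) (pow K X q) * (nrm K v)\<^sup>2"
    by (rule nrm_mv_le_frobenius)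
  also have "\<dots> < (d ^ q)\<^sup>2 * (nrm K v)\<^sup>2" using q v by (intro mult_strict_right_mono) auto
  finally show False by (simp add: power_mult_distrib)
qed

text \<open>Truncated Neumann series for \<open>(I + X)\<^sup>-\<^sup>1\<close>. Unlike the inverse, it is a polynomial in the entries
  of \<open>X\<close>, hence measurable.\<close>
definition neumann :: "'a set \<Rightarrow> ('a \<Rightarrow> 'a \<Rightarrow> complex) \<Rightarrow> nat \<Rightarrow> ('a \<Rightarrow> complex) \<Rightarrow> 'a \<Rightarrow> complex" where
  "neumann K X N v = (\<lambda>j. \<Sum>i\<le>N. (-1) ^ i * (mv K X ^^ i) v j)"

lemma nrm_mv_funpow_le:
  assumes "\<And>v. nrm K (mv K X v) \<le> d * nrm K v" "0 \<le> d"
  shows "nrm K ((mv K X ^^ i) v) \<le> d ^ i * nrm K v"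
proof (induction i)
  case (Suc i)
  show ?case using assms(1)[of "(mv K X ^^ i) v"] mult_left_mono[OF Suc assms(2)] by (simp add: mult.assoc)
qed simp

lemma nrm_neumann_le:
  assumes "\<And>v. nrm K (mv K X v) \<le> 1 / 2 * nrm K v"
  shows "nrm K (neumann K X N v) \<le> 2 * nrm K v"
proof -
  have "nrm K (neumann K X N v) \<le> (\<Sum>i\<le>N. nrm K (\<lambda>j. (-1) ^ i * (mv K X ^^ i) v j))"
    unfolding neumann_def by (rule nrm_sum)
  also have "\<dots> \<le> (\<Sum>i\<le>N. (1 / 2) ^ i * nrm K v)"
    using nrm_mv_funpow_le[of K X "1 / 2", OF assms] by (intro sum_mono) (simp add: nrm_scale norm_power)
  also have "\<dots> = (\<Sum>i<Suc N. (1 / 2) ^ i) * nrm K v" by (simp add: sum_distrib_right lessThan_Suc_atMost)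
  also have "\<dots> \<le> 2 * nrm K v"
    unfolding sum_gp_strict by (intro mult_right_mono) (auto simp: field_simps)
  finally show ?thesis .
qed

lemma neumann_residual:
  "neumann K X N v j + mv K X (neumann K X N v) j = v j + (-1) ^ N * (mv K X ^^ Suc N) v j"
proof -
  have "mv K X (neumann K X N v) j = (\<Sum>i\<le>N. (-1) ^ i * (mv K X ^^ Suc i) v j)"
    unfolding mv_def neumann_def sum_distrib_left
    by (subst sum.swap) (simp add: mv_def sum_distrib_left algebra_simps)
  moreover have "(\<Sum>i\<le>N. (-1) ^ i * (mv K X ^^ i) v j) + (\<Sum>i\<le>N. (-1) ^ i * (mv K X ^^ Suc i) v j)
     = v j + (-1) ^ N * (mv K X ^^ Suc N) v j"
    by (induction N) (simp_all add: algebra_simps)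
  ultimately show ?thesis by (simp add: neumann_def)
qed

text \<open>A polynomial with real coefficients in a Hermitian matrix is Hermitian. This moves the
  Neumann series from the sign vector to a column of H, so that the certificate becomes linear in
  the signs with coefficients that depend on the blocks alone.\<close>

lemma cin_neumann:
  assumes "adj X = X"
  shows "cin K (neumann K X N v) w = cin K v (neumann K X N w)"
proof -
  have "cin K ((mv K X ^^ i) v) w = cin K v ((mv K X ^^ i) w)" for i
    by (induction i arbitrary: v w) (simp_all add: cin_mv_left assms funpow_swap1)
  then show ?thesis unfolding neumann_def cin_sum_left cin_sum_right
    by (simp add: cin_scale_left cin_scale_right)
qed


text \<open>Here \<open>a j\<close> are the columns of A and \<open>d\<close> is the error. Let D be
  its l1 mass off \<open>K\<close> and q its norm on \<open>K\<close>. The certificate bounds D by a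
  multiple of \<eta> plus q + D/2; near-isometry on \<open>K\<close> and the small cross columns
  bound q by 3 \<eta> + 9/32 D. Since 1/2 + 9/32 < 1, both can be solved for.\<close>

lemma recovery_from_certificate:
  fixes W :: "'r set" and a :: "nat \<Rightarrow> 'r \<Rightarrow> complex" and d \<sigma> :: "nat \<Rightarrow> complex" and n :: nat
  defines "H \<equiv> \<lambda>j k. cin W (a j) (a k)"
  assumes K: "K \<subseteq> {..<n}" and X: "\<And>j k. j \<in> K \<Longrightarrow> k \<in> K \<Longrightarrow> X j k = H j k - idm K j k" "adj X = X"
    and X_le: "\<And>v. nrm K (mv K X v) \<le> 1 / 2 * nrm K v"
    and cross: "\<And>j. j \<in> {..<n} - K \<Longrightarrow> nrm K (\<lambda>k. H k j) \<le> 1 / 8"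
    and cert: "\<And>j. j \<in> {..<n} - K \<Longrightarrow> cmod (cin K (neumann K X n (\<lambda>k. H k j)) \<sigma>) \<le> 1 / 2"
    and sign: "\<And>k. k \<in> K \<Longrightarrow> cmod (\<sigma> k) = 1"
    and Ad: "nrm W (\<lambda>r. \<Sum>j<n. a j r * d j) \<le> 2 * \<eta>"
    and cone: "(\<Sum>j\<in>{..<n} - K. cmod (d j)) \<le> cmod (cin K \<sigma> d)"
  shows "nrm {..<n} d \<le> (21 + 36 * sqrt (real (card K))) * \<eta>"
proof -
  have fin: "finite K" using K finite_subset by blast
  define s where "s = sqrt (real (card K))"
  have s0: "0 \<le> s" by (simp add: s_def)
  have ns: "nrm K \<sigma> = s" by (simp add: s_def nrm_def L2_set_def sign)
  define D where "D = (\<Sum>j\<in>{..<n} - K. cmod (d j))"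
  have D0: "0 \<le> D" unfolding D_def by (intro sum_nonneg) auto
  define \<tau> where "\<tau> = neumann K X n \<sigma>"
  \<comment> \<open>The dual vector A_K \<tau>, its image \<open>u\<close> under the adjoint of A,
    and the residual \<open>g\<close> by which \<open>u\<close> misses the signs on
    \<open>K\<close>.\<close>
  define h where "h = (\<lambda>r. \<Sum>k\<in>K. \<tau> k * a k r)"
  define u where "u j = cin W (a j) h" for j
  define g where "g = (\<lambda>j. (-1) ^ n * (mv K X ^^ Suc n) \<sigma> j)"
  have u: "u j = (\<Sum>k\<in>K. H j k * \<tau> k)" for j
    by (simp add: u_def h_def cin_sum_right cin_scale_right H_def mult.commute)
  have HX: "(\<Sum>k\<in>K. H j k * v k) = v j + mv K X v j" if "j \<in> K" for j v
  proof -
    have "(\<Sum>k\<in>K. H j k * v k) = (\<Sum>k\<in>K. (if k = j then v k else 0) + X j k * v k)"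
      using that by (intro sum.cong) (auto simp: X idm_def algebra_simps)
    also have "\<dots> = v j + mv K X v j"
      using that fin by (simp add: sum.distrib mv_def)
    finally show ?thesis .
  qed
  have \<tau>s: "nrm K \<tau> \<le> 2 * s" unfolding \<tau>_def ns[symmetric] by (intro nrm_neumann_le X_le)
  have u_on: "u j = \<sigma> j + g j" if "j \<in> K" for j
    unfolding u HX[OF that] g_def \<tau>_def neumann_residual ..
  \<comment> \<open>This is why \<open>n\<close> is a sufficient truncation order: the residual has
    norm at most sqrt (card K) / 2^(n+1), and card K <= n < 2^n.\<close>
  have "s \<le> 2 ^ Suc n"
  proof -
    have "card K \<le> n" using card_mono[OF _ K] by simp
    then have "real (card K) \<le> 2 ^ n" using of_nat_less_two_power[of n, where 'a=real] by linarith
    also have "\<dots> \<le> (2 ^ Suc n)\<^sup>2"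
      using one_le_power[of "2::real" n] by (simp add: power_mult_distrib power2_eq_square, linarith)
    finally show ?thesis unfolding s_def by (intro real_le_lsqrt) auto
  qed
  then have "(1 / 2) ^ Suc n * s \<le> (1 / 2) ^ Suc n * 2 ^ Suc n" by (intro mult_left_mono) auto
  then have "(1 / 2) ^ Suc n * s \<le> 1" by (simp add: power_mult_distrib[symmetric] del: power_Suc)
  then have g: "nrm K g \<le> 1"
    using nrm_mv_funpow_le[OF X_le, of "Suc n" \<sigma>]
    by (simp add: g_def nrm_scale norm_power ns del: funpow.simps power_Suc)
  have "nrm K u \<le> nrm K \<tau> + nrm K (mv K X \<tau>)"
    using nrm_triangle[of K \<tau> "mv K X \<tau>"] by (subst nrm_cong[of K u "\<lambda>j. \<tau> j + mv K X \<tau> j"]) (auto simp: u HX)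
  then have nu: "nrm K u \<le> 3 * s" using X_le[of \<tau>] \<tau>s by linarith
  have "cin W h h = cin K \<tau> u"
  proof -
    have "cin W h h = (\<Sum>k\<in>K. cnj (\<tau> k) * cin W (a k) h)"
      by (subst (1) h_def) (simp add: cin_sum_left cin_scale_left)
    then show ?thesis by (simp add: cin_def[of K] u_def)
  qed
  then have "(nrm W h)\<^sup>2 = cmod (cin K \<tau> u)" by (metis cin_self norm_of_real abs_of_nonneg zero_le_power2)
  also have "\<dots> \<le> nrm K \<tau> * nrm K u" by (rule cin_cauchy)
  also have "\<dots> \<le> (2 * s) * (3 * s)" using \<tau>s nu s0 by (intro mult_mono) auto
  also have "\<dots> \<le> (3 * s)\<^sup>2" by (simp add: power2_eq_square)
  finally have nh: "nrm W h \<le> 3 * s" by (rule power2_le_imp_le) (simp add: s0)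
  have u_off: "cmod (u j) \<le> 1 / 2" if "j \<in> {..<n} - K" for j
  proof -
    have "u j = cin K (\<lambda>k. H k j) \<tau>"
      unfolding u cin_def[of K] H_def by (intro sum.cong refl) (simp add: cin_commute[of W "a j"])
    also have "\<dots> = cin K (neumann K X n (\<lambda>k. H k j)) \<sigma>" unfolding \<tau>_def by (simp add: cin_neumann X)
    finally show ?thesis using cert[OF that] by simp
  qed
  define y where "y = (\<lambda>r. \<Sum>j<n. d j * a j r)"
  have ny: "nrm W y \<le> 2 * \<eta>" using Ad by (simp add: y_def mult.commute)
  have split: "(\<Sum>j<n. f j) = (\<Sum>j\<in>K. f j) + (\<Sum>j\<in>{..<n} - K. f j)" for f :: "nat \<Rightarrow> complex"
    using sum.subset_diff[OF K, of f] by simp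
  \<comment> \<open>Pairing A d with \<open>h\<close> in two ways isolates the sign product on
    \<open>K\<close>: what remains is a noise term, the residual and the part off \<open>K\<close>,
    where the certificate is at most 1/2.\<close>
  have "cin W h y = (\<Sum>j<n. cnj (u j) * d j)"
    unfolding y_def cin_sum_right cin_scale_right u_def by (simp add: cin_commute[of W h] mult.commute)
  also have "\<dots> = cin K \<sigma> d + cin K g d + (\<Sum>j\<in>{..<n} - K. cnj (u j) * d j)"
    unfolding split cin_def by (simp add: u_on algebra_simps sum.distrib)
  finally have "cin K \<sigma> d = cin W h y - cin K g d - (\<Sum>j\<in>{..<n} - K. cnj (u j) * d j)" by simp
  then have "cmod (cin K \<sigma> d) \<le> cmod (cin W h y) + cmod (cin K g d) + cmod (\<Sum>j\<in>{..<n} - K. cnj (u j) * d j)"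
    by (metis (no_types) add_mono_thms_linordered_semiring(3) norm_triangle_ineq4 order_trans)
  moreover have "cmod (cin W h y) \<le> 3 * s * (2 * \<eta>)"
    using cin_cauchy[of W h y] mult_mono[OF nh ny] s0 by simp
  moreover have "cmod (cin K g d) \<le> nrm K d"
    using cin_cauchy[of K g d] mult_right_mono[OF g, of "nrm K d"] by simp
  moreover have "cmod (\<Sum>j\<in>{..<n} - K. cnj (u j) * d j) \<le> D / 2"
  proof -
    have "cmod (\<Sum>j\<in>{..<n} - K. cnj (u j) * d j) \<le> (\<Sum>j\<in>{..<n} - K. 1 / 2 * cmod (d j))"
      using u_off by (intro sum_norm_le) (simp add: norm_mult mult_right_mono del: times_divide_eq_left)
    then show ?thesis by (simp add: D_def sum_divide_distrib)
  qed
  ultimately have D1: "D \<le> 6 * s * \<eta> + nrm K d + D / 2" using cone unfolding D_def[symmetric] by simp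
  \<comment> \<open>Second inequality: \<open>z\<close> is the part of A d coming from
    \<open>K\<close>. Its norm \<open>p\<close> controls \<open>q\<close> from above, and
    \<open>p\<close> in turn is bounded by pairing \<open>z\<close> with A d minus the columns off
    \<open>K\<close>.\<close>
  define z where "z = (\<lambda>r. \<Sum>k\<in>K. d k * a k r)"
  define p where "p = nrm W z"
  define q where "q = nrm K d"
  have p0: "0 \<le> p" and q0: "0 \<le> q" by (auto simp: p_def q_def)
  have cz: "cin W z z = cin K d (\<lambda>j. d j + mv K X d j)"
  proof -
    have "cin W z z = (\<Sum>j\<in>K. cnj (d j) * (\<Sum>k\<in>K. H j k * d k))"
      unfolding z_def cin_sum_left cin_scale_left cin_sum_right cin_scale_right H_def by (simp add: mult.commute)
    then show ?thesis by (simp add: HX cin_def)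
  qed
  have "q\<^sup>2 = cmod (cin K d d)" by (simp add: cin_self q_def norm_power)
  also have "cin K d d = cin W z z - cin K d (mv K X d)" unfolding cz cin_add_right by simp
  also have "cmod \<dots> \<le> cmod (cin W z z) + cmod (cin K d (mv K X d))" by (rule norm_triangle_ineq4)
  also have "cmod (cin W z z) = p\<^sup>2" by (simp add: cin_self p_def norm_power)
  also have "cmod (cin K d (mv K X d)) \<le> q * (1 / 2 * q)"
    using cin_cauchy[of K d "mv K X d"] mult_left_mono[OF X_le[of d] q0] unfolding q_def by linarith
  finally have "q\<^sup>2 \<le> 2 * p\<^sup>2" by (simp add: power2_eq_square)
  \<comment> \<open>Rounding 2 up to 9/4 avoids a square root.\<close>
  also have "\<dots> \<le> (3 / 2 * p)\<^sup>2" by (simp add: power2_eq_square)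
  finally have qp: "q \<le> 3 / 2 * p" by (rule power2_le_imp_le) (simp add: p0)
  have zy: "z = (\<lambda>r. y r - (\<Sum>j\<in>{..<n} - K. d j * a j r))" by (simp add: z_def y_def split)
  have "p\<^sup>2 = cmod (cin W z z)" by (simp add: cin_self p_def norm_power)
  also have "cin W z z = cin W z y - (\<Sum>j\<in>{..<n} - K. d j * cin W z (a j))"
    by (subst (2) zy) (simp add: cin_diff_right cin_sum_right cin_scale_right)
  also have "cmod \<dots> \<le> cmod (cin W z y) + cmod (\<Sum>j\<in>{..<n} - K. d j * cin W z (a j))"
    by (rule norm_triangle_ineq4)
  also have "cmod (cin W z y) \<le> p * (2 * \<eta>)"
    using cin_cauchy[of W z y] mult_left_mono[OF ny p0] unfolding p_def by linarith
  also have "cmod (\<Sum>j\<in>{..<n} - K. d j * cin W z (a j)) \<le> (\<Sum>j\<in>{..<n} - K. cmod (d j) * (q / 8))"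
  proof (intro sum_norm_le)
    fix j assume j: "j \<in> {..<n} - K"
    have "cin W z (a j) = cin K d (\<lambda>k. H k j)"
      unfolding z_def cin_sum_left cin_scale_left by (simp add: cin_def[of K] H_def)
    then have "cmod (cin W z (a j)) \<le> q * (1 / 8)"
      using cin_cauchy[of K d "\<lambda>k. H k j"] mult_left_mono[OF cross[OF j] q0] unfolding q_def by simp
    then show "cmod (d j * cin W z (a j)) \<le> cmod (d j) * (q / 8)"
      by (simp add: norm_mult mult_left_mono del: times_divide_eq_right)
  qed
  also have "(\<Sum>j\<in>{..<n} - K. cmod (d j) * (q / 8)) = D * (q / 8)" by (simp add: D_def sum_distrib_right)
  also have "D * (q / 8) \<le> D * (3 / 2 * p / 8)" using qp D0 by (intro mult_left_mono) auto
  finally have "p * p \<le> p * (2 * \<eta> + 3 / 16 * D)" by (simp add: power2_eq_square algebra_simps)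
  moreover have \<eta>0: "0 \<le> \<eta>" using ny nrm_nonneg[of W y] by linarith
  ultimately have "p \<le> 2 * \<eta> + 3 / 16 * D"
    using p0 D0 by (cases "p = 0") (auto simp: mult_le_cancel_left)
  then have q1: "q \<le> 3 * \<eta> + 9 / 32 * D" using qp by linarith
  have s\<eta>: "0 \<le> s * \<eta>" using s0 \<eta>0 by simp
  have "nrm {..<n} d \<le> q + D"
  proof -
    define d1 where "d1 j = (if j \<in> K then d j else 0)" for j
    define d2 where "d2 j = (if j \<in> K then 0 else d j)" for j
    have "d = (\<lambda>j. d1 j + d2 j)" by (simp add: d1_def d2_def fun_eq_iff)
    then have "nrm {..<n} d \<le> nrm {..<n} d1 + nrm {..<n} d2" using nrm_triangle by metis
    moreover have "nrm {..<n} d1 = q"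
      unfolding q_def nrm_def L2_set_def
      by (rule arg_cong[where f=sqrt], rule sum.mono_neutral_cong_right) (use K in \<open>auto simp: d1_def\<close>)
    moreover have "(\<Sum>j<n. cmod (d2 j)) = D"
      unfolding D_def by (rule sum.mono_neutral_cong_right) (auto simp: d2_def)
    ultimately show ?thesis using nrm_le_l1[of "{..<n}" d2] by linarith
  qed
  \<comment> \<open>The two bounds give 7/32 D <= (6 s + 3) \<eta>. Hence q + D <= 3 \<eta> + 41/32
    D <= (144/7 + 246/7 s) \<eta>, and the coefficients are rounded up to 21 and 36.\<close>
  also have "q + D \<le> 21 * \<eta> + 36 * (s * \<eta>)" using D1 q1 s\<eta> \<eta>0 unfolding q_def[symmetric] by (simp add: mult.assoc)
  finally show ?thesis unfolding s_def by (simp add: algebra_simps)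
qed

section \<open>A convexity bound for the hyperbolic cosine\<close>

lemma convex_power_nonneg: "convex_on {0..} (\<lambda>x::real. x ^ k)"
proof (cases "even k")
  case True
  show ?thesis by (rule convex_on_subset[OF convex_power_even[OF True]]) auto
qed (rule convex_power_odd)

text \<open>The power series of cosh (sqrt y) has the nonnegative coefficients 1 / (2k)!, so
  convexity is inherited termwise from the powers of y.\<close>

lemma cosh_sqrt_convex:
  fixes u v t :: real
  assumes "0 \<le> u" "0 \<le> v" "0 \<le> t" "t \<le> 1"
  shows "cosh (sqrt ((1 - t) * u + t * v)) \<le> (1 - t) * cosh (sqrt u) + t * cosh (sqrt v)"
proof -
  have s: "(\<lambda>k. y ^ k / fact (2 * k)) sums cosh (sqrt y)" if "y \<ge> 0" for y :: real
  proof -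
    have "(\<lambda>n. if even n then sqrt y ^ n /\<^sub>R fact n else 0) sums cosh (sqrt y)" by (rule cosh_converges)
    then have "(\<lambda>n. if even (2*n) then sqrt y ^ (2*n) /\<^sub>R fact (2*n) else 0) sums cosh (sqrt y)"
      by (subst sums_mono_reindex[of "\<lambda>n. 2 * n" "\<lambda>n. if even n then sqrt y ^ n /\<^sub>R fact n else 0"])
         (auto simp: strict_mono_def elim!: evenE)
    then show ?thesis using that by (simp add: power_mult real_sqrt_pow2 scaleR_conv_of_real divide_inverse mult.commute[of _ "inverse _"])
  qed
  have "(\<lambda>k. (1 - t) * (u ^ k / fact (2 * k)) + t * (v ^ k / fact (2 * k))) sums
     ((1 - t) * cosh (sqrt u) + t * cosh (sqrt v))"
    by (intro sums_add sums_mult s assms)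
  moreover have "((1 - t) * u + t * v) ^ k / fact (2 * k)
     \<le> (1 - t) * (u ^ k / fact (2 * k)) + t * (v ^ k / fact (2 * k))" for k
  proof -
    have "((1 - t) * u + t * v) ^ k \<le> (1 - t) * u ^ k + t * v ^ k"
      using convex_onD[OF convex_power_nonneg, of t u v] assms by simp
    then have "((1 - t) * u + t * v) ^ k / fact (2 * k) \<le> ((1 - t) * u ^ k + t * v ^ k) / fact (2 * k)"
      by (rule divide_right_mono) simp
    then show ?thesis by (simp add: add_divide_distrib)
  qed
  moreover have "(\<lambda>k. ((1 - t) * u + t * v) ^ k / fact (2 * k)) sums cosh (sqrt ((1 - t) * u + t * v))"
    using assms by (intro s) auto
  ultimately show ?thesis by (metis (no_types, lifting) sums_le)
qed

lemma x_le_sinh_real: "0 \<le> x \<Longrightarrow> x \<le> sinh x" for x :: real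
proof -
  assume x: "0 \<le> x"
  have "(\<lambda>x. sinh x - x) x \<ge> (\<lambda>x. sinh x - x) (0::real)"
    using x by (rule DERIV_nonneg_imp_nondecreasing) (auto intro!: derivative_eq_intros exI simp: cosh_real_ge_1)
  then show ?thesis by simp
qed

lemma exp_minus_self_le: "exp x - x \<le> exp (x\<^sup>2)" if "0 \<le> x" for x :: real
proof (cases "x \<le> 1")
  case True
  have "exp x \<le> 1 + x + x\<^sup>2" using that True by (intro exp_bound)
  also have "\<dots> \<le> exp (x\<^sup>2) + x" using exp_ge_add_one_self[of "x\<^sup>2"] by simp
  finally show ?thesis by simp
next
  case False
  then have "x \<le> x\<^sup>2" by (simp add: power2_eq_square)
  then have "exp x \<le> exp (x\<^sup>2)" by simp
  then show ?thesis using that by linarith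
qed

text \<open>For vectors of norms \<open>a\<close> and \<open>b\<close> with real inner product
  \<open>q\<close>, the square root is the norm of their sum. By convexity the left side lies below
  the chord between q = -ab and q = ab. Replacing sinh b by b in its slope leaves an error of at
  most cosh a (sinh b - b) and makes the slope independent of \<open>b\<close>.\<close>

lemma cosh_sqrt_linear_bound:
  fixes a b q :: real
  assumes "0 \<le> a" "0 \<le> b" "\<bar>q\<bar> \<le> a * b"
  shows "cosh (sqrt (a\<^sup>2 + 2 * q + b\<^sup>2)) \<le> cosh a * (exp b - b) + q * (sinh a / a)"
proof (cases "a = 0 \<or> b = 0")
  case True
  \<comment> \<open>For \<open>a = 0\<close> the quotient \<open>sinh a / a\<close> is 0 by
    convention; it is multiplied by \<open>q = 0\<close> anyway.\<close>
  then have "q = 0" using assms by auto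
  moreover have "cosh b \<le> exp b - b" using assms(2)
    using x_le_sinh_real[OF assms(2)] cosh_plus_sinh[of b] by linarith
  ultimately show ?thesis using True assms by auto
next
  case False
  then have ab: "a > 0" "b > 0" using assms by auto
  \<comment> \<open>The cosine of the angle between the two vectors; the chord weights are (1 - c)/2
    and (1 + c)/2.\<close>
  define c where "c = q / (a * b)"
  have q: "q = a * b * c" using ab by (simp add: c_def)
  have c: "-1 \<le> c" "c \<le> 1" using assms ab unfolding c_def by (auto simp: field_simps abs_le_iff)
  define t where "t = (1 + c) / 2"
  have t: "0 \<le> t" "t \<le> 1" using c by (auto simp: t_def)
  have "cosh (sqrt (a\<^sup>2 + 2 * q + b\<^sup>2)) = cosh (sqrt ((1 - t) * (a - b)\<^sup>2 + t * (a + b)\<^sup>2))"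
    by (rule arg_cong[where f="\<lambda>x. cosh (sqrt x)"]) (simp add: t_def q power2_eq_square field_simps)
  also have "\<dots> \<le> (1 - t) * cosh (sqrt ((a - b)\<^sup>2)) + t * cosh (sqrt ((a + b)\<^sup>2))"
    by (intro cosh_sqrt_convex t) auto
  also have "\<dots> = (1 - t) * cosh (a - b) + t * cosh (a + b)"
    using ab by (simp add: cosh_real_abs)
  also have "\<dots> = cosh a * cosh b + c * (sinh a * sinh b)"
    by (simp add: cosh_add cosh_diff t_def field_simps)
  also have "\<dots> = cosh a * cosh b + c * sinh a * b + c * (sinh a * (sinh b - b))"
    by (simp add: algebra_simps)
  also have "c * (sinh a * (sinh b - b)) \<le> cosh a * (sinh b - b)"
  proof -
    have "sinh b - b \<ge> 0" using ab by (simp add: x_le_sinh_real)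
    have "c * sinh a \<le> 1 * cosh a"
      using c ab sinh_le_cosh_real[of a] by (intro mult_mono) auto
    then show ?thesis using \<open>sinh b - b \<ge> 0\<close> mult_right_mono by (metis mult.assoc mult_1)
  qed
  also have "cosh a * cosh b + c * sinh a * b + cosh a * (sinh b - b) = cosh a * (exp b - b) + q * (sinh a / a)"
    using ab unfolding q cosh_plus_sinh[of b, symmetric] by (simp add: field_simps)
  finally show ?thesis by simp
qed

section \<open>Concentration of sums of independent random vectors\<close>

text \<open>The increment \<open>v\<close> enters the last term linearly, so that term vanishes on
  integration over a centred \<open>v\<close>, and only a scalar factor multiplies
  \<open>cosh (nrm K x)\<close>.\<close>

lemma cosh_nrm_add_le:
  "cosh (nrm K (\<lambda>k. x k + v k)) \<le> cosh (nrm K x) * (exp (nrm K v) - nrm K v)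
     + Re (cin K x v) * (sinh (nrm K x) / nrm K x)"
proof -
  have "(nrm K (\<lambda>k. x k + v k))\<^sup>2 = (nrm K x)\<^sup>2 + 2 * Re (cin K x v) + (nrm K v)\<^sup>2"
  proof -
    have "(cmod (x k + v k))\<^sup>2 = (cmod (x k))\<^sup>2 + 2 * Re (cnj (x k) * v k) + (cmod (v k))\<^sup>2" for k
      by (simp add: cmod_power2, simp add: power2_eq_square algebra_simps)
    then show ?thesis by (simp add: nrm_sq cin_def sum.distrib sum_distrib_left)
  qed
  then have "nrm K (\<lambda>k. x k + v k) = sqrt ((nrm K x)\<^sup>2 + 2 * Re (cin K x v) + (nrm K v)\<^sup>2)"
    by (metis nrm_nonneg real_sqrt_unique)
  moreover have "\<bar>Re (cin K x v)\<bar> \<le> nrm K x * nrm K v"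
    using abs_Re_le_cmod cin_cauchy order_trans by blast
  ultimately show ?thesis using cosh_sqrt_linear_bound[of "nrm K x" "nrm K v"] by simp
qed

lemma borel_measurable_cosh:
  fixes f :: "'b \<Rightarrow> real"
  assumes "f \<in> borel_measurable M" shows "(\<lambda>x. cosh (f x)) \<in> borel_measurable M"
  using assms unfolding cosh_def by measurable

lemma borel_measurable_nrm:
  assumes "\<And>k. k \<in> K \<Longrightarrow> (\<lambda>b. Y b k) \<in> borel_measurable M"
  shows "(\<lambda>b. nrm K (Y b)) \<in> borel_measurable M"
  using assms unfolding nrm_def L2_set_def by measurable

lemma nn_integral_cosh_nrm_add_le:
  fixes Y :: "'b \<Rightarrow> 'a \<Rightarrow> complex"
  assumes M: "prob_space M"
    and Y: "\<And>k. k \<in> K \<Longrightarrow> integrable M (\<lambda>b. Y b k)" "\<And>k. k \<in> K \<Longrightarrow> (\<integral>b. Y b k \<partial>M) = 0"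
    and e: "integrable M (\<lambda>b. exp (nrm K (Y b)) - nrm K (Y b))"
    and c: "(\<integral>b. exp (nrm K (Y b)) - nrm K (Y b) \<partial>M) \<le> c"
  shows "(\<integral>\<^sup>+b. ennreal (cosh (nrm K (\<lambda>k. x k + Y b k))) \<partial>M) \<le> ennreal (c * cosh (nrm K x))"
proof -
  interpret prob_space M by fact
  let ?m = "\<lambda>b. cosh (nrm K x) * (exp (nrm K (Y b)) - nrm K (Y b))
     + Re (cin K x (Y b)) * (sinh (nrm K x) / nrm K x)"
  have ci: "integrable M (\<lambda>b. cin K x (Y b))" unfolding cin_def using Y by auto
  then have cr: "integrable M (\<lambda>b. Re (cin K x (Y b)))" by (rule integrable_Re)
  have "(\<integral>b. cin K x (Y b) \<partial>M) = 0" unfolding cin_def using Y by (subst Bochner_Integration.integral_sum) auto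
  then have c0: "(\<integral>b. Re (cin K x (Y b)) \<partial>M) = 0" using integral_Re[OF ci] by simp
  have im: "integrable M ?m" using e cr by (intro Bochner_Integration.integrable_add integrable_mult_right integrable_mult_left)
  have le: "cosh (nrm K (\<lambda>k. x k + Y b k)) \<le> ?m b" for b by (rule cosh_nrm_add_le)
  have pos: "0 \<le> ?m b" for b using le[of b] cosh_real_pos[of "nrm K (\<lambda>k. x k + Y b k)"] by linarith
  have "(\<integral>\<^sup>+b. ennreal (cosh (nrm K (\<lambda>k. x k + Y b k))) \<partial>M) \<le> (\<integral>\<^sup>+b. ennreal (?m b) \<partial>M)"
    by (intro nn_integral_mono ennreal_leI le)
  also have "\<dots> = ennreal (\<integral>b. ?m b \<partial>M)" using im pos by (intro nn_integral_eq_integral) auto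
  also have "(\<integral>b. ?m b \<partial>M) = cosh (nrm K x) * (\<integral>b. exp (nrm K (Y b)) - nrm K (Y b) \<partial>M)"
    using e cr c0 by (simp add: Bochner_Integration.integral_add integrable_mult_right integrable_mult_left
      Bochner_Integration.integral_mult_right_zero Bochner_Integration.integral_mult_left_zero
      del: Bochner_Integration.integral_diff)
  also have "ennreal \<dots> \<le> ennreal (c * cosh (nrm K x))"
    using c by (intro ennreal_leI) (simp add: mult.commute[of c] mult_left_mono)
  finally show ?thesis .
qed

lemma measurable_PiM_component_comp:
  "f \<in> borel_measurable (M i) \<Longrightarrow> i \<in> I \<Longrightarrow> (\<lambda>\<omega>. f (\<omega> i)) \<in> borel_measurable (PiM I M)"
  by (rule measurable_compose[OF measurable_component_singleton])

text \<open>This is Pinelis' inequality, obtained by integrating out one coordinate at a time with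
  the others frozen in \<open>x\<close>. Nonnegative integrals spare a proof that the hyperbolic
  cosine of the whole sum is integrable.\<close>

lemma nn_integral_cosh_nrm_sum_le:
  fixes Y :: "'i \<Rightarrow> 'b \<Rightarrow> 'a \<Rightarrow> complex"
  assumes M: "\<And>i. prob_space (M i)" and "finite I"
    and "\<And>i k. i \<in> I \<Longrightarrow> k \<in> K \<Longrightarrow> integrable (M i) (\<lambda>b. Y i b k)"
    and "\<And>i k. i \<in> I \<Longrightarrow> k \<in> K \<Longrightarrow> (\<integral>b. Y i b k \<partial>M i) = 0"
    and "\<And>i. i \<in> I \<Longrightarrow> integrable (M i) (\<lambda>b. exp (nrm K (Y i b)) - nrm K (Y i b))"
    and "\<And>i. i \<in> I \<Longrightarrow> (\<integral>b. exp (nrm K (Y i b)) - nrm K (Y i b) \<partial>M i) \<le> c i"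
    and "\<And>i. i \<in> I \<Longrightarrow> 0 \<le> c i"
  shows "(\<integral>\<^sup>+\<omega>. ennreal (cosh (nrm K (\<lambda>k. \<Sum>i\<in>I. Y i (\<omega> i) k))) \<partial>PiM I M) \<le> ennreal (\<Prod>i\<in>I. c i)"
  using assms(2-)
proof (induction I rule: finite_induct)
  interpret product_prob_space M by (simp add: M product_prob_space_def product_sigma_finite_def
    prob_space_imp_sigma_finite product_prob_space_axioms_def)
  case empty
  show ?case by (simp add: nrm_def L2_set_def PiM_empty nn_integral_count_space_finite)
next
  interpret product_prob_space M by (simp add: M product_prob_space_def product_sigma_finite_def
    prob_space_imp_sigma_finite product_prob_space_axioms_def)
  case (insert i I)
  let ?f = "\<lambda>\<omega>. ennreal (cosh (nrm K (\<lambda>k. \<Sum>i\<in>insert i I. Y i (\<omega> i) k)))"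
  have "?f \<in> borel_measurable (PiM (insert i I) M)"
    by (intro measurable_compose[OF _ measurable_ennreal] borel_measurable_cosh borel_measurable_nrm
        borel_measurable_sum measurable_PiM_component_comp)
      (use insert.prems in auto)
  then have "(\<integral>\<^sup>+\<omega>. ?f \<omega> \<partial>PiM (insert i I) M) = (\<integral>\<^sup>+\<omega>. (\<integral>\<^sup>+b. ?f (fun_upd \<omega> i b) \<partial>M i) \<partial>PiM I M)"
    by (intro product_nn_integral_insert insert.hyps)
  also have "\<dots> \<le> (\<integral>\<^sup>+\<omega>. ennreal (c i * cosh (nrm K (\<lambda>k. \<Sum>i\<in>I. Y i (\<omega> i) k))) \<partial>PiM I M)"
  proof (rule nn_integral_mono)
    fix \<omega>
    have "?f (fun_upd \<omega> i b) = ennreal (cosh (nrm K (\<lambda>k. (\<Sum>i\<in>I. Y i (\<omega> i) k) + Y i b k)))" for b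
    proof -
      have "(\<Sum>l\<in>I. Y l ((fun_upd \<omega> i b) l) k) = (\<Sum>i\<in>I. Y i (\<omega> i) k)" for k
        using insert.hyps by (intro sum.cong) auto
      then show ?thesis using insert.hyps by (simp add: add.commute)
    qed
    then show "(\<integral>\<^sup>+b. ?f (fun_upd \<omega> i b) \<partial>M i) \<le> ennreal (c i * cosh (nrm K (\<lambda>k. \<Sum>i\<in>I. Y i (\<omega> i) k)))"
      using insert.prems M by (simp only:) (intro nn_integral_cosh_nrm_add_le, auto)
  qed
  also have "\<dots> = ennreal (c i) * (\<integral>\<^sup>+\<omega>. ennreal (cosh (nrm K (\<lambda>k. \<Sum>i\<in>I. Y i (\<omega> i) k))) \<partial>PiM I M)"
    using insert.prems(5)[of i]
    by (subst nn_integral_cmult[symmetric]) (use insert.prems in \<open>auto simp: ennreal_mult cosh_real_nonneg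
      intro!: measurable_compose[OF _ measurable_ennreal] borel_measurable_cosh borel_measurable_nrm
        borel_measurable_sum measurable_PiM_component_comp\<close>)
  also have "\<dots> \<le> ennreal (c i) * ennreal (\<Prod>i\<in>I. c i)"
    using insert.prems by (intro mult_left_mono insert.IH) auto
  also have "\<dots> = ennreal (\<Prod>i\<in>insert i I. c i)"
    using insert.hyps insert.prems by (simp add: ennreal_mult prod_nonneg)
  finally show ?case .
qed

text \<open>Markov's inequality for cosh; the factor 2 comes from cosh t >= exp t / 2.\<close>

lemma prob_nrm_sum_ge_le:
  fixes Y :: "'i \<Rightarrow> 'b \<Rightarrow> 'a \<Rightarrow> complex"
  assumes M: "\<And>i. prob_space (M i)" and I: "finite I"
    and int: "\<And>i k. i \<in> I \<Longrightarrow> k \<in> K \<Longrightarrow> integrable (M i) (\<lambda>b. Y i b k)"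
    and zero: "\<And>i k. i \<in> I \<Longrightarrow> k \<in> K \<Longrightarrow> (\<integral>b. Y i b k \<partial>M i) = 0"
    and e: "\<And>i. i \<in> I \<Longrightarrow> integrable (M i) (\<lambda>b. exp (nrm K (Y i b)) - nrm K (Y i b))"
    and c: "\<And>i. i \<in> I \<Longrightarrow> (\<integral>b. exp (nrm K (Y i b)) - nrm K (Y i b) \<partial>M i) \<le> exp (c i)"
    and t: "0 \<le> t"
  shows "measure (PiM I M) {\<omega>\<in>space (PiM I M). t \<le> nrm K (\<lambda>k. \<Sum>i\<in>I. Y i (\<omega> i) k)}
     \<le> 2 * exp ((\<Sum>i\<in>I. c i) - t)"
proof -
  interpret product_prob_space M by (simp add: M product_prob_space_def product_sigma_finite_def
    prob_space_imp_sigma_finite product_prob_space_axioms_def)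
  interpret P: prob_space "PiM I M" by (intro prob_space_PiM M)
  let ?n = "\<lambda>\<omega>. nrm K (\<lambda>k. \<Sum>i\<in>I. Y i (\<omega> i) k)"
  have meas: "?n \<in> borel_measurable (PiM I M)"
    by (intro borel_measurable_nrm borel_measurable_sum measurable_PiM_component_comp) (use int in auto)
  let ?A = "{\<omega>\<in>space (PiM I M). t \<le> ?n \<omega>}"
  have "ennreal (cosh t) * emeasure (PiM I M) ?A = (\<integral>\<^sup>+\<omega>. ennreal (cosh t) * indicator ?A \<omega> \<partial>PiM I M)"
    using meas by (subst nn_integral_cmult_indicator) auto
  also have "\<dots> \<le> (\<integral>\<^sup>+\<omega>. ennreal (cosh (?n \<omega>)) \<partial>PiM I M)"
    using t by (intro nn_integral_mono) (auto simp: indicator_def cosh_real_nonneg_le_iff intro!: ennreal_leI)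
  also have "\<dots> \<le> ennreal (\<Prod>i\<in>I. exp (c i))"
    using assms by (intro nn_integral_cosh_nrm_sum_le) auto
  also have "\<dots> = ennreal (exp (\<Sum>i\<in>I. c i))" using I by (simp add: exp_sum)
  finally have "ennreal (cosh t * measure (PiM I M) ?A) \<le> ennreal (exp (\<Sum>i\<in>I. c i))"
    by (simp add: P.emeasure_eq_measure ennreal_mult cosh_real_nonneg)
  then have "cosh t * measure (PiM I M) ?A \<le> exp (\<Sum>i\<in>I. c i)" by simp
  moreover have "exp t / 2 * measure (PiM I M) ?A \<le> cosh t * measure (PiM I M) ?A"
    by (intro mult_right_mono) (auto simp: cosh_def)
  ultimately show ?thesis by (simp add: exp_diff field_simps)
qed

text \<open>After scaling by \<kappa> the norms lie in [0,1], where exp x - x <= 1 + x^2, so only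
  second moments enter the exponent. The choice of \<kappa> is left to the application.\<close>

lemma vector_bernstein:
  fixes Y :: "'i \<Rightarrow> 'b \<Rightarrow> 'a \<Rightarrow> complex"
  assumes M: "\<And>i. prob_space (M i)" and I: "finite I"
    and int: "\<And>i k. i \<in> I \<Longrightarrow> k \<in> K \<Longrightarrow> integrable (M i) (\<lambda>b. Y i b k)"
    and zero: "\<And>i k. i \<in> I \<Longrightarrow> k \<in> K \<Longrightarrow> (\<integral>b. Y i b k \<partial>M i) = 0"
    and bound: "\<And>i b. i \<in> I \<Longrightarrow> b \<in> space (M i) \<Longrightarrow> \<kappa> * nrm K (Y i b) \<le> 1"
    and var: "(\<Sum>i\<in>I. \<integral>b. (nrm K (Y i b))\<^sup>2 \<partial>M i) \<le> V"
    and t: "0 \<le> t" and \<kappa>: "0 < \<kappa>"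
  shows "measure (PiM I M) {\<omega>\<in>space (PiM I M). t \<le> nrm K (\<lambda>k. \<Sum>i\<in>I. Y i (\<omega> i) k)}
     \<le> 2 * exp (\<kappa>\<^sup>2 * V - \<kappa> * t)"
proof -
  let ?Y = "\<lambda>i b k. of_real \<kappa> * Y i b k"
  let ?v = "\<lambda>i. \<integral>b. (nrm K (Y i b))\<^sup>2 \<partial>M i"
  have n: "nrm K (?Y i b) = \<kappa> * nrm K (Y i b)" for i b using \<kappa> by (simp add: nrm_scale)
  have n2: "nrm K (\<lambda>k. \<Sum>i\<in>I. ?Y i (\<omega> i) k) = \<kappa> * nrm K (\<lambda>k. \<Sum>i\<in>I. Y i (\<omega> i) k)" for \<omega>
    using \<kappa> by (simp add: nrm_scale sum_distrib_left[symmetric])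
  have meas: "(\<lambda>b. nrm K (Y i b)) \<in> borel_measurable (M i)" if "i \<in> I" for i
    using int[OF that] by (intro borel_measurable_nrm) auto
  have pt: "exp (nrm K (?Y i b)) - nrm K (?Y i b) \<le> 1 + \<kappa>\<^sup>2 * (nrm K (Y i b))\<^sup>2"
    if "i \<in> I" "b \<in> space (M i)" for i b
    using exp_bound[of "\<kappa> * nrm K (Y i b)"] bound[OF that] \<kappa> unfolding n by (simp add: power_mult_distrib)
  have nb: "nrm K (Y i b) \<le> 1 / \<kappa>" if "i \<in> I" "b \<in> space (M i)" for i b
    using bound[OF that] \<kappa> by (simp add: field_simps)
  have i2: "integrable (M i) (\<lambda>b. (nrm K (Y i b))\<^sup>2)" if "i \<in> I" for i
  proof -
    interpret prob_space "M i" by (rule M)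
    show ?thesis
    proof (rule integrable_const_bound[where B="(1 / \<kappa>)\<^sup>2"])
      show "AE b in M i. norm ((nrm K (Y i b))\<^sup>2) \<le> (1 / \<kappa>)\<^sup>2"
        using nb[OF that] by (intro AE_I2) (auto intro!: power_mono)
    qed (use meas[OF that] in auto)
  qed
  have e: "integrable (M i) (\<lambda>b. exp (nrm K (?Y i b)) - nrm K (?Y i b))" if "i \<in> I" for i
  proof (rule Bochner_Integration.integrable_bound)
    interpret prob_space "M i" by (rule M)
    show "integrable (M i) (\<lambda>b. 1 + \<kappa>\<^sup>2 * (nrm K (Y i b))\<^sup>2)" using i2[OF that] by simp
    show "AE b in M i. norm (exp (nrm K (?Y i b)) - nrm K (?Y i b)) \<le> norm (1 + \<kappa>\<^sup>2 * (nrm K (Y i b))\<^sup>2)"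
    proof (rule AE_I2)
      fix b assume b: "b \<in> space (M i)"
      have "0 \<le> exp (nrm K (?Y i b)) - nrm K (?Y i b)"
        using exp_ge_add_one_self[of "nrm K (?Y i b)"] by linarith
      then show "norm (exp (nrm K (?Y i b)) - nrm K (?Y i b)) \<le> norm (1 + \<kappa>\<^sup>2 * (nrm K (Y i b))\<^sup>2)"
        using pt[OF that b] by simp
    qed
    show "(\<lambda>b. exp (nrm K (?Y i b)) - nrm K (?Y i b)) \<in> borel_measurable (M i)"
      unfolding n using meas[OF that] by measurable
  qed
  have "measure (PiM I M) {\<omega>\<in>space (PiM I M). \<kappa> * t \<le> nrm K (\<lambda>k. \<Sum>i\<in>I. ?Y i (\<omega> i) k)}
     \<le> 2 * exp ((\<Sum>i\<in>I. \<kappa>\<^sup>2 * ?v i) - \<kappa> * t)"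
  proof (rule prob_nrm_sum_ge_le[OF M I _ _ e])
    fix i assume i: "i \<in> I"
    interpret prob_space "M i" by (rule M)
    have "(\<integral>b. exp (nrm K (?Y i b)) - nrm K (?Y i b) \<partial>M i) \<le> (\<integral>b. 1 + \<kappa>\<^sup>2 * (nrm K (Y i b))\<^sup>2 \<partial>M i)"
      using i2[OF i] by (intro integral_mono e i pt) auto
    also have "\<dots> = 1 + \<kappa>\<^sup>2 * ?v i" using i2[OF i] prob_space by simp
    also have "\<dots> \<le> exp (\<kappa>\<^sup>2 * ?v i)" by (rule exp_ge_add_one_self)
    finally show "(\<integral>b. exp (nrm K (?Y i b)) - nrm K (?Y i b) \<partial>M i) \<le> exp (\<kappa>\<^sup>2 * ?v i)" .
  qed (use int zero t \<kappa> in auto)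
  also have "\<dots> \<le> 2 * exp (\<kappa>\<^sup>2 * V - \<kappa> * t)"
    using var by (simp add: sum_distrib_left[symmetric] mult_left_mono)
  finally show ?thesis using \<kappa> unfolding n2 by simp
qed

text \<open>The summands have deterministic modulus, so exp x - x <= exp (x^2) applies to each of
  them without any size restriction.\<close>

lemma hoeffding_unimodular:
  fixes w :: "'i \<Rightarrow> complex"
  assumes M: "prob_space M" and I: "finite I"
    and s: "integrable M s" "(\<integral>b. s b \<partial>M) = 0" "AE b in M. cmod (s b) = 1"
    and w: "nrm I w \<le> \<beta>" "0 < \<beta>" and t: "0 \<le> t"
  shows "measure (PiM I (\<lambda>_. M)) {\<omega>\<in>space (PiM I (\<lambda>_. M)). t \<le> cmod (\<Sum>i\<in>I. w i * s (\<omega> i))}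
     \<le> 2 * exp (- (t\<^sup>2 / (4 * \<beta>\<^sup>2)))"
proof -
  interpret prob_space M by fact
  \<comment> \<open>The minimiser of \<kappa>^2 \<beta>^2 - \<kappa> t.\<close>
  define \<kappa> where "\<kappa> = t / (2 * \<beta>\<^sup>2)"
  have \<kappa>: "0 \<le> \<kappa>" using t by (simp add: \<kappa>_def)
  \<comment> \<open>Scalars are treated as vectors with a single coordinate of type
    \<open>unit\<close>.\<close>
  let ?Y = "\<lambda>i b (k::unit). of_real \<kappa> * w i * s b"
  have n: "nrm UNIV f = cmod (f ())" for f :: "unit \<Rightarrow> complex" by (simp add: nrm_def L2_set_def UNIV_unit)
  have ae: "AE b in M. exp (nrm UNIV (?Y i b)) - nrm UNIV (?Y i b) = exp (\<kappa> * cmod (w i)) - \<kappa> * cmod (w i)" for i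
    using s(3) by eventually_elim (simp add: n norm_mult \<kappa>)
  have "measure (PiM I (\<lambda>_. M)) {\<omega>\<in>space (PiM I (\<lambda>_. M)). \<kappa> * t \<le> nrm UNIV (\<lambda>k. \<Sum>i\<in>I. ?Y i (\<omega> i) k)}
     \<le> 2 * exp ((\<Sum>i\<in>I. (\<kappa> * cmod (w i))\<^sup>2) - \<kappa> * t)"
  proof (rule prob_nrm_sum_ge_le)
    fix i
    show "integrable M (\<lambda>b. exp (nrm UNIV (?Y i b)) - nrm UNIV (?Y i b))"
    proof (subst integrable_cong_AE[OF _ _ ae])
      show "(\<lambda>b. exp (nrm UNIV (?Y i b)) - nrm UNIV (?Y i b)) \<in> borel_measurable M"
        using s(1) unfolding n by measurable
    qed auto
    have "(\<integral>b. exp (nrm UNIV (?Y i b)) - nrm UNIV (?Y i b) \<partial>M) = (\<integral>b. exp (\<kappa> * cmod (w i)) - \<kappa> * cmod (w i) \<partial>M)"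
      using borel_measurable_integrable[OF s(1)] unfolding n by (intro integral_cong_AE ae[unfolded n]) auto
    also have "\<dots> = exp (\<kappa> * cmod (w i)) - \<kappa> * cmod (w i)" using prob_space by simp
    also have "\<dots> \<le> exp ((\<kappa> * cmod (w i))\<^sup>2)" using \<kappa> by (intro exp_minus_self_le) auto
    finally show "(\<integral>b. exp (nrm UNIV (?Y i b)) - nrm UNIV (?Y i b) \<partial>M) \<le> exp ((\<kappa> * cmod (w i))\<^sup>2)" .
  qed (use M I s t \<kappa> in auto)
  also have "(\<Sum>i\<in>I. (\<kappa> * cmod (w i))\<^sup>2) = \<kappa>\<^sup>2 * (nrm I w)\<^sup>2"
    by (simp add: nrm_sq power_mult_distrib sum_distrib_left)
  also have "2 * exp (\<kappa>\<^sup>2 * (nrm I w)\<^sup>2 - \<kappa> * t) \<le> 2 * exp (\<kappa>\<^sup>2 * \<beta>\<^sup>2 - \<kappa> * t)"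
    using w by (simp add: mult_left_mono power_mono)
  also have "\<kappa>\<^sup>2 * \<beta>\<^sup>2 - \<kappa> * t = - (t\<^sup>2 / (4 * \<beta>\<^sup>2))"
    using w(2) by (simp add: \<kappa>_def power2_eq_square field_simps)
  finally have *: "measure (PiM I (\<lambda>_. M)) {\<omega>\<in>space (PiM I (\<lambda>_. M)). \<kappa> * t \<le> nrm UNIV (\<lambda>k. \<Sum>i\<in>I. ?Y i (\<omega> i) k)}
     \<le> 2 * exp (- (t\<^sup>2 / (4 * \<beta>\<^sup>2)))" .
  show ?thesis
  proof (cases "t = 0")
    case True
    interpret P: prob_space "PiM I (\<lambda>_. M)" by (intro prob_space_PiM M)
    have "measure (PiM I (\<lambda>_. M)) B \<le> 2" for B using P.prob_le_1[of B] by linarith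
    then show ?thesis using True by simp
  next
    case False
    then have "0 < \<kappa>" using t w(2) by (simp add: \<kappa>_def)
    moreover have "nrm UNIV (\<lambda>k. \<Sum>i\<in>I. ?Y i (\<omega> i) k) = \<kappa> * cmod (\<Sum>i\<in>I. w i * s (\<omega> i))" for \<omega>
      using \<kappa> by (simp add: n mult.assoc sum_distrib_left[symmetric] norm_mult)
    ultimately show ?thesis using * by simp
  qed
qed

section \<open>Trace moments of sums of independent random matrices\<close>

text \<open>Boundedness at every point of the space, not just almost everywhere, is preserved by
  sums, products and compositions; on a probability space every polynomial in such functions is then
  integrable.\<close>

definition bounded_meas :: "'b measure \<Rightarrow> ('b \<Rightarrow> 'c::{real_normed_field, second_countable_topology, banach}) \<Rightarrow> bool" where
  "bounded_meas M f \<longleftrightarrow> f \<in> borel_measurable M \<and> (\<exists>c. \<forall>x\<in>space M. norm (f x) \<le> c)"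

lemma bounded_meas_measurable: "bounded_meas M f \<Longrightarrow> f \<in> borel_measurable M"
  by (simp add: bounded_meas_def)

lemma bounded_meas_const: "bounded_meas M (\<lambda>x. c)"
  by (auto simp: bounded_meas_def)

lemma bounded_meas_add: "bounded_meas M f \<Longrightarrow> bounded_meas M g \<Longrightarrow> bounded_meas M (\<lambda>x. f x + g x)"
  unfolding bounded_meas_def by (auto intro: norm_triangle_mono)

lemma bounded_meas_mult: "bounded_meas M f \<Longrightarrow> bounded_meas M g \<Longrightarrow> bounded_meas M (\<lambda>x. f x * g x)"
proof -
  assume "bounded_meas M f" "bounded_meas M g"
  then obtain c d where f: "f \<in> borel_measurable M" "\<And>x. x\<in>space M \<Longrightarrow> norm (f x) \<le> c"
    and g: "g \<in> borel_measurable M" "\<And>x. x\<in>space M \<Longrightarrow> norm (g x) \<le> d"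
    by (auto simp: bounded_meas_def)
  have "norm (f x * g x) \<le> c * d" if "x \<in> space M" for x
    using f(2)[OF that] g(2)[OF that] order_trans[OF norm_ge_zero f(2)[OF that]]
    by (simp add: norm_mult mult_mono)
  then show ?thesis using f(1) g(1) unfolding bounded_meas_def by auto
qed

lemma bounded_meas_uminus: "bounded_meas M f \<Longrightarrow> bounded_meas M (\<lambda>x. - f x)"
  unfolding bounded_meas_def by auto

lemma bounded_meas_diff: "bounded_meas M f \<Longrightarrow> bounded_meas M g \<Longrightarrow> bounded_meas M (\<lambda>x. f x - g x)"
  using bounded_meas_add[of M f "\<lambda>x. - g x"] bounded_meas_uminus[of M g] by simp

lemma bounded_meas_sum: "(\<And>i. i \<in> I \<Longrightarrow> bounded_meas M (f i)) \<Longrightarrow> bounded_meas M (\<lambda>x. \<Sum>i\<in>I. f i x)"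
  by (induction I rule: infinite_finite_induct) (auto intro: bounded_meas_const bounded_meas_add)

lemma bounded_meas_cnj: "bounded_meas M f \<Longrightarrow> bounded_meas M (\<lambda>x. cnj (f x))"
  unfolding bounded_meas_def
  by (auto intro: measurable_compose[OF _ borel_measurable_continuous_onI[OF continuous_on_cnj[OF continuous_on_id]]])

lemma bounded_meas_Re: "bounded_meas M f \<Longrightarrow> bounded_meas M (\<lambda>x. Re (f x))"
  unfolding bounded_meas_def using abs_Re_le_cmod order_trans by (auto, blast)

lemma bounded_meas_compose:
  assumes f: "bounded_meas N f" and h: "h \<in> measurable M N"
  shows "bounded_meas M (\<lambda>x. f (h x))"
proof -
  obtain c where c: "f \<in> borel_measurable N" "\<And>x. x \<in> space N \<Longrightarrow> norm (f x) \<le> c"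
    using f by (auto simp: bounded_meas_def)
  have "norm (f (h x)) \<le> c" if "x \<in> space M" for x using c(2) measurable_space[OF h that] by blast
  then show ?thesis using measurable_compose[OF h c(1)] unfolding bounded_meas_def by auto
qed

lemma bounded_meas_integrable: "prob_space M \<Longrightarrow> bounded_meas M f \<Longrightarrow> integrable M f"
proof -
  assume M: "prob_space M" and f: "bounded_meas M f"
  interpret prob_space M by fact
  from f obtain c where "f \<in> borel_measurable M" "\<And>x. x\<in>space M \<Longrightarrow> norm (f x) \<le> c" by (auto simp: bounded_meas_def)
  then show ?thesis by (intro integrable_const_bound[where B=c]) auto
qed

lemma bounded_meas_integral:
  assumes M: "prob_space M" and f: "bounded_meas (N \<Otimes>\<^sub>M M) (\<lambda>(x, y). f x y)"
  shows "bounded_meas N (\<lambda>x. \<integral>y. f x y \<partial>M)"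
proof -
  interpret prob_space M by fact
  from f obtain c where c: "(\<lambda>(x, y). f x y) \<in> borel_measurable (N \<Otimes>\<^sub>M M)"
    "\<And>x y. x \<in> space N \<Longrightarrow> y \<in> space M \<Longrightarrow> norm (f x y) \<le> c" by (auto simp: bounded_meas_def space_pair_measure)
  have "norm (\<integral>y. f x y \<partial>M) \<le> c" if "x \<in> space N" for x
  proof -
    have "bounded_meas M (f x)" using c that unfolding bounded_meas_def by (auto dest: measurable_Pair2)
    then have i: "integrable M (f x)" by (rule bounded_meas_integrable[OF M])
    have "norm (\<integral>y. f x y \<partial>M) \<le> (\<integral>y. norm (f x y) \<partial>M)" by (rule integral_norm_bound)
    also have "\<dots> \<le> (\<integral>y. c \<partial>M)" using i c(2)[OF that] by (intro integral_mono) auto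
    finally show ?thesis by (simp add: prob_space)
  qed
  then show ?thesis using c(1) unfolding bounded_meas_def by (auto intro: borel_measurable_lebesgue_integral)
qed

definition bounded_meas_mat :: "'b measure \<Rightarrow> ('b \<Rightarrow> 'a \<Rightarrow> 'a \<Rightarrow> complex) \<Rightarrow> bool" where
  "bounded_meas_mat M X \<longleftrightarrow> (\<forall>j k. bounded_meas M (\<lambda>x. X x j k))"

lemma bounded_meas_mat_const: "bounded_meas_mat M (\<lambda>x. X)"
  by (simp add: bounded_meas_mat_def bounded_meas_const)

lemma bounded_meas_mat_add: "bounded_meas_mat M X \<Longrightarrow> bounded_meas_mat M Y \<Longrightarrow> bounded_meas_mat M (\<lambda>x j k. X x j k + Y x j k)"
  by (simp add: bounded_meas_mat_def bounded_meas_add)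

lemma bounded_meas_mat_diff: "bounded_meas_mat M X \<Longrightarrow> bounded_meas_mat M Y \<Longrightarrow> bounded_meas_mat M (\<lambda>x j k. X x j k - Y x j k)"
  by (simp add: bounded_meas_mat_def bounded_meas_diff)

lemma bounded_meas_mat_sum: "(\<And>i. i \<in> I \<Longrightarrow> bounded_meas_mat M (X i)) \<Longrightarrow> bounded_meas_mat M (\<lambda>x j k. \<Sum>i\<in>I. X i x j k)"
  by (simp add: bounded_meas_mat_def bounded_meas_sum)

lemma bounded_meas_mat_compose: "bounded_meas_mat N X \<Longrightarrow> h \<in> measurable M N \<Longrightarrow> bounded_meas_mat M (\<lambda>x. X (h x))"
  unfolding bounded_meas_mat_def by (auto intro: bounded_meas_compose[of N "\<lambda>x. X x _ _"])

lemma bounded_meas_mat_mm: "bounded_meas_mat M X \<Longrightarrow> bounded_meas_mat M Y \<Longrightarrow> bounded_meas_mat M (\<lambda>x. mm K (X x) (Y x))"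
  by (simp add: bounded_meas_mat_def mm_def bounded_meas_sum bounded_meas_mult)

lemma bounded_meas_mat_pow: "bounded_meas_mat M X \<Longrightarrow> bounded_meas_mat M (\<lambda>x. pow K (X x) r)"
  by (induction r) (simp_all add: pow_0 pow_Suc bounded_meas_mat_const bounded_meas_mat_mm)

lemma bounded_meas_fip: "bounded_meas_mat M X \<Longrightarrow> bounded_meas_mat M Y \<Longrightarrow> bounded_meas M (\<lambda>x. fip K (X x) (Y x))"
  unfolding fip_def bounded_meas_mat_def by (intro bounded_meas_Re bounded_meas_sum bounded_meas_mult bounded_meas_cnj) auto

lemmas bounded_meas_mat_intros = bounded_meas_mat_add bounded_meas_mat_diff bounded_meas_mat_sum bounded_meas_mat_mm bounded_meas_mat_pow bounded_meas_fip bounded_meas_mat_const bounded_meas_add bounded_meas_diff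

section \<open>Exchangeable pairs and the moment recursion\<close>

lemma integral_fip_right:
  assumes "prob_space M" "bounded_meas_mat M Z"
  shows "(\<integral>b. fip K X (Z b) \<partial>M) = fip K X (\<lambda>j k. \<integral>b. Z b j k \<partial>M)"
proof -
  have i: "integrable M (\<lambda>b. Z b j k)" for j k
    using assms by (intro bounded_meas_integrable) (auto simp: bounded_meas_mat_def)
  then have "integrable M (\<lambda>b. \<Sum>j\<in>K. \<Sum>k\<in>K. cnj (X j k) * Z b j k)" by simp
  then show ?thesis unfolding fip_def by (subst integral_Re) (simp_all add: i)
qed

lemma integral_mm_left:
  assumes "prob_space M" "bounded_meas_mat M Z"
  shows "(\<integral>b. mm K (Z b) X j k \<partial>M) = mm K (\<lambda>j k. \<integral>b. Z b j k \<partial>M) X j k"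
proof -
  have i: "integrable M (\<lambda>b. Z b j k)" for j k
    using assms by (intro bounded_meas_integrable) (auto simp: bounded_meas_mat_def)
  then show ?thesis unfolding mm_def by simp
qed

text \<open>Exchanging \<open>Z\<close> with an independent copy \<open>Z'\<close> shows that the left-hand side is half the expectation of
  the difference bounded in \<open>fip_pow_diff_psd_le\<close>.\<close>
lemma integral_fip_centered_pow_le:
  fixes Z :: "'b \<Rightarrow> 'a \<Rightarrow> 'a \<Rightarrow> complex"
  assumes M: "prob_space M" and K: "finite K" and Zb: "bounded_meas_mat M Z"
    and R: "supported K R" "adj R = R" and Z: "\<And>b. supported K (Z b)" "\<And>b. adj (Z b) = Z b"
    and Zr: "\<And>b X. fip K (mm K (Z b) X) (mm K (Z b) X) \<le> \<rho> * fip K X (mm K (Z b) X)"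
  defines "P \<equiv> \<lambda>b j k. R j k + Z b j k" and "E \<equiv> \<lambda>j k. \<integral>b. Z b j k \<partial>M"
  shows "(\<integral>b. fip K (\<lambda>j k. Z b j k - E j k) (pow K (P b) (Suc (2 * r))) \<partial>M)
    \<le> (2 * r + 1) * (2 * \<rho>) *
      (\<integral>b. fip K (pow K (P b) r) (mm K (\<lambda>j k. Z b j k + E j k) (pow K (P b) r)) \<partial>M)"
proof -
  interpret prob_space M by fact
  interpret pair_prob_space M M ..
  let ?c = "(2 * real r + 1) * (2 * \<rho>)"
  \<comment> \<open>\<open>W\<close> and \<open>V\<close> are the integrands of the two sides with
    the mean \<open>E\<close> replaced by an independent copy \<open>Z b'\<close>.\<close>
  define W where "W = (\<lambda>(b, b'). fip K (\<lambda>j k. Z b j k - Z b' j k) (pow K (P b) (Suc (2 * r))))"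
  define V where "V = (\<lambda>(b, b'). fip K (pow K (P b) r) (mm K (\<lambda>j k. Z b j k + Z b' j k) (pow K (P b) r)))"
  have Z1: "bounded_meas_mat (M \<Otimes>\<^sub>M M) (\<lambda>x. Z (fst x))" and Z2: "bounded_meas_mat (M \<Otimes>\<^sub>M M) (\<lambda>x. Z (snd x))"
    using Zb by (auto intro: bounded_meas_mat_compose)
  have P1: "bounded_meas_mat (M \<Otimes>\<^sub>M M) (\<lambda>x. P (fst x))" unfolding P_def by (intro bounded_meas_mat_intros Z1)
  have Wb: "bounded_meas (M \<Otimes>\<^sub>M M) W" unfolding W_def case_prod_unfold by (intro bounded_meas_mat_intros Z1 Z2 P1)
  have Vb: "bounded_meas (M \<Otimes>\<^sub>M M) V" unfolding V_def case_prod_unfold by (intro bounded_meas_mat_intros Z1 Z2 P1)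
  have pp: "prob_space (M \<Otimes>\<^sub>M M)" by (rule P.prob_space_axioms)
  note Wi = bounded_meas_integrable[OF pp Wb] and Vi = bounded_meas_integrable[OF pp Vb]
  have sw: "(\<integral>x. f x \<partial>(M \<Otimes>\<^sub>M M)) = (\<integral>x. f (snd x, fst x) \<partial>(M \<Otimes>\<^sub>M M))"
    "integrable (M \<Otimes>\<^sub>M M) (\<lambda>x. f (snd x, fst x))"
    if "bounded_meas (M \<Otimes>\<^sub>M M) f" for f :: "_ \<Rightarrow> real"
    using integral_product_swap[of f] bounded_meas_measurable[OF that] bounded_meas_integrable[OF pp that] integrable_product_swap[of f]
    by (simp_all add: case_prod_unfold)
  \<comment> \<open>Swapping the copies flips the sign of Z - Z' and turns the power of P into that
    of Q, so the sum is exactly the left side of \<open>fip_pow_diff_psd_le\<close>. Both integrals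
    are invariant under the swap, which gives the factor 2 on each side.\<close>
  have "W x + W (snd x, fst x) \<le> ?c * (V x + V (snd x, fst x))" for x
  proof -
    obtain b b' where x: "x = (b, b')" by force
    show ?thesis
      using fip_pow_diff_psd_le[OF K R Z(1)[of b] Z(2)[of b] Z(1)[of b'] Z(2)[of b'] Zr[of b] Zr[of b'], of r]
      unfolding x W_def V_def P_def
      by (simp add: fip_diff_left fip_diff_right mm_add_left fip_add_right algebra_simps)
  qed
  then have "(\<integral>x. W x + W (snd x, fst x) \<partial>(M \<Otimes>\<^sub>M M)) \<le> (\<integral>x. ?c * (V x + V (snd x, fst x)) \<partial>(M \<Otimes>\<^sub>M M))"
    using Wi Vi sw(2)[OF Wb] sw(2)[OF Vb] by (intro integral_mono) auto
  then have "2 * (\<integral>x. W x \<partial>(M \<Otimes>\<^sub>M M)) \<le> ?c * (2 * (\<integral>x. V x \<partial>(M \<Otimes>\<^sub>M M)))"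
    using Wi Vi sw(2)[OF Wb] sw(2)[OF Vb] by (simp add: sw(1)[OF Wb, symmetric] sw(1)[OF Vb, symmetric])
  then have "(\<integral>x. W x \<partial>(M \<Otimes>\<^sub>M M)) \<le> ?c * (\<integral>x. V x \<partial>(M \<Otimes>\<^sub>M M))" by linarith
  moreover have "(\<integral>x. W x \<partial>(M \<Otimes>\<^sub>M M)) = (\<integral>b. fip K (\<lambda>j k. Z b j k - E j k) (pow K (P b) (Suc (2 * r))) \<partial>M)"
  proof -
    have "(\<integral>b'. W (b, b') \<partial>M) = fip K (\<lambda>j k. Z b j k - E j k) (pow K (P b) (Suc (2 * r)))" for b
      using integral_fip_right[OF M Zb, of K "pow K (P b) (Suc (2 * r))"] bounded_meas_integrable[OF M bounded_meas_fip[OF bounded_meas_mat_const Zb]] prob_space.prob_space[OF M]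
      unfolding W_def E_def by (simp add: fip_diff_left fip_commute[of K _ "pow K (P b) (Suc (2 * r))"])
    then show ?thesis by (simp add: integral_fst'[OF Wi, symmetric])
  qed
  moreover have "(\<integral>x. V x \<partial>(M \<Otimes>\<^sub>M M)) = (\<integral>b. fip K (pow K (P b) r) (mm K (\<lambda>j k. Z b j k + E j k) (pow K (P b) r)) \<partial>M)"
  proof -
    have "(\<integral>b'. V (b, b') \<partial>M) = fip K (pow K (P b) r) (mm K (\<lambda>j k. Z b j k + E j k) (pow K (P b) r))" for b
    proof -
      have mb: "bounded_meas_mat M (\<lambda>b'. mm K (Z b') (pow K (P b) r))" by (intro bounded_meas_mat_intros Zb)
      show ?thesis
        using integral_fip_right[OF M mb] bounded_meas_integrable[OF M bounded_meas_fip[OF bounded_meas_mat_const mb]] prob_space.prob_space[OF M]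
        unfolding V_def E_def by (simp add: mm_add_left fip_add_right integral_mm_left[OF M Zb])
    qed
    then show ?thesis by (simp add: integral_fst'[OF Vi, symmetric])
  qed
  ultimately show ?thesis by simp
qed

text \<open>By Fubini, the estimate for a single random block transfers to the full product with all
  other blocks frozen.\<close>

lemma product_integral_mono_coordinate:
  fixes f g :: "('i \<Rightarrow> 'b) \<Rightarrow> real"
  assumes M: "\<And>i. prob_space (M i)" and I: "finite I" "i \<in> I"
    and f: "bounded_meas (PiM I M) f" and g: "bounded_meas (PiM I M) g"
    and le: "\<And>\<omega>. \<omega> \<in> space (PiM (I - {i}) M) \<Longrightarrow> (\<integral>b. f (fun_upd \<omega> i b) \<partial>M i) \<le> (\<integral>b. g (fun_upd \<omega> i b) \<partial>M i)"
  shows "(\<integral>\<omega>. f \<omega> \<partial>PiM I M) \<le> (\<integral>\<omega>. g \<omega> \<partial>PiM I M)"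
proof -
  interpret product_prob_space M by (simp add: M product_prob_space_def product_sigma_finite_def
    prob_space_imp_sigma_finite product_prob_space_axioms_def)
  let ?J = "I - {i}"
  have J: "finite ?J" "i \<notin> ?J" "insert i ?J = I" using I by auto
  have *: "(\<integral>\<omega>. h \<omega> \<partial>PiM I M) = (\<integral>\<omega>. (\<integral>b. h (fun_upd \<omega> i b) \<partial>M i) \<partial>PiM ?J M)
     \<and> integrable (PiM ?J M) (\<lambda>\<omega>. \<integral>b. h (fun_upd \<omega> i b) \<partial>M i)"
    if h: "bounded_meas (PiM I M) h" for h :: "_ \<Rightarrow> real"
  proof
    show "(\<integral>\<omega>. h \<omega> \<partial>PiM I M) = (\<integral>\<omega>. (\<integral>b. h (fun_upd \<omega> i b) \<partial>M i) \<partial>PiM ?J M)"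
      using product_integral_insert[OF J(1,2), of h] bounded_meas_integrable[OF prob_space_PiM h] M unfolding J(3) by simp
    have "bounded_meas (PiM ?J M \<Otimes>\<^sub>M M i) (\<lambda>(\<omega>, b). h (fun_upd \<omega> i b))"
      using bounded_meas_compose[OF h measurable_add_dim[of i ?J M, unfolded J(3)]] by (simp add: case_prod_unfold)
    then show "integrable (PiM ?J M) (\<lambda>\<omega>. \<integral>b. h (fun_upd \<omega> i b) \<partial>M i)"
      by (intro bounded_meas_integrable prob_space_PiM M bounded_meas_integral)
  qed
  show ?thesis using *[OF f] *[OF g] le by (simp add: integral_mono)
qed

text \<open>Since the block means add up to the identity, S is the sum of the centred blocks, and tr
  S^(2r+2) splits into one exchangeable-pair term per block. On the right, the blocks plus their
  means add up to S + 2 I. The odd trace of S^(2r+1) is split by AM-GM, which yields 5/2 = 2 + 1/2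
  and puts \<open>T (Suc r)\<close> on both sides.\<close>

lemma integral_fip_pow_step:
  fixes Z :: "'i \<Rightarrow> 'b \<Rightarrow> 'a \<Rightarrow> 'a \<Rightarrow> complex"
  assumes M: "\<And>i. prob_space (M i)" and I: "finite I" and K: "finite K"
    and Zb: "\<And>i. i \<in> I \<Longrightarrow> bounded_meas_mat (M i) (Z i)"
    and Z: "\<And>i b. supported K (Z i b)" "\<And>i b. adj (Z i b) = Z i b"
    and Zr: "\<And>i b X. i \<in> I \<Longrightarrow> fip K (mm K (Z i b) X) (mm K (Z i b) X) \<le> \<rho> * fip K X (mm K (Z i b) X)"
    and E: "\<And>j k. (\<Sum>i\<in>I. \<integral>b. Z i b j k \<partial>M i) = idm K j k"
  defines "S \<equiv> \<lambda>\<omega> j k. (\<Sum>i\<in>I. Z i (\<omega> i) j k) - idm K j k"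
  defines "T \<equiv> \<lambda>r. \<integral>\<omega>. fip K (pow K (S \<omega>) r) (pow K (S \<omega>) r) \<partial>PiM I M"
  assumes \<rho>: "0 \<le> \<rho>"
  shows "T (Suc r) \<le> (2 * r + 1) * (2 * \<rho>) * (5 / 2 * T r + 1 / 2 * T (Suc r))"
proof -
  interpret prob_space "PiM I M" by (intro prob_space_PiM M)
  let ?c = "(2 * real r + 1) * (2 * \<rho>)"
  let ?E = "\<lambda>i j k. \<integral>b. Z i b j k \<partial>M i"
  have Sb: "bounded_meas_mat (PiM I M) S" unfolding S_def
    by (intro bounded_meas_mat_intros bounded_meas_mat_compose[OF Zb] measurable_component_singleton)
  have S: "supported K (S \<omega>)" "adj (S \<omega>) = S \<omega>" for \<omega>
  proof -
    show "supported K (S \<omega>)" using Z supported_idm[of K] unfolding S_def supported_def by simp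
    have "cnj (Z i b k j) = Z i b j k" for i b j k using Z(2)[of i b] unfolding adj_def by metis
    then show "adj (S \<omega>) = S \<omega>" using adj_idm[of K] unfolding S_def adj_def fun_eq_iff by simp
  qed
  define f where "f i \<omega> = fip K (\<lambda>j k. Z i (\<omega> i) j k - ?E i j k) (pow K (S \<omega>) (Suc (2 * r)))" for i \<omega>
  define g where "g i \<omega> = fip K (pow K (S \<omega>) r) (mm K (\<lambda>j k. Z i (\<omega> i) j k + ?E i j k) (pow K (S \<omega>) r))" for i \<omega>
  have fb: "bounded_meas (PiM I M) (f i)" and gb: "bounded_meas (PiM I M) (g i)" if "i \<in> I" for i
    unfolding f_def g_def using that
    by (intro bounded_meas_mat_intros bounded_meas_mat_compose[OF Zb] measurable_component_singleton Sb bounded_meas_mat_const[of _ "?E i"]; simp)+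
  have fg: "(\<integral>\<omega>. f i \<omega> \<partial>PiM I M) \<le> (\<integral>\<omega>. ?c * g i \<omega> \<partial>PiM I M)" if i: "i \<in> I" for i
  proof (rule product_integral_mono_coordinate[OF M I i fb[OF i] bounded_meas_mult[OF bounded_meas_const gb[OF i]]])
    fix \<omega>
    \<comment> \<open>Everything in \<open>S \<omega>\<close> that does not depend on coordinate
      \<open>i\<close>.\<close>
    define R where "R = (\<lambda>j k. (\<Sum>l\<in>I - {i}. Z l (\<omega> l) j k) - idm K j k)"
    have R: "supported K R" using Z(1) supported_idm[of K] unfolding R_def supported_def by simp
    have "cnj (Z i b k j) = Z i b j k" for i b j k using Z(2)[of i b] unfolding adj_def by metis
    then have R': "adj R = R" using adj_idm[of K] unfolding R_def adj_def fun_eq_iff by simp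
    have "S (fun_upd \<omega> i b) = (\<lambda>j k. R j k + Z i b j k)" for b
      unfolding S_def R_def using i I by (simp add: sum.remove[OF I i] fun_eq_iff)
    then show "(\<integral>b. f i (fun_upd \<omega> i b) \<partial>M i) \<le> (\<integral>b. ?c * g i (fun_upd \<omega> i b) \<partial>M i)"
      using integral_fip_centered_pow_le[OF M K Zb[OF i] R R' Z(1) Z(2) Zr[OF i], of r]
      unfolding f_def g_def by simp
  qed
  have "T (Suc r) = (\<integral>\<omega>. (\<Sum>i\<in>I. f i \<omega>) \<partial>PiM I M)"
  proof -
    have "fip K (pow K (S \<omega>) (Suc r)) (pow K (S \<omega>) (Suc r)) = (\<Sum>i\<in>I. f i \<omega>)" for \<omega>
    proof -
      have "fip K (pow K (S \<omega>) (Suc r)) (pow K (S \<omega>) (Suc r)) = fip K (pow K (S \<omega>) 1) (pow K (S \<omega>) (Suc (2 * r)))"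
        by (simp only: fip_pow_pow[OF K S]) (simp add: mult_2)
      also have "\<dots> = fip K (\<lambda>j k. \<Sum>i\<in>I. Z i (\<omega> i) j k - ?E i j k) (pow K (S \<omega>) (Suc (2 * r)))"
      proof (rule arg_cong2[where f="fip K", OF _ refl])
        have "pow K (S \<omega>) 1 = S \<omega>" using S K by (simp add: pow_Suc pow_0 mm_idm_left)
        then show "pow K (S \<omega>) 1 = (\<lambda>j k. \<Sum>i\<in>I. Z i (\<omega> i) j k - ?E i j k)"
          unfolding S_def by (simp add: sum_subtractf E)
      qed
      also have "\<dots> = (\<Sum>i\<in>I. f i \<omega>)" unfolding fip_sum_left f_def ..
      finally show ?thesis .
    qed
    then show ?thesis unfolding T_def by simp
  qed
  also have "\<dots> = (\<Sum>i\<in>I. (\<integral>\<omega>. f i \<omega> \<partial>PiM I M))"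
    by (intro Bochner_Integration.integral_sum bounded_meas_integrable[OF _ fb] prob_space_PiM M)
  also have "\<dots> \<le> (\<Sum>i\<in>I. (\<integral>\<omega>. ?c * g i \<omega> \<partial>PiM I M))" by (intro sum_mono fg)
  also have "\<dots> = ?c * (\<integral>\<omega>. (\<Sum>i\<in>I. g i \<omega>) \<partial>PiM I M)"
    using bounded_meas_integrable[OF prob_space_PiM gb] M
    by (simp add: sum_distrib_left Bochner_Integration.integral_sum)
  also have "(\<integral>\<omega>. (\<Sum>i\<in>I. g i \<omega>) \<partial>PiM I M)
     \<le> (\<integral>\<omega>. 5 / 2 * fip K (pow K (S \<omega>) r) (pow K (S \<omega>) r)
           + 1 / 2 * fip K (pow K (S \<omega>) (Suc r)) (pow K (S \<omega>) (Suc r)) \<partial>PiM I M)"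
  proof (rule integral_mono)
    show "integrable (PiM I M) (\<lambda>\<omega>. \<Sum>i\<in>I. g i \<omega>)" by (intro bounded_meas_integrable bounded_meas_sum gb prob_space_PiM M)
    show "integrable (PiM I M) (\<lambda>\<omega>. 5 / 2 * fip K (pow K (S \<omega>) r) (pow K (S \<omega>) r)
           + 1 / 2 * fip K (pow K (S \<omega>) (Suc r)) (pow K (S \<omega>) (Suc r)))"
      by (intro bounded_meas_integrable bounded_meas_add bounded_meas_mult bounded_meas_const bounded_meas_mat_intros Sb prob_space_PiM M)
    fix \<omega>
    have "(\<Sum>i\<in>I. g i \<omega>) = fip K (pow K (S \<omega>) r) (mm K (\<lambda>j k. \<Sum>i\<in>I. Z i (\<omega> i) j k + ?E i j k) (pow K (S \<omega>) r))"
      unfolding mm_sum_left fip_sum_right g_def ..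
    also have "(\<lambda>j k. \<Sum>i\<in>I. Z i (\<omega> i) j k + ?E i j k) = (\<lambda>j k. S \<omega> j k + (idm K j k + idm K j k))"
      unfolding S_def by (simp add: sum.distrib E fun_eq_iff)
    also have "fip K (pow K (S \<omega>) r) (mm K (\<lambda>j k. S \<omega> j k + (idm K j k + idm K j k)) (pow K (S \<omega>) r))
       = fip K (pow K (S \<omega>) r) (pow K (S \<omega>) (Suc r)) + 2 * fip K (pow K (S \<omega>) r) (pow K (S \<omega>) r)"
      unfolding mm_add_left fip_add_right mm_idm_left[OF K supported_pow[OF S(1)]]
        pow_commute[OF K S(1)] pow_Suc by simp
    finally show "(\<Sum>i\<in>I. g i \<omega>) \<le> 5 / 2 * fip K (pow K (S \<omega>) r) (pow K (S \<omega>) r)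
           + 1 / 2 * fip K (pow K (S \<omega>) (Suc r)) (pow K (S \<omega>) (Suc r))"
      using fip_amgm[of K "pow K (S \<omega>) r" "pow K (S \<omega>) (Suc r)"] by simp
  qed
  also have "\<dots> = 5 / 2 * T r + 1 / 2 * T (Suc r)"
  proof -
    have "integrable (PiM I M) (\<lambda>\<omega>. fip K (pow K (S \<omega>) l) (pow K (S \<omega>) l))" for l
      by (intro bounded_meas_integrable bounded_meas_fip bounded_meas_mat_pow Sb prob_space_PiM M)
    then show ?thesis unfolding T_def by simp
  qed
  finally show ?thesis using \<rho> by (simp add: mult_left_mono add.commute)
qed

lemma prob_frobenius_pow_ge_le:
  fixes Z :: "'i \<Rightarrow> 'b \<Rightarrow> 'a \<Rightarrow> 'a \<Rightarrow> complex"
  assumes M: "\<And>i. prob_space (M i)" and I: "finite I" and K: "finite K"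
    and Zb: "\<And>i. i \<in> I \<Longrightarrow> bounded_meas_mat (M i) (Z i)"
    and Z: "\<And>i b. supported K (Z i b)" "\<And>i b. adj (Z i b) = Z i b"
    and Zr: "\<And>i b X. i \<in> I \<Longrightarrow> fip K (mm K (Z i b) X) (mm K (Z i b) X) \<le> \<rho> * fip K X (mm K (Z i b) X)"
    and E: "\<And>j k. (\<Sum>i\<in>I. \<integral>b. Z i b j k \<partial>M i) = idm K j k"
  defines "S \<equiv> \<lambda>\<omega> j k. (\<Sum>i\<in>I. Z i (\<omega> i) j k) - idm K j k"
  assumes \<rho>: "0 \<le> \<rho>" and q: "\<rho> * real q \<le> 1 / 168"
  shows "measure (PiM I M) {\<omega> \<in> space (PiM I M). ((1 / 2) ^ q)\<^sup>2 \<le> fip K (pow K (S \<omega>) q) (pow K (S \<omega>) q)}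
     \<le> card K * (1 / 4) ^ q"
proof -
  interpret prob_space "PiM I M" by (intro prob_space_PiM M)
  define T where "T r = (\<integral>\<omega>. fip K (pow K (S \<omega>) r) (pow K (S \<omega>) r) \<partial>PiM I M)" for r
  have T0: "0 \<le> T r" for r unfolding T_def by (intro integral_nonneg_AE) (simp add: fip_self_nonneg)
  have Sb: "bounded_meas_mat (PiM I M) S" unfolding S_def
    by (intro bounded_meas_mat_intros bounded_meas_mat_compose[OF Zb] measurable_component_singleton)
  have "T r \<le> card K * (1 / 16) ^ r" if "r \<le> q" for r
    using that
  proof (induction r)
    case 0
    have "fip K (idm K) (idm K) = card K"
    proof -
      have "fip K (idm K) (idm K) = (\<Sum>j\<in>K. \<Sum>k\<in>K. if k = j then 1 else 0)"
        unfolding fip_self idm_def by (intro sum.cong) auto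
      then show ?thesis using K by simp
    qed
    then show ?case by (simp add: T_def pow_0 prob_space)
  next
    case (Suc r)
    have "\<rho> * (2 * r + 1) \<le> \<rho> * (2 * q)" using Suc.prems \<rho> by (intro mult_left_mono) auto
    \<comment> \<open>As r < q, the factor is at most 4 q \<rho> <= 4 / 168.\<close>
    then have "(2 * r + 1) * (2 * \<rho>) \<le> 1 / 42" using q by (simp add: algebra_simps)
    then have "(2 * r + 1) * (2 * \<rho>) * (5 / 2 * T r + 1 / 2 * T (Suc r)) \<le> 1 / 42 * (5 / 2 * T r + 1 / 2 * T (Suc r))"
      using T0[of r] T0[of "Suc r"] by (intro mult_right_mono) auto
    moreover have "T (Suc r) \<le> (2 * r + 1) * (2 * \<rho>) * (5 / 2 * T r + 1 / 2 * T (Suc r))"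
      unfolding T_def S_def by (rule integral_fip_pow_step[OF M I K Zb Z Zr E \<rho>])
    ultimately have "T (Suc r) \<le> 1 / 42 * (5 / 2 * T r + 1 / 2 * T (Suc r))" by (rule order_trans[rotated])
    \<comment> \<open>Absorbing \<open>T (Suc r)\<close> leaves the ratio 5/83, which is below
      1/16.\<close>
    then have "T (Suc r) \<le> 1 / 16 * T r" using T0[of r] by (simp add: algebra_simps)
    then show ?case using Suc by simp
  qed
  then have Tq: "T q \<le> card K * (1 / 16) ^ q" by simp
  have half: "((1 / 2 :: real) ^ q)\<^sup>2 = (1 / 4) ^ q"
    unfolding power_mult[symmetric] mult.commute[of q] unfolding power_mult by (simp add: power2_eq_square)
  have "measure (PiM I M) {\<omega> \<in> space (PiM I M). ((1 / 2) ^ q)\<^sup>2 \<le> fip K (pow K (S \<omega>) q) (pow K (S \<omega>) q)}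
     \<le> T q / ((1 / 2) ^ q)\<^sup>2"
    unfolding T_def
  proof (rule integral_Markov_inequality_measure[where A="{}"])
    show "integrable (PiM I M) (\<lambda>\<omega>. fip K (pow K (S \<omega>) q) (pow K (S \<omega>) q))"
      by (intro bounded_meas_integrable bounded_meas_fip bounded_meas_mat_pow Sb prob_space_PiM M)
  qed (auto simp: fip_self_nonneg)
  also have "T q / ((1 / 2) ^ q)\<^sup>2 = T q / (1 / 4) ^ q" unfolding half ..
  also have "T q / (1 / 4) ^ q \<le> card K * (1 / 16) ^ q / (1 / 4) ^ q" using Tq by (rule divide_right_mono) simp
  also have "\<dots> = card K * ((1 / 16) / (1 / 4)) ^ q" unfolding power_divide[of "1 / 16"] by simp
  also have "\<dots> = card K * (1 / 4) ^ q" by simp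
  finally show ?thesis .
qed

section \<open>Gram matrices with bounded row sums\<close>

definition row_bounded :: "nat \<Rightarrow> nat \<Rightarrow> nat set \<Rightarrow> real \<Rightarrow> cmat \<Rightarrow> bool" where
  "row_bounded p n S \<Theta> B \<longleftrightarrow> (\<forall>j<n. (\<Sum>k\<in>S. cmod (gram p B j k)) \<le> \<Theta>)"

lemma inf_norm_gram_S_le_iff:
  "n \<ge> 1 \<Longrightarrow> inf_norm_gram_S p n S B \<le> \<Theta> \<longleftrightarrow> row_bounded p n S \<Theta> B"
  unfolding inf_norm_gram_S_def row_bounded_def by (subst Max_le_iff) (auto simp: lessThan_empty_iff)

lemma cnj_gram: "cnj (gram p B j k) = gram p B k j"
  by (simp add: gram_def mult.commute)

lemma cmod_gram_commute: "cmod (gram p B j k) = cmod (gram p B k j)"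
  by (metis cnj_gram complex_mod_cnj)

lemma cin_gram: "cin K v (\<lambda>j. \<Sum>k\<in>K. gram p B j k * v k) = of_real ((nrm {..<p} (\<lambda>i. \<Sum>k\<in>K. B i k * v k))\<^sup>2)"
proof -
  have "cin {..<p} (\<lambda>i. \<Sum>k\<in>K. v k * B i k) (\<lambda>i. \<Sum>k\<in>K. v k * B i k)
     = (\<Sum>j\<in>K. cnj (v j) * (\<Sum>k\<in>K. v k * (\<Sum>i<p. cnj (B i j) * B i k)))"
    unfolding cin_sum_left cin_scale_left cin_sum_right cin_scale_right by (simp add: cin_def)
  then show ?thesis unfolding cin_self by (simp add: cin_def gram_def mult.commute)
qed

text \<open>This is Schur's test for the Hermitian matrix \<open>B\<^sub>S\<^sup>*B\<^sub>S\<close>.\<close>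
lemma nrm_block_mult_le:
  assumes S: "S \<subseteq> {..<n}" and B: "row_bounded p n S \<Theta> B"
  shows "(nrm {..<p} (\<lambda>i. \<Sum>k\<in>S. B i k * v k))\<^sup>2 \<le> \<Theta> * (nrm S v)\<^sup>2"
proof -
  let ?g = "\<lambda>j k. cmod (gram p B j k)"
  have row: "(\<Sum>k\<in>S. ?g j k) \<le> \<Theta>" if "j \<in> S" for j using B S that unfolding row_bounded_def by auto
  have "(nrm {..<p} (\<lambda>i. \<Sum>k\<in>S. B i k * v k))\<^sup>2 = cmod (cin S v (\<lambda>j. \<Sum>k\<in>S. gram p B j k * v k))"
    by (simp add: cin_gram norm_power)
  also have "\<dots> \<le> (\<Sum>j\<in>S. \<Sum>k\<in>S. cmod (v j) * (?g j k * cmod (v k)))"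
    unfolding cin_def sum_distrib_left
    by (intro order_trans[OF norm_sum] sum_mono order_trans[OF norm_sum]) (simp add: norm_mult)
  also have "\<dots> \<le> (\<Sum>j\<in>S. \<Sum>k\<in>S. ?g j k * (cmod (v j))\<^sup>2 / 2 + ?g j k * (cmod (v k))\<^sup>2 / 2)"
  proof (intro sum_mono)
    fix j k
    have "?g j k * (2 * cmod (v j) * cmod (v k)) \<le> ?g j k * ((cmod (v j))\<^sup>2 + (cmod (v k))\<^sup>2)"
      by (intro mult_left_mono sum_squares_bound) auto
    then show "cmod (v j) * (?g j k * cmod (v k)) \<le> ?g j k * (cmod (v j))\<^sup>2 / 2 + ?g j k * (cmod (v k))\<^sup>2 / 2"
      by (simp add: algebra_simps)
  qed
  also have "\<dots> = (\<Sum>j\<in>S. \<Sum>k\<in>S. ?g j k * (cmod (v j))\<^sup>2 / 2) + (\<Sum>k\<in>S. \<Sum>j\<in>S. ?g j k * (cmod (v k))\<^sup>2 / 2)"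
    by (subst (2) sum.swap) (simp add: sum.distrib)
  also have "(\<Sum>k\<in>S. \<Sum>j\<in>S. ?g j k * (cmod (v k))\<^sup>2 / 2) = (\<Sum>j\<in>S. \<Sum>k\<in>S. ?g j k * (cmod (v j))\<^sup>2 / 2)"
    by (subst cmod_gram_commute) simp
  also have "(\<Sum>j\<in>S. \<Sum>k\<in>S. ?g j k * (cmod (v j))\<^sup>2 / 2) + (\<Sum>j\<in>S. \<Sum>k\<in>S. ?g j k * (cmod (v j))\<^sup>2 / 2)
      = (\<Sum>j\<in>S. (\<Sum>k\<in>S. ?g j k) * (cmod (v j))\<^sup>2)"
    by (simp add: sum.distrib[symmetric] sum_distrib_right)
  also have "\<dots> \<le> (\<Sum>j\<in>S. \<Theta> * (cmod (v j))\<^sup>2)" using row by (intro sum_mono mult_right_mono) auto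
  finally show ?thesis by (simp add: nrm_sq sum_distrib_left)
qed

text \<open>Duality: with c the adjoint of B_S applied to b, the squared norm of c is the inner
  product of b with B_S c, and \<open>nrm_block_mult_le\<close> bounds the norm of B_S c by sqrt
  \<Theta> times that of c.\<close>

lemma nrm_block_adjoint_mult_le:
  assumes S: "S \<subseteq> {..<n}" and B: "row_bounded p n S \<Theta> B" and \<Theta>: "0 \<le> \<Theta>"
  shows "(nrm S (\<lambda>k. \<Sum>i<p. cnj (B i k) * b i))\<^sup>2 \<le> \<Theta> * (nrm {..<p} b)\<^sup>2"
proof -
  define c where "c = (\<lambda>k. \<Sum>i<p. b i * cnj (B i k))"
  let ?Bc = "\<lambda>i. \<Sum>k\<in>S. B i k * c k"
  have "cin S c c = cin {..<p} b ?Bc"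
    by (subst (1) c_def, unfold cin_sum_left cin_scale_left) (simp add: cin_def)
  then have "(nrm S c)\<^sup>2 = cmod (cin {..<p} b ?Bc)" by (metis cin_self norm_of_real abs_power2)
  also have "\<dots> \<le> nrm {..<p} b * nrm {..<p} ?Bc" by (rule cin_cauchy)
  finally have "((nrm S c)\<^sup>2)\<^sup>2 \<le> (nrm {..<p} b * nrm {..<p} ?Bc)\<^sup>2" by (intro power_mono) auto
  also have "\<dots> \<le> (nrm {..<p} b)\<^sup>2 * (\<Theta> * (nrm S c)\<^sup>2)"
    unfolding power_mult_distrib by (intro mult_left_mono nrm_block_mult_le[OF S B]) auto
  finally have le: "(nrm S c)\<^sup>2 * (nrm S c)\<^sup>2 \<le> (\<Theta> * (nrm {..<p} b)\<^sup>2) * (nrm S c)\<^sup>2"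
    by (simp add: power2_eq_square[of "(nrm S c)\<^sup>2"] mult.assoc mult.left_commute)
  have "(nrm S c)\<^sup>2 \<le> \<Theta> * (nrm {..<p} b)\<^sup>2"
  proof (cases "nrm S c = 0")
    case False
    then show ?thesis by (intro mult_right_le_imp_le[OF le]) simp
  qed (simp add: \<Theta>)
  then show ?thesis unfolding c_def by (simp add: mult.commute)
qed

text \<open>The truncation only acts on a null set and makes every random variable below bounded everywhere.\<close>
definition tgram :: "nat \<Rightarrow> nat \<Rightarrow> nat set \<Rightarrow> real \<Rightarrow> cmat \<Rightarrow> nat \<Rightarrow> nat \<Rightarrow> complex" where
  "tgram p n S \<Theta> B j k = (if row_bounded p n S \<Theta> B then gram p B j k else 0)"

definition tblock :: "nat \<Rightarrow> nat \<Rightarrow> nat \<Rightarrow> nat set \<Rightarrow> real \<Rightarrow> cmat \<Rightarrow> nat \<Rightarrow> nat \<Rightarrow> complex" where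
  "tblock m p n S \<Theta> B j k = (if j \<in> S \<and> k \<in> S then of_real (1 / real m) * tgram p n S \<Theta> B j k else 0)"

lemma supported_tblock: "supported S (tblock m p n S \<Theta> B)"
  by (simp add: supported_def tblock_def)

lemma adj_tblock: "adj (tblock m p n S \<Theta> B) = tblock m p n S \<Theta> B"
  by (simp add: adj_def tblock_def tgram_def cnj_gram fun_eq_iff)

lemma fip_columns: "fip K X Y = (\<Sum>k\<in>K. Re (cin K (\<lambda>j. X j k) (\<lambda>j. Y j k)))"
  unfolding fip_def cin_def by (subst sum.swap) simp

lemma mm_column: "(\<lambda>j. mm K Z X j k) = mv K Z (\<lambda>j. X j k)"
  by (simp add: mm_def mv_def)

text \<open>Supplies Z^2 <= \<rho> Z with \<rho> = \<Theta>/m. For a single column v, the norm of Z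
  v squared is m^(-2) times that of the adjoint of B_S applied to B_S v, hence at most \<Theta>/m^2
  times the squared norm of B_S v, and the latter is m times the quadratic form of Z at v.\<close>

lemma tblock_square_le:
  fixes m p :: nat and B :: cmat
  assumes S: "S \<subseteq> {..<n}" and \<Theta>: "0 \<le> \<Theta>"
  defines "Z \<equiv> tblock m p n S \<Theta> B"
  shows "fip S (mm S Z X) (mm S Z X) \<le> \<Theta> / m * fip S X (mm S Z X)"
proof -
  have "Re (cin S (mv S Z v) (mv S Z v)) \<le> \<Theta> / m * Re (cin S v (mv S Z v))" for v
  proof (cases "row_bounded p n S \<Theta> B")
    case True
    let ?b = "\<lambda>i. \<Sum>k\<in>S. B i k * v k"
    have Zv: "mv S Z v j = of_real (1 / real m) * (\<Sum>k\<in>S. gram p B j k * v k)" if "j \<in> S" for j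
      using that True unfolding mv_def Z_def sum_distrib_left
      by (intro sum.cong) (auto simp: tblock_def tgram_def)
    have Zc: "mv S Z v j = of_real (1 / real m) * (\<Sum>i<p. cnj (B i j) * ?b i)" if "j \<in> S" for j
    proof -
      have "(\<Sum>k\<in>S. gram p B j k * v k) = (\<Sum>i<p. cnj (B i j) * ?b i)"
        unfolding gram_def sum_distrib_right sum_distrib_left by (subst sum.swap) (simp add: mult.assoc)
      then show ?thesis using Zv[OF that] by simp
    qed
    have "Re (cin S (mv S Z v) (mv S Z v)) = (nrm S (mv S Z v))\<^sup>2" by (simp add: cin_self)
    also have "nrm S (mv S Z v) = nrm S (\<lambda>j. of_real (1 / real m) * (\<Sum>i<p. cnj (B i j) * ?b i))"
      by (intro nrm_cong Zc)
    also have "\<dots> = 1 / m * nrm S (\<lambda>j. \<Sum>i<p. cnj (B i j) * ?b i)" by (subst nrm_scale) (simp add: norm_divide)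
    also have "\<dots>\<^sup>2 \<le> (1 / m)\<^sup>2 * (\<Theta> * (nrm {..<p} ?b)\<^sup>2)"
      unfolding power_mult_distrib by (intro mult_left_mono nrm_block_adjoint_mult_le[OF S True \<Theta>]) auto
    also have "\<dots> = \<Theta> / m * (1 / m * (nrm {..<p} ?b)\<^sup>2)" by (simp add: power2_eq_square)
    also have "1 / m * (nrm {..<p} ?b)\<^sup>2 = Re (cin S v (\<lambda>j. of_real (1 / real m) * (\<Sum>k\<in>S. gram p B j k * v k)))"
      unfolding cin_scale_right cin_gram by simp
    also have "cin S v (\<lambda>j. of_real (1 / real m) * (\<Sum>k\<in>S. gram p B j k * v k)) = cin S v (mv S Z v)"
      unfolding cin_def by (intro sum.cong) (simp_all add: Zv)
    finally show ?thesis .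
  next
    case False
    then have "mv S Z v = (\<lambda>j. 0)" by (auto simp: mv_def Z_def tblock_def tgram_def fun_eq_iff intro!: sum.neutral)
    then show ?thesis by (simp add: cin_def)
  qed
  then show ?thesis unfolding fip_columns mm_column sum_distrib_left by (intro sum_mono)
qed

text \<open>Aligning each entry of \<open>z\<close> on \<open>S\<close> with the sign there bounds
  its modulus below by the signal size minus the real part of the aligned error. Since the l1 norm
  of \<open>z\<close> does not exceed that of the signal, the mass off \<open>S\<close> is paid for
  by this loss on \<open>S\<close>.\<close>

lemma qBP_minimizer_cone:
  assumes S: "S \<subseteq> {..<n}" and \<sigma>: "\<And>k. k \<in> S \<Longrightarrow> cmod (\<sigma> k) = 1"
    and l1: "l1norm n z \<le> l1norm n (signal S r \<sigma>)" and r: "\<And>k. k \<in> S \<Longrightarrow> 0 \<le> r k"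
  defines "d \<equiv> \<lambda>j. signal S r \<sigma> j - z j"
  shows "(\<Sum>j\<in>{..<n} - S. cmod (d j)) \<le> cmod (cin S \<sigma> d)"
proof -
  have split: "(\<Sum>j<n. f j) = (\<Sum>j\<in>S. f j) + (\<Sum>j\<in>{..<n} - S. f j)" for f :: "nat \<Rightarrow> real"
    using sum.subset_diff[OF S, of f] by simp
  have on: "r k - Re (cnj (\<sigma> k) * d k) \<le> cmod (z k)" if "k \<in> S" for k
  proof -
    have "cnj (\<sigma> k) * \<sigma> k = 1" using \<sigma>[OF that] complex_norm_square[of "\<sigma> k"] by (simp add: mult.commute)
    then have "cnj (\<sigma> k) * z k = of_real (r k) - cnj (\<sigma> k) * d k"
      using that by (simp add: d_def signal_def algebra_simps)
    then have "r k - Re (cnj (\<sigma> k) * d k) = Re (cnj (\<sigma> k) * z k)" by simp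
    also have "\<dots> \<le> cmod (cnj (\<sigma> k) * z k)" by (rule complex_Re_le_cmod)
    also have "\<dots> = cmod (z k)" using \<sigma>[OF that] by (simp add: norm_mult)
    finally show ?thesis .
  qed
  have "(\<Sum>k\<in>S. r k) - Re (cin S \<sigma> d) + (\<Sum>j\<in>{..<n} - S. cmod (d j)) \<le> l1norm n z"
  proof -
    have "(\<Sum>k\<in>S. r k) - Re (cin S \<sigma> d) = (\<Sum>k\<in>S. r k - Re (cnj (\<sigma> k) * d k))"
      by (simp add: cin_def sum_subtractf)
    also have "\<dots> \<le> (\<Sum>k\<in>S. cmod (z k))" by (intro sum_mono on)
    finally show ?thesis unfolding l1norm_def split by (simp add: d_def signal_def)
  qed
  also have "l1norm n z \<le> (\<Sum>k\<in>S. r k)"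
    using l1 \<sigma> r unfolding l1norm_def split[of "\<lambda>j. cmod (signal S r \<sigma> j)"]
    by (simp add: signal_def norm_mult)
  finally show ?thesis using complex_Re_le_cmod[of "cin S \<sigma> d"] by linarith
qed

text \<open>On the good event the truncated Gram matrices are the true ones, so H is the Gram matrix
  of the columns of A. Feasibility of both the minimizer and the signal gives the tube bound
  \<open>2 * \<eta>\<close> and the cone condition.\<close>

lemma qBP_recovery:
  fixes Bs :: "nat \<Rightarrow> cmat" and p :: "nat \<Rightarrow> nat" and n m :: nat and S :: "nat set" and \<Theta> :: real
  defines "H \<equiv> \<lambda>j k. \<Sum>l<m. of_real (1 / real m) * tgram (p l) n S \<Theta> (Bs l) j k"
  defines "X \<equiv> \<lambda>j k. (\<Sum>l<m. tblock m (p l) n S \<Theta> (Bs l) j k) - idm S j k"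
  assumes S: "S \<subseteq> {..<n}" and good: "\<And>l. l < m \<Longrightarrow> row_bounded (p l) n S \<Theta> (Bs l)"
    and X_le: "\<And>v. nrm S (mv S X v) \<le> 1 / 2 * nrm S v"
    and cross: "\<And>j. j \<in> {..<n} - S \<Longrightarrow> nrm S (\<lambda>k. H k j) \<le> 1 / 8"
    and cert: "\<And>j. j \<in> {..<n} - S \<Longrightarrow> cmod (cin S (neumann S X n (\<lambda>k. H k j)) \<sigma>) \<le> 1 / 2"
    and \<sigma>: "\<And>k. k \<in> S \<Longrightarrow> cmod (\<sigma> k) = 1" and r: "\<And>k. k \<in> S \<Longrightarrow> 0 \<le> r k"
    and e: "norm2_rows m p e \<le> \<eta>"
    and z: "qBP_minimizer n m p Bs (\<lambda>rw. Amul n m Bs (signal S r \<sigma>) rw + e rw) \<eta> z"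
  shows "l2norm n (\<lambda>j. signal S r \<sigma> j - z j) \<le> (21 + 36 * sqrt (real (card S))) * \<eta>"
proof -
  let ?x = "signal S r \<sigma>"
  let ?W = "rows m p"
  define a where "a j = (\<lambda>(l, i). of_real (1 / sqrt (real m)) * Bs l i j)" for j
  have nr: "norm2_rows m p v = nrm ?W v" for v by (simp add: norm2_rows_def nrm_def L2_set_def)
  have Am: "Amul n m Bs v rw = (\<Sum>j<n. a j rw * v j)" for v rw
    by (simp add: Amul_def a_def case_prod_unfold sum_distrib_left mult.assoc)
  have H: "cin ?W (a j) (a k) = H j k" for j k
  proof -
    have mm: "of_real (1 / sqrt (real m)) * of_real (1 / sqrt (real m)) = (of_real (1 / real m) :: complex)"
      unfolding of_real_mult[symmetric] by simp
    have "cin ?W (a j) (a k) = (\<Sum>l<m. \<Sum>i<p l. cnj (a j (l, i)) * a k (l, i))"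
      unfolding cin_def rows_def by (subst sum.Sigma) (auto simp: case_prod_unfold)
    also have "\<dots> = (\<Sum>l<m. of_real (1 / real m) * gram (p l) (Bs l) j k)"
      unfolding gram_def sum_distrib_left mm[symmetric]
      by (intro sum.cong refl) (simp add: a_def algebra_simps)
    also have "\<dots> = H j k" unfolding H_def using good by (intro sum.cong) (auto simp: tgram_def)
    finally show ?thesis .
  qed
  have Xa: "adj X = X"
  proof -
    have "cnj (tblock m p n S \<Theta> B k j) = tblock m p n S \<Theta> B j k" for p B j k
      using adj_tblock[of m p n S \<Theta> B] unfolding adj_def by metis
    then show ?thesis using adj_idm[of S] unfolding X_def adj_def fun_eq_iff by simp
  qed
  have "nrm {..<n} (\<lambda>j. ?x j - z j) \<le> (21 + 36 * sqrt (real (card S))) * \<eta>"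
  proof (rule recovery_from_certificate[where W="?W" and a=a and X=X and \<sigma>=\<sigma>, unfolded H, OF S _ Xa X_le cross cert \<sigma>])
    show "X j k = H j k - idm S j k" if "j \<in> S" "k \<in> S" for j k
      using that by (simp add: X_def H_def tblock_def)
    have f: "qBP_feasible n m p Bs (\<lambda>rw. Amul n m Bs ?x rw + e rw) \<eta> z"
      and min: "\<And>w. qBP_feasible n m p Bs (\<lambda>rw. Amul n m Bs ?x rw + e rw) \<eta> w \<Longrightarrow> l1norm n z \<le> l1norm n w"
      using z by (auto simp: qBP_minimizer_def)
    have "nrm ?W (\<lambda>rw. (Amul n m Bs ?x rw + e rw - Amul n m Bs z rw) - e rw) \<le> \<eta> + \<eta>"
      using f e nrm_triangle_diff[of ?W "\<lambda>rw. Amul n m Bs ?x rw + e rw - Amul n m Bs z rw" e]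
      unfolding qBP_feasible_def nr by linarith
    then show "nrm ?W (\<lambda>rw. \<Sum>j<n. a j rw * (?x j - z j)) \<le> 2 * \<eta>"
      by (simp add: Am algebra_simps sum_subtractf)
    have "qBP_feasible n m p Bs (\<lambda>rw. Amul n m Bs ?x rw + e rw) \<eta> ?x"
      using e by (simp add: qBP_feasible_def)
    then show "(\<Sum>j\<in>{..<n} - S. cmod (?x j - z j)) \<le> cmod (cin S \<sigma> (\<lambda>j. ?x j - z j))"
      by (intro qBP_minimizer_cone S \<sigma> r min)
  qed
  then show ?thesis by (simp add: l2norm_def nrm_def L2_set_def)
qed

section \<open>Sign sequences\<close>

lemma rademacher_signs:
  defines "Q \<equiv> measure_pmf (pmf_of_set {1, -1 :: complex})"
  shows "prob_space Q" "integrable Q (\<lambda>b. b)" "(\<integral>b. b \<partial>Q) = 0" "AE b in Q. cmod b = 1"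
proof -
  show "prob_space Q" unfolding Q_def by (rule measure_pmf.prob_space_axioms)
  show "integrable Q (\<lambda>b. b)" unfolding Q_def by (rule integrable_measure_pmf_finite) simp
  show "(\<integral>b. b \<partial>Q) = 0" unfolding Q_def by (subst integral_measure_pmf[of "{1, -1}"]) auto
  show "AE b in Q. cmod b = 1" unfolding Q_def by (simp add: AE_measure_pmf_iff)
qed

lemma steinhaus_signs:
  defines "Q \<equiv> distr (uniform_measure lborel {0..<2*pi}) borel (\<lambda>t. cis t)"
  shows "prob_space Q" "integrable Q (\<lambda>b. b)" "(\<integral>b. b \<partial>Q) = 0" "AE b in Q. cmod b = 1"
    "(\<lambda>b. b) \<in> borel_measurable Q"
proof -
  let ?U = "uniform_measure lborel {0..<2*pi}"
  interpret U: prob_space ?U by (intro prob_space_uniform_measure) auto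
  have c: "cis \<in> borel_measurable borel"
    by (intro borel_measurable_continuous_onI continuous_intros)
  then have cU: "cis \<in> borel_measurable ?U"
  proof -
    have "measurable ?U borel = measurable borel (borel :: complex measure)"
      by (rule measurable_cong_sets) simp_all
    then show ?thesis using c by simp
  qed
  show "prob_space Q" unfolding Q_def using cU by (rule U.prob_space_distr)
  interpret Q: prob_space Q by fact
  show m: "(\<lambda>b. b) \<in> borel_measurable Q" unfolding Q_def by simp
  show ae: "AE b in Q. cmod b = 1" unfolding Q_def using cU by (subst AE_distr_iff) auto
  show "integrable Q (\<lambda>b. b)"
    by (rule Q.integrable_const_bound[where B=1]) (use ae m in auto)
  have "(\<integral>b. b \<partial>Q) = (\<integral>t. cis t \<partial>?U)" unfolding Q_def using cU by (subst integral_distr) auto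
  also have "\<dots> = 0"
  proof -
    have U: "?U = density lborel (\<lambda>t. ennreal (indicator {0..<2*pi} t / (2*pi)))"
    proof -
      have "(indicator {0..<2*pi} t :: ennreal) / emeasure lborel {0..<2*pi} = ennreal (indicator {0..<2*pi} t / (2*pi))" for t
        by (simp add: indicator_def divide_ennreal flip: ennreal_1)
      then show ?thesis unfolding uniform_measure_def by simp
    qed
    have "(\<integral>t. cis t \<partial>?U) = (\<integral>t. (indicator {0..<2*pi} t / (2*pi)) *\<^sub>R cis t \<partial>lborel)"
      unfolding U using c by (subst integral_density) auto
    \<comment> \<open>Adding the endpoint, a null set, produces the closed interval on which the
      fundamental theorem of calculus is applied.\<close>
    also have "\<dots> = (\<integral>t. (1 / (2*pi)) *\<^sub>R (indicator {0..2*pi} t *\<^sub>R cis t) \<partial>lborel)"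
    proof (rule integral_cong_AE)
      show "AE t in lborel. (indicator {0..<2*pi} t / (2*pi)) *\<^sub>R cis t = (1 / (2*pi)) *\<^sub>R (indicator {0..2*pi} t *\<^sub>R cis t)"
        using AE_lborel_singleton[of "2*pi"] by eventually_elim (auto simp: indicator_def)
    qed (use c in auto)
    also have "\<dots> = (1 / (2*pi)) *\<^sub>R (\<integral>t. indicator {0..2*pi} t *\<^sub>R cis t \<partial>lborel)" by (rule integral_scaleR_right)
    also have "(\<integral>t. indicator {0..2*pi} t *\<^sub>R cis t \<partial>lborel) = - \<i> * cis (2*pi) - (- \<i> * cis 0)"
    proof (rule integral_FTC_Icc)
      fix t
      have "((\<lambda>t. - \<i> * cis t) has_vector_derivative - \<i> * (\<i> * cis t)) (at t within {0..2*pi})"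
        using has_derivative_cis[OF has_derivative_ident, of t]
        by (intro has_vector_derivative_mult_right) (simp add: has_vector_derivative_def)
      then show "((\<lambda>t. - \<i> * cis t) has_vector_derivative cis t) (at t within {0..2*pi})"
        by (simp add: mult.assoc[symmetric])
    qed (auto intro!: continuous_intros)
    finally show ?thesis by simp
  qed
  finally show "(\<integral>b. b \<partial>Q) = 0" .
qed

section \<open>Probability bounds for the block model\<close>

locale block_model =
  fixes n m :: nat and p :: "nat \<Rightarrow> nat" and F :: "nat \<Rightarrow> cmat measure" and S :: "nat set" and \<Theta> :: real
  assumes n: "n \<ge> 1" and m: "m \<ge> 1" and prob_F: "\<And>l. l < m \<Longrightarrow> prob_space (F l)"
    and entry_measurable: "\<And>l i j. l < m \<Longrightarrow> i < p l \<Longrightarrow> j < n \<Longrightarrow> (\<lambda>B. B i j) \<in> borel_measurable (F l)"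
    and iso: "isotropic n m p F" and S: "S \<subseteq> {..<n}" and theta: "theta_bound n m p F S \<Theta>"
begin

text \<open>The library's product measure locale wants a probability measure at every index, so \<open>F\<close> is
  extended beyond \<open>m\<close> by point masses.\<close>
definition M :: "nat \<Rightarrow> cmat measure" where
  "M l = (if l < m then F l else return (count_space UNIV) (\<lambda>_ _. 0))"

abbreviation T :: "nat \<Rightarrow> cmat \<Rightarrow> nat \<Rightarrow> nat \<Rightarrow> complex" where
  "T l \<equiv> tgram (p l) n S \<Theta>"

definition H :: "(nat \<Rightarrow> cmat) \<Rightarrow> nat \<Rightarrow> nat \<Rightarrow> complex" where
  "H Bs j k = (\<Sum>l<m. of_real (1 / real m) * T l (Bs l) j k)"

definition X :: "(nat \<Rightarrow> cmat) \<Rightarrow> nat \<Rightarrow> nat \<Rightarrow> complex" where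
  "X Bs = (\<lambda>j k. (\<Sum>l<m. tblock m (p l) n S \<Theta> (Bs l) j k) - idm S j k)"

lemma finite_S: "finite S" using S finite_subset by blast

lemma \<Theta>_pos: "0 < \<Theta>" using theta by (simp add: theta_bound_def)

lemma prob_M: "prob_space (M l)"
  using prob_F by (auto simp: M_def intro: prob_space_return)

lemma PiM_M: "PiM {..<m} M = PiM {..<m} F"
  by (intro PiM_cong) (auto simp: M_def)

lemma gram_measurable: "l < m \<Longrightarrow> j < n \<Longrightarrow> k < n \<Longrightarrow> (\<lambda>B. gram (p l) B j k) \<in> borel_measurable (M l)"
  unfolding gram_def M_def using entry_measurable
  by (auto intro!: borel_measurable_sum borel_measurable_times
      measurable_compose[OF _ borel_measurable_continuous_onI[OF continuous_on_cnj[OF continuous_on_id]]])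

lemma row_bounded_measurable: "l < m \<Longrightarrow> Measurable.pred (M l) (row_bounded (p l) n S \<Theta>)"
proof -
  assume l: "l < m"
  have "{B \<in> space (M l). (\<Sum>k\<in>S. cmod (gram (p l) B j k)) \<le> \<Theta>} \<in> sets (M l)" if "j \<in> {..<n}" for j
  proof -
    have "(\<lambda>B. \<Sum>k\<in>S. cmod (gram (p l) B j k)) \<in> borel_measurable (M l)"
      using that S by (intro borel_measurable_sum measurable_compose[OF gram_measurable[OF l] borel_measurable_norm]) auto
    then show ?thesis by (rule borel_measurable_le) simp
  qed
  then have "{B \<in> space (M l). \<forall>j\<in>{..<n}. (\<Sum>k\<in>S. cmod (gram (p l) B j k)) \<le> \<Theta>} \<in> sets (M l)"
    by (rule sets.sets_Collect_finite_All[OF _ finite_lessThan])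
  moreover have "row_bounded (p l) n S \<Theta> B \<longleftrightarrow> (\<forall>j\<in>{..<n}. (\<Sum>k\<in>S. cmod (gram (p l) B j k)) \<le> \<Theta>)" for B
    unfolding row_bounded_def by blast
  ultimately show ?thesis by (simp only: pred_def)
qed

lemma AE_row_bounded: "l < m \<Longrightarrow> AE B in M l. row_bounded (p l) n S \<Theta> B"
proof -
  assume l: "l < m"
  then have "M l = F l" by (simp add: M_def)
  then show ?thesis using theta l by (simp only: theta_bound_def inf_norm_gram_S_le_iff[OF n])
qed

lemma tgram_row_le:
  assumes "j < n" shows "(\<Sum>k\<in>S. cmod (T l B j k)) \<le> \<Theta>"
proof (cases "row_bounded (p l) n S \<Theta> B")
  case True
  then have "(\<Sum>k\<in>S. cmod (T l B j k)) = (\<Sum>k\<in>S. cmod (gram (p l) B j k))" by (simp add: tgram_def)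
  then show ?thesis using True assms by (simp add: row_bounded_def)
next
  case False
  then show ?thesis using \<Theta>_pos by (simp add: tgram_def)
qed

lemma cmod_tgram_commute: "cmod (T l B j k) = cmod (T l B k j)"
  by (simp add: tgram_def cmod_gram_commute[of _ _ j])

lemma bounded_meas_tgram: "l < m \<Longrightarrow> j \<in> S \<Longrightarrow> k < n \<Longrightarrow> bounded_meas (M l) (\<lambda>B. T l B j k)"
proof -
  assume l: "l < m" and j: "j \<in> S" and k: "k < n"
  have "(\<lambda>B. T l B j k) \<in> borel_measurable (M l)"
    unfolding tgram_def using l j k S
    by (intro measurable_If gram_measurable row_bounded_measurable[unfolded pred_def]) (auto simp: row_bounded_measurable[OF l, unfolded pred_def])
  \<comment> \<open>Row sums only run over \<open>S\<close>; Hermitian symmetry moves the index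
    \<open>j\<close> of \<open>S\<close> into the second place.\<close>
  moreover have "cmod (T l B j k) \<le> \<Theta>" for B
    using member_le_sum[OF j, of "\<lambda>j. cmod (T l B k j)"] finite_S tgram_row_le[OF k, of l B]
    by (simp add: cmod_tgram_commute[of l B j])
  ultimately show ?thesis by (auto simp: bounded_meas_def)
qed

lemma sum_integral_tgram:
  assumes "j \<in> S" "k < n"
  shows "(\<Sum>l<m. \<integral>B. T l B j k \<partial>M l) = (if j = k then of_nat m else 0)"
proof -
  have j: "j < n" using assms S by auto
  have "(\<integral>B. T l B j k \<partial>M l) = (\<integral>B. gram (p l) B j k \<partial>F l)" if l: "l < m" for l
  proof -
    have "(\<integral>B. T l B j k \<partial>M l) = (\<integral>B. gram (p l) B j k \<partial>M l)"
    proof (rule integral_cong_AE)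
      show "AE B in M l. T l B j k = gram (p l) B j k"
        using AE_row_bounded[OF l] by eventually_elim (simp add: tgram_def)
    qed (use bounded_meas_measurable[OF bounded_meas_tgram[OF l assms]] gram_measurable[OF l j assms(2)] in auto)
    then show ?thesis using l by (simp add: M_def)
  qed
  then have "(\<Sum>l<m. \<integral>B. T l B j k \<partial>M l) = (\<Sum>l<m. \<integral>B. gram (p l) B j k \<partial>F l)" by simp
  moreover have "1 / of_nat m * (\<Sum>l<m. \<integral>B. gram (p l) B j k \<partial>F l) = (if j = k then 1 else (0::complex))"
    using iso j assms unfolding isotropic_def by blast
  ultimately show ?thesis using m by (auto simp: field_simps split: if_splits)
qed

lemma bounded_meas_mat_tblock: "l < m \<Longrightarrow> bounded_meas_mat (M l) (tblock m (p l) n S \<Theta>)"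
  unfolding bounded_meas_mat_def
proof (intro allI)
  fix j k assume l: "l < m"
  show "bounded_meas (M l) (\<lambda>B. tblock m (p l) n S \<Theta> B j k)"
  proof (cases "j \<in> S \<and> k \<in> S")
    case True
    then have "bounded_meas (M l) (\<lambda>B. of_real (1 / real m) * T l B j k)" using S l by (intro bounded_meas_mult bounded_meas_const bounded_meas_tgram) auto
    then show ?thesis using True by (simp add: tblock_def)
  next
    case False
    then have "(\<lambda>B. tblock m (p l) n S \<Theta> B j k) = (\<lambda>B. 0)" by (auto simp: tblock_def)
    then show ?thesis by (simp add: bounded_meas_const)
  qed
qed

lemma sum_integral_tblock: "(\<Sum>l<m. \<integral>B. tblock m (p l) n S \<Theta> B j k \<partial>M l) = idm S j k"
proof (cases "j \<in> S \<and> k \<in> S")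
  case True
  then have "k < n" using S by auto
  have "(\<Sum>l<m. \<integral>B. tblock m (p l) n S \<Theta> B j k \<partial>M l) = of_real (1 / real m) * (\<Sum>l<m. \<integral>B. T l B j k \<partial>M l)"
    using True by (simp add: tblock_def sum_distrib_left)
  also have "\<dots> = idm S j k" using True m sum_integral_tgram[of j k] \<open>k < n\<close> by (simp add: idm_def)
  finally show ?thesis .
qed (auto simp: tblock_def idm_def)

lemma prob_pow_X_ge_le:
  assumes "\<Theta> / m * real q \<le> 1 / 168"
  shows "measure (PiM {..<m} M) {\<omega> \<in> space (PiM {..<m} M). ((1 / 2) ^ q)\<^sup>2 \<le> fip S (pow S (X \<omega>) q) (pow S (X \<omega>) q)}
     \<le> card S * (1 / 4) ^ q"
  unfolding X_def
proof (rule prob_frobenius_pow_ge_le[OF prob_M _ finite_S _ supported_tblock adj_tblock _ sum_integral_tblock _ assms])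
  show "bounded_meas_mat (M l) (tblock m (p l) n S \<Theta>)" if "l \<in> {..<m}" for l using that bounded_meas_mat_tblock by simp
  show "fip S (mm S (tblock m (p l) n S \<Theta> b) X) (mm S (tblock m (p l) n S \<Theta> b) X)
     \<le> \<Theta> / real m * fip S X (mm S (tblock m (p l) n S \<Theta> b) X)" for l b X
    using \<Theta>_pos by (intro tblock_square_le[OF S]) auto
  show "0 \<le> \<Theta> / real m" using \<Theta>_pos by simp
qed simp

text \<open>Vector Bernstein for the j-th columns of the blocks, centred and divided by m. Their
  norms are at most 2 \<Theta>/m. Their second moments are at most \<Theta>/m^2 times the mean
  squared norm of the j-th column of B_l, and by isotropy these means add up to m; the total
  variance is at most \<Theta>/m.\<close>

lemma prob_cross_ge_le:
  assumes j: "j \<in> {..<n} - S" and \<beta>: "0 < \<beta>" "\<beta> \<le> 1"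
  shows "measure (PiM {..<m} M) {\<omega> \<in> space (PiM {..<m} M). \<beta> \<le> nrm S (\<lambda>k. H \<omega> k j)}
     \<le> 2 * exp (- (\<beta>\<^sup>2 * m / (4 * \<Theta>)))"
proof -
  have jn: "j < n" using j by simp
  let ?E = "\<lambda>l k. \<integral>B. T l B k j \<partial>M l"
  define Y where "Y l B k = of_real (1 / real m) * (T l B k j - ?E l k)" for l B k
  \<comment> \<open>The minimiser of \<kappa>^2 \<Theta>/m - \<kappa> \<beta>. It is admissible
    because \<kappa> times the norm bound 2 \<Theta>/m is \<beta> <= 1.\<close>
  define \<kappa> where "\<kappa> = \<beta> * m / (2 * \<Theta>)"
  have bT: "bounded_meas (M l) (\<lambda>B. T l B k j)" if "l < m" "k \<in> S" for l k using bounded_meas_tgram that jn by auto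
  have iT: "integrable (M l) (\<lambda>B. T l B k j)" if "l < m" "k \<in> S" for l k
    by (intro bounded_meas_integrable prob_M bT that)
  have col: "(\<Sum>k\<in>S. cmod (T l B k j)) \<le> \<Theta>" for l B
    using tgram_row_le[OF jn, of l B] by (simp add: cmod_tgram_commute[of l B _ j])
  have bY: "bounded_meas (M l) (\<lambda>B. Y l B k)" if "l < m" "k \<in> S" for l k
    unfolding Y_def by (intro bounded_meas_mult bounded_meas_diff bounded_meas_const bT that)
  have sum: "(\<Sum>l<m. Y l (\<omega> l) k) = H \<omega> k j" if "k \<in> S" for \<omega> k
  proof -
    \<comment> \<open>Isotropy with \<open>k\<close> in \<open>S\<close> and \<open>j\<close>
      outside: centring the blocks individually does not change their sum.\<close>
    have "(\<Sum>l<m. ?E l k) = 0" using sum_integral_tgram[OF that jn] that j by auto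
    then show ?thesis unfolding Y_def H_def sum_distrib_left[symmetric] by (simp add: sum_subtractf)
  qed
  have set: "{\<omega> \<in> space (PiM {..<m} M). \<beta> \<le> nrm S (\<lambda>k. \<Sum>l\<in>{..<m}. Y l (\<omega> l) k)}
      = {\<omega> \<in> space (PiM {..<m} M). \<beta> \<le> nrm S (\<lambda>k. H \<omega> k j)}"
    by (subst nrm_cong[OF sum]) auto
  have "measure (PiM {..<m} M) {\<omega> \<in> space (PiM {..<m} M). \<beta> \<le> nrm S (\<lambda>k. \<Sum>l\<in>{..<m}. Y l (\<omega> l) k)}
     \<le> 2 * exp (\<kappa>\<^sup>2 * (\<Theta> / m) - \<kappa> * \<beta>)"
  proof (rule vector_bernstein[OF prob_M])
    show "integrable (M l) (\<lambda>B. Y l B k)" if "l \<in> {..<m}" "k \<in> S" for l k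
      using that by (intro bounded_meas_integrable prob_M bY) auto
    show "(\<integral>B. Y l B k \<partial>M l) = 0" if "l \<in> {..<m}" "k \<in> S" for l k
    proof -
      interpret prob_space "M l" by (rule prob_M)
      show ?thesis using iT[of l k] that prob_space unfolding Y_def by simp
    qed
    show "\<kappa> * nrm S (Y l B) \<le> 1" if l: "l \<in> {..<m}" for l B
    proof -
      interpret prob_space "M l" by (rule prob_M)
      have iN: "integrable (M l) (\<lambda>B. cmod (T l B k j))" if "k \<in> S" for k
        using iT[of l k] l that by (intro integrable_norm) auto
      have "(\<Sum>k\<in>S. cmod (?E l k)) \<le> (\<Sum>k\<in>S. \<integral>B. cmod (T l B k j) \<partial>M l)"
        by (intro sum_mono integral_norm_bound)
      also have "\<dots> = (\<integral>B. (\<Sum>k\<in>S. cmod (T l B k j)) \<partial>M l)"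
        by (rule Bochner_Integration.integral_sum[symmetric]) (rule iN)
      also have "\<dots> \<le> (\<integral>B. \<Theta> \<partial>M l)"
        by (intro integral_mono Bochner_Integration.integrable_sum iN integrable_const col)
      also have "\<dots> = \<Theta>" using prob_space by simp
      finally have E: "nrm S (?E l) \<le> \<Theta>" by (rule order_trans[OF nrm_le_l1])
      have "nrm S (Y l B) = 1 / m * nrm S (\<lambda>k. T l B k j - ?E l k)"
        unfolding Y_def by (subst nrm_scale) (simp add: norm_divide)
      also have "\<dots> \<le> 1 / m * (\<Theta> + \<Theta>)"
      proof (rule mult_left_mono)
        show "nrm S (\<lambda>k. T l B k j - ?E l k) \<le> \<Theta> + \<Theta>"
          using nrm_triangle_diff[of S "\<lambda>k. T l B k j" "?E l"] nrm_le_l1[of S "\<lambda>k. T l B k j"] col[of l B] E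
          by linarith
      qed simp
      finally have "\<kappa> * nrm S (Y l B) \<le> \<kappa> * (1 / m * (\<Theta> + \<Theta>))"
        using \<beta> \<Theta>_pos by (intro mult_left_mono) (auto simp: \<kappa>_def)
      also have "\<dots> = \<beta>" using \<Theta>_pos m by (simp add: \<kappa>_def)
      finally show ?thesis using \<beta> by simp
    qed
    \<comment> \<open>Since \<open>j\<close> lies outside \<open>S\<close>, the row sums do not
      bound this diagonal entry; its integrability comes from \<open>isotropic\<close>.\<close>
    have gi: "integrable (M l) (\<lambda>B. Re (gram (p l) B j j))" if "l < m" for l
      using iso that jn unfolding isotropic_def M_def by (auto intro: integrable_Re)
    have "(\<integral>B. (nrm S (Y l B))\<^sup>2 \<partial>M l) \<le> \<Theta> / m\<^sup>2 * (\<integral>B. Re (gram (p l) B j j) \<partial>M l)" if l: "l < m" for l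
    proof -
      interpret prob_space "M l" by (rule prob_M)
      have b2: "bounded_meas (M l) (\<lambda>B. (cmod (T l B k j))\<^sup>2)" if "k \<in> S" for k
      proof -
        have "bounded_meas (M l) (\<lambda>B. Re (cnj (T l B k j) * T l B k j))" by (intro bounded_meas_Re bounded_meas_mult bounded_meas_cnj bT l that)
        then show ?thesis by (simp add: cmod_power2, simp add: power2_eq_square)
      qed
      have i2: "integrable (M l) (\<lambda>B. (cmod (T l B k j))\<^sup>2)" if "k \<in> S" for k
        by (intro bounded_meas_integrable prob_M b2 that)
      have var: "(\<integral>B. (cmod (Y l B k))\<^sup>2 \<partial>M l) \<le> 1 / m\<^sup>2 * (\<integral>B. (cmod (T l B k j))\<^sup>2 \<partial>M l)"
        and iY: "integrable (M l) (\<lambda>B. (cmod (Y l B k))\<^sup>2)" if k: "k \<in> S" for k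
      proof -
        define u where "u B = Re (cnj (?E l k) * T l B k j)" for B
        have eq: "(cmod (Y l B k))\<^sup>2 = 1 / m\<^sup>2 * ((cmod (T l B k j))\<^sup>2 - 2 * u B + (cmod (?E l k))\<^sup>2)" for B
        proof -
          have "(cmod (T l B k j - ?E l k))\<^sup>2 = (cmod (T l B k j))\<^sup>2 - 2 * u B + (cmod (?E l k))\<^sup>2"
            by (simp add: u_def cmod_power2, simp add: power2_eq_square algebra_simps)
          then show ?thesis unfolding Y_def by (simp add: norm_mult norm_divide power_mult_distrib power_divide)
        qed
        have iu: "integrable (M l) u"
          unfolding u_def using iT[OF l k] by (intro integrable_Re integrable_mult_right)
        have "(\<integral>B. u B \<partial>M l) = Re (cnj (?E l k) * ?E l k)"
          unfolding u_def using iT[OF l k] by (subst integral_Re) auto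
        also have "\<dots> = (cmod (?E l k))\<^sup>2" by (simp add: cmod_power2, simp add: power2_eq_square)
        finally have re: "(\<integral>B. u B \<partial>M l) = (cmod (?E l k))\<^sup>2" .
        show "integrable (M l) (\<lambda>B. (cmod (Y l B k))\<^sup>2)" unfolding eq using i2[OF k] iu by simp
        have "(\<integral>B. (cmod (Y l B k))\<^sup>2 \<partial>M l)
            = 1 / m\<^sup>2 * ((\<integral>B. (cmod (T l B k j))\<^sup>2 \<partial>M l) - 2 * (\<integral>B. u B \<partial>M l) + (cmod (?E l k))\<^sup>2)"
          unfolding eq using i2[OF k] iu prob_space by simp
        also have "\<dots> \<le> 1 / m\<^sup>2 * (\<integral>B. (cmod (T l B k j))\<^sup>2 \<partial>M l)"
          unfolding re by (intro mult_left_mono) auto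
        finally show "(\<integral>B. (cmod (Y l B k))\<^sup>2 \<partial>M l) \<le> 1 / m\<^sup>2 * (\<integral>B. (cmod (T l B k j))\<^sup>2 \<partial>M l)" .
      qed
      have "(\<integral>B. (nrm S (Y l B))\<^sup>2 \<partial>M l) = (\<Sum>k\<in>S. \<integral>B. (cmod (Y l B k))\<^sup>2 \<partial>M l)"
        unfolding nrm_sq using iY by (intro Bochner_Integration.integral_sum) auto
      also have "\<dots> \<le> (\<Sum>k\<in>S. 1 / m\<^sup>2 * (\<integral>B. (cmod (T l B k j))\<^sup>2 \<partial>M l))" by (intro sum_mono var)
      also have "\<dots> = 1 / m\<^sup>2 * (\<integral>B. (nrm S (\<lambda>k. T l B k j))\<^sup>2 \<partial>M l)"
        unfolding nrm_sq sum_distrib_left[symmetric] using i2 by (subst Bochner_Integration.integral_sum) auto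
      also have "\<dots> \<le> 1 / m\<^sup>2 * (\<integral>B. \<Theta> * Re (gram (p l) B j j) \<partial>M l)"
      proof (intro mult_left_mono integral_mono)
        show "integrable (M l) (\<lambda>B. (nrm S (\<lambda>k. T l B k j))\<^sup>2)"
          unfolding nrm_sq using i2 by (intro Bochner_Integration.integrable_sum) auto
        show "integrable (M l) (\<lambda>B. \<Theta> * Re (gram (p l) B j j))" using gi[OF l] by simp
        fix B
        have g: "Re (gram (p l) B j j) = (nrm {..<p l} (\<lambda>i. B i j))\<^sup>2"
          by (simp add: gram_def nrm_sq cmod_power2, simp add: power2_eq_square)
        show "(nrm S (\<lambda>k. T l B k j))\<^sup>2 \<le> \<Theta> * Re (gram (p l) B j j)"
        proof (cases "row_bounded (p l) n S \<Theta> B")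
          case True
          then show ?thesis
            using nrm_block_adjoint_mult_le[OF S True, of "\<lambda>i. B i j"] \<Theta>_pos
            unfolding g by (simp add: tgram_def gram_def)
        next
          case False
          then have "nrm S (\<lambda>k. T l B k j) = 0" by (simp add: tgram_def nrm_def L2_set_def)
          then show ?thesis unfolding g using \<Theta>_pos by simp
        qed
      qed auto
      finally show ?thesis by simp
    qed
    then have "(\<Sum>l\<in>{..<m}. \<integral>B. (nrm S (Y l B))\<^sup>2 \<partial>M l) \<le> (\<Sum>l<m. \<Theta> / m\<^sup>2 * (\<integral>B. Re (gram (p l) B j j) \<partial>M l))"
      by (intro sum_mono) auto
    also have "\<dots> = \<Theta> / m\<^sup>2 * (\<Sum>l<m. \<integral>B. Re (gram (p l) B j j) \<partial>M l)" by (simp add: sum_distrib_left)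
    also have "(\<Sum>l<m. \<integral>B. Re (gram (p l) B j j) \<partial>M l) = Re (\<Sum>l<m. \<integral>B. gram (p l) B j j \<partial>F l)"
    proof -
      have "(\<integral>B. Re (gram (p l) B j j) \<partial>M l) = Re (\<integral>B. gram (p l) B j j \<partial>F l)" if "l < m" for l
        using that iso jn unfolding isotropic_def M_def by (auto intro!: integral_Re)
      then show ?thesis by simp
    qed
    also have "(\<Sum>l<m. \<integral>B. gram (p l) B j j \<partial>F l) = of_nat m"
    proof -
      have "1 / of_nat m * (\<Sum>l<m. \<integral>B. gram (p l) B j j \<partial>F l) = (1::complex)"
        using iso jn unfolding isotropic_def by auto
      then show ?thesis using m by (simp add: field_simps)
    qed
    finally show "(\<Sum>l\<in>{..<m}. \<integral>B. (nrm S (Y l B))\<^sup>2 \<partial>M l) \<le> \<Theta> / m"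
      using m by (simp add: power2_eq_square)
    show "0 < \<kappa>" using \<beta> \<Theta>_pos m by (simp add: \<kappa>_def)
  qed (use \<beta> in auto)
  also have "\<kappa>\<^sup>2 * (\<Theta> / m) - \<kappa> * \<beta> = - (\<beta>\<^sup>2 * m / (4 * \<Theta>))"
    using \<Theta>_pos m by (simp add: \<kappa>_def power2_eq_square field_simps)
  finally show ?thesis unfolding set .
qed

end

section \<open>The recovery event\<close>

lemma measure_pair_fst:
  assumes R: "prob_space R" and U: "U \<in> sets N"
  shows "measure (N \<Otimes>\<^sub>M R) (U \<times> space R) = measure N U"
proof -
  interpret R: prob_space R by fact
  show ?thesis using U by (simp add: measure_def R.emeasure_pair_measure_Times R.emeasure_space_1)
qed

lemma measure_pair_snd:
  assumes N: "prob_space N" and R: "prob_space R" and U: "U \<in> sets R"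
  shows "measure (N \<Otimes>\<^sub>M R) (space N \<times> U) = measure R U"
proof -
  interpret N: prob_space N by fact
  interpret R: prob_space R by fact
  show ?thesis using U by (simp add: measure_def R.emeasure_pair_measure_Times N.emeasure_space_1)
qed

text \<open>Independence of the signs from the blocks enters here: a bound for the signs with the
  blocks fixed holds for the product measure.\<close>

lemma measure_pair_le:
  assumes N: "prob_space N" and R: "prob_space R" and U: "U \<in> sets (N \<Otimes>\<^sub>M R)" and c: "0 \<le> c"
    and le: "\<And>\<omega>. \<omega> \<in> space N \<Longrightarrow> measure R (Pair \<omega> -` U) \<le> c"
  shows "measure (N \<Otimes>\<^sub>M R) U \<le> c"
proof -
  interpret N: prob_space N by fact
  interpret R: prob_space R by fact
  interpret pair_prob_space N R ..
  have "emeasure (N \<Otimes>\<^sub>M R) U = (\<integral>\<^sup>+\<omega>. emeasure R (Pair \<omega> -` U) \<partial>N)" by (rule R.emeasure_pair_measure_alt[OF U])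
  also have "\<dots> \<le> (\<integral>\<^sup>+\<omega>. ennreal c \<partial>N)"
    using le by (intro nn_integral_mono) (simp add: R.emeasure_eq_measure ennreal_leI)
  also have "\<dots> = ennreal c" by (simp add: N.emeasure_space_1)
  finally show ?thesis using c by (simp add: P.emeasure_eq_measure)
qed

context block_model
begin

lemma adj_X: "adj (X Bs) = X Bs"
proof -
  have "cnj (tblock m p n S \<Theta> B k j) = tblock m p n S \<Theta> B j k" for p B j k
    using adj_tblock[of m p n S \<Theta> B] unfolding adj_def by metis
  then show ?thesis using adj_idm[of S] unfolding X_def adj_def fun_eq_iff by simp
qed

lemma bounded_meas_mat_X: "bounded_meas_mat (PiM {..<m} M) X"
  unfolding X_def by (intro bounded_meas_mat_intros bounded_meas_mat_compose[OF bounded_meas_mat_tblock] measurable_component_singleton) auto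

lemma H_measurable:
  assumes "k \<in> S" "j < n" shows "(\<lambda>\<omega>. H \<omega> k j) \<in> borel_measurable (PiM {..<m} M)"
  unfolding H_def
  by (intro borel_measurable_sum borel_measurable_times borel_measurable_const
      measurable_PiM_component_comp[of "\<lambda>B. T _ B k j"] bounded_meas_measurable[OF bounded_meas_tgram]) (use assms in auto)

lemma neumann_measurable:
  assumes "j < n" "k \<in> S"
  shows "(\<lambda>\<omega>. neumann S (X \<omega>) N (\<lambda>k. H \<omega> k j) k) \<in> borel_measurable (PiM {..<m} M)"
proof -
  have "(\<lambda>\<omega>. (mv S (X \<omega>) ^^ i) (\<lambda>k. H \<omega> k j) k) \<in> borel_measurable (PiM {..<m} M)" if "k \<in> S" for i k
    using that
  proof (induction i arbitrary: k)
    case 0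
    then show ?case using H_measurable assms by simp
  next
    case (Suc i)
    have "(\<lambda>\<omega>. X \<omega> k l) \<in> borel_measurable (PiM {..<m} M)" for l
      using bounded_meas_mat_X by (auto simp: bounded_meas_mat_def intro: bounded_meas_measurable)
    then show ?case using Suc.IH by (simp add: mv_def borel_measurable_sum borel_measurable_times)
  qed
  then show ?thesis using assms unfolding neumann_def by (intro borel_measurable_sum borel_measurable_times) auto
qed

text \<open>\<open>Q\<close> is the law of a single sign, and only its mean and modulus are used, so
  the Rademacher and Steinhaus cases are treated at once. The exceptional events are: a block
  violating the row bound (null), a large moment of \<open>X\<close>, a large cross column, a large
  certificate, and a sign not of modulus 1 (null).\<close>

lemma recovery_event:
  fixes Q :: "complex measure" and e :: "nat \<times> nat \<Rightarrow> complex" and r :: "nat \<Rightarrow> real"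
  assumes Q: "prob_space Q" "integrable Q (\<lambda>b. b)" "(\<integral>b. b \<partial>Q) = 0" "AE b in Q. cmod b = 1"
    and r: "\<And>k. k \<in> S \<Longrightarrow> r k > 0" and e: "norm2_rows m p e \<le> \<eta>"
    and \<epsilon>: "0 < \<epsilon>" "\<epsilon> < 1" and m_ge: "real m \<ge> 889 * \<Theta> * (ln (6 * real n / \<epsilon>))\<^sup>2"
  shows "\<exists>E \<in> sets (PiM {..<m} F \<Otimes>\<^sub>M PiM S (\<lambda>_. Q)).
          measure (PiM {..<m} F \<Otimes>\<^sub>M PiM S (\<lambda>_. Q)) E \<ge> 1 - \<epsilon> \<and>
          (\<forall>\<omega>\<in>E. \<forall>z. qBP_minimizer n m p (fst \<omega>)
                         (\<lambda>rw. Amul n m (fst \<omega>) (signal S r (snd \<omega>)) rw + e rw) \<eta> z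
                      \<longrightarrow> l2norm n (\<lambda>j. signal S r (snd \<omega>) j - z j)
                            \<le> (21 + 36 * sqrt (real (card S))) * \<eta>)"
proof -
  define N where "N = PiM {..<m} M"
  define R where "R = PiM S (\<lambda>_. Q)"
  interpret N: prob_space N unfolding N_def by (intro prob_space_PiM prob_M)
  interpret R: prob_space R unfolding R_def by (intro prob_space_PiM Q)
  interpret NR: pair_prob_space N R ..
  define L where "L = ln (6 * real n / \<epsilon>)"
  have ratio: "6 \<le> 6 * real n / \<epsilon>"
  proof -
    have "\<epsilon> \<le> real n" using n \<epsilon> by linarith
    then show ?thesis using \<epsilon> by (simp add: field_simps)
  qed
  have "exp 1 \<le> 6 * real n / \<epsilon>" using exp_le ratio by linarith
  \<comment> \<open>Used for \<open>q \<le> 2 * L\<close>, for \<open>\<beta> \<le> 1 / 8\<close>,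
    and to pass from L to L^2 in the moment bound.\<close>
  then have L1: "1 \<le> L" unfolding L_def using \<epsilon> n by (subst ln_ge_iff) auto
  have expL: "exp (- L) = \<epsilon> / (6 * real n)" using \<epsilon> n unfolding L_def by (simp add: exp_minus)
  have mL: "889 * \<Theta> * L\<^sup>2 \<le> m" using m_ge by (simp add: L_def)
  define \<beta> where "\<beta> = 1 / (8 * sqrt L)"
  have \<beta>2: "\<beta>\<^sup>2 = 1 / (64 * L)" using L1 by (simp add: \<beta>_def power_divide power_mult_distrib)
  have sL: "1 \<le> sqrt L" using L1 by simp
  have \<beta>: "0 < \<beta>" "\<beta> \<le> 1 / 8" using L1 sL by (auto simp: \<beta>_def field_simps)
  \<comment> \<open>The moment order is just large enough that (1/4)^q <= exp (-q) <= exp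
    (-L).\<close>
  define q where "q = nat \<lceil>L\<rceil>"
  have q: "L \<le> real q" "real q \<le> 2 * L" using L1 unfolding q_def by linarith+
  define J where "J = {..<n} - S"
  have J: "finite J" "card J \<le> n" unfolding J_def using card_mono[of "{..<n}" "{..<n} - S"] by auto
  define f where "f \<omega> = fip S (pow S (X \<omega>) q) (pow S (X \<omega>) q)" for \<omega>
  define g where "g j \<omega> = nrm S (\<lambda>k. H \<omega> k j)" for j \<omega>
  define w where "w j \<omega> = neumann S (X \<omega>) n (\<lambda>k. H \<omega> k j)" for j \<omega>
  define V where "V j = (\<lambda>(\<omega>, \<sigma>). cmod (cin S (w j \<omega>) \<sigma>))" for j

  have f_meas[measurable]: "f \<in> borel_measurable N"
    unfolding f_def N_def by (intro bounded_meas_measurable bounded_meas_fip bounded_meas_mat_pow bounded_meas_mat_X)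
  have g_meas[measurable]: "g j \<in> borel_measurable N" if "j \<in> J" for j
    unfolding g_def N_def using that by (intro borel_measurable_nrm H_measurable) (auto simp: J_def)
  have V_meas[measurable]: "V j \<in> borel_measurable (N \<Otimes>\<^sub>M R)" if "j \<in> J" for j
  proof -
    have 1: "(\<lambda>x. w j (fst x) k) \<in> borel_measurable (N \<Otimes>\<^sub>M R)" if "k \<in> S" for k
      unfolding w_def using neumann_measurable[of j k n] \<open>j \<in> J\<close> that
      by (intro measurable_compose[OF measurable_fst]) (auto simp: N_def J_def)
    have 2: "(\<lambda>x. snd x k) \<in> borel_measurable (N \<Otimes>\<^sub>M R)" if "k \<in> S" for k
    proof -
      have "(\<lambda>\<sigma>. \<sigma> k) \<in> borel_measurable R"
        unfolding R_def using borel_measurable_integrable[OF Q(2)] that by (rule measurable_PiM_component_comp)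
      then show ?thesis by (rule measurable_compose[OF measurable_snd])
    qed
    have 3: "(\<lambda>x. cnj (w j (fst x) k)) \<in> borel_measurable (N \<Otimes>\<^sub>M R)" if "k \<in> S" for k
      by (rule measurable_compose[OF 1[OF that] borel_measurable_continuous_onI[OF continuous_on_cnj[OF continuous_on_id]]])
    have "(\<lambda>x. \<Sum>k\<in>S. cnj (w j (fst x) k) * snd x k) \<in> borel_measurable (N \<Otimes>\<^sub>M R)"
      by (intro borel_measurable_sum borel_measurable_times 2 3)
    from measurable_compose[OF this borel_measurable_norm] show ?thesis
      unfolding V_def cin_def by (simp add: case_prod_unfold)
  qed

  define U0 where "U0 = (\<Union>l<m. {\<omega> \<in> space N. \<not> row_bounded (p l) n S \<Theta> (\<omega> l)})"
  define U1 where "U1 = {\<omega> \<in> space N. ((1 / 2) ^ q)\<^sup>2 \<le> f \<omega>}"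
  define U2 where "U2 j = {\<omega> \<in> space N. \<beta> \<le> g j \<omega>}" for j
  \<comment> \<open>The first two conditions are built in so that the sections can be bounded for
    every \<omega>: they are empty for bad blocks, and for good ones the coefficient vector
    \<open>w j \<omega>\<close> has norm at most \<open>2 * \<beta>\<close>.\<close>
  define U3 where "U3 j = {x \<in> space (N \<Otimes>\<^sub>M R). f (fst x) < ((1 / 2) ^ q)\<^sup>2 \<and> g j (fst x) < \<beta> \<and> 1 / 2 \<le> V j x}" for j
  define U4 where "U4 = (\<Union>k\<in>S. {\<sigma> \<in> space R. cmod (\<sigma> k) \<noteq> 1})"

  have U0: "U0 \<in> sets N" "measure N U0 = 0"
  proof -
    have *: "{\<omega> \<in> space N. \<not> row_bounded (p l) n S \<Theta> (\<omega> l)} \<in> null_sets N" if l: "l < m" for l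
    proof -
      have "Measurable.pred N (\<lambda>\<omega>. row_bounded (p l) n S \<Theta> (\<omega> l))"
      proof -
        have "(\<lambda>\<omega>. \<omega> l) \<in> measurable (PiM {..<m} M) (M l)"
          using l by (intro measurable_component_singleton) simp
        from measurable_compose[OF this row_bounded_measurable[OF l]] show ?thesis unfolding N_def .
      qed
      then have s: "{\<omega> \<in> space N. \<not> row_bounded (p l) n S \<Theta> (\<omega> l)} \<in> sets N"
        by (intro sets.sets_Collect_neg) (simp add: pred_def)
      have "AE \<omega> in N. row_bounded (p l) n S \<Theta> (\<omega> l)"
        unfolding N_def using l by (intro AE_PiM_component prob_M AE_row_bounded) auto
      then show ?thesis using s AE_iff_measurable[OF s refl] by (auto simp: null_sets_def)
    qed
    have "U0 \<in> null_sets N" unfolding U0_def using * by (intro null_sets_UN') auto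
    then show "U0 \<in> sets N" "measure N U0 = 0" by (auto simp: null_sets_def measure_def)
  qed
  have U4: "U4 \<in> sets R" "measure R U4 = 0"
  proof -
    have *: "{\<sigma> \<in> space R. cmod (\<sigma> k) \<noteq> 1} \<in> null_sets R" if k: "k \<in> S" for k
    proof -
      have "(\<lambda>\<sigma>. \<sigma> k) \<in> borel_measurable R"
        unfolding R_def using borel_measurable_integrable[OF Q(2)] k by (rule measurable_PiM_component_comp)
      then have s: "{\<sigma> \<in> space R. \<not> cmod (\<sigma> k) = 1} \<in> sets R" by measurable
      have "AE \<sigma> in R. cmod (\<sigma> k) = 1"
        unfolding R_def using k Q by (intro AE_PiM_component[where M="\<lambda>_. Q"]) auto
      then show ?thesis using s AE_iff_measurable[OF s refl] by (auto simp: null_sets_def)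
    qed
    have "U4 \<in> null_sets R" unfolding U4_def using * finite_S by (intro null_sets_UN') (auto intro: countable_finite)
    then show "U4 \<in> sets R" "measure R U4 = 0" by (auto simp: null_sets_def measure_def)
  qed
  have U1: "U1 \<in> sets N" "measure N U1 \<le> real n * exp (- L)"
  proof -
    show "U1 \<in> sets N" unfolding U1_def by measurable
    \<comment> \<open>The moment bound asks for m >= 168 \<Theta> q, which m >= 336 \<Theta> L
      guarantees.\<close>
    have "\<Theta> * real q * 168 \<le> \<Theta> * (2 * L) * 168" using q \<Theta>_pos by (intro mult_mono) auto
    also have "\<dots> = \<Theta> * L * 336 * 1" by simp
    also have "\<dots> \<le> \<Theta> * L * 889 * L" using \<Theta>_pos L1 by (intro mult_mono) auto
    also have "\<dots> \<le> m" using mL by (simp add: power2_eq_square algebra_simps)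
    finally have "\<Theta> / m * real q \<le> 1 / 168" using m by (simp add: field_simps)
    from prob_pow_X_ge_le[OF this] have "measure N U1 \<le> card S * (1 / 4) ^ q" by (simp add: U1_def f_def N_def)
    also have "\<dots> \<le> real n * exp (- L)"
    proof (rule mult_mono)
      show "real (card S) \<le> real n" using card_mono[OF _ S] by simp
      have "(1 / 4 :: real) \<le> exp (- 1)" using exp_le by (simp add: exp_minus field_simps)
      then have "(1 / 4 :: real) ^ q \<le> exp (- 1) ^ q" by (intro power_mono) auto
      also have "\<dots> = exp (- real q)" by (simp add: exp_of_nat_mult[symmetric])
      also have "\<dots> \<le> exp (- L)" using q by simp
      finally show "(1 / 4 :: real) ^ q \<le> exp (- L)" .
    qed auto
    finally show "measure N U1 \<le> real n * exp (- L)" .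
  qed
  have U2: "U2 j \<in> sets N" "measure N (U2 j) \<le> 2 * exp (- L)" if j: "j \<in> J" for j
  proof -
    show "U2 j \<in> sets N" unfolding U2_def using g_meas[OF j] by measurable
    have "measure N (U2 j) \<le> 2 * exp (- (\<beta>\<^sup>2 * m / (4 * \<Theta>)))"
      unfolding U2_def g_def N_def using j \<beta> by (intro prob_cross_ge_le) (auto simp: J_def)
    also have "\<dots> \<le> 2 * exp (- L)"
    proof -
      have "L * (256 * L * \<Theta>) = 256 * (\<Theta> * L\<^sup>2)" by (simp add: power2_eq_square)
      also have "\<dots> \<le> 889 * (\<Theta> * L\<^sup>2)" using \<Theta>_pos by (intro mult_right_mono) auto
      also have "\<dots> \<le> m" using mL by simp
      finally have "L \<le> m / (256 * L * \<Theta>)" using L1 \<Theta>_pos by (subst le_divide_eq) auto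
      also have "\<dots> = \<beta>\<^sup>2 * m / (4 * \<Theta>)" unfolding \<beta>2 by simp
      finally show ?thesis by simp
    qed
    finally show "measure N (U2 j) \<le> 2 * exp (- L)" .
  qed
  have X_le: "nrm S (mv S (X \<omega>) v) \<le> 1 / 2 * nrm S v" if "f \<omega> < ((1 / 2) ^ q)\<^sup>2" for \<omega> v
    using that unfolding f_def by (intro hermitian_norm_le_of_pow[where q=q] finite_S adj_X) auto
  have U3: "U3 j \<in> sets (N \<Otimes>\<^sub>M R)" "measure (N \<Otimes>\<^sub>M R) (U3 j) \<le> 2 * exp (- L)" if j: "j \<in> J" for j
  proof -
    show s: "U3 j \<in> sets (N \<Otimes>\<^sub>M R)" unfolding U3_def using g_meas[OF j] V_meas[OF j] by measurable
    show "measure (N \<Otimes>\<^sub>M R) (U3 j) \<le> 2 * exp (- L)"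
    proof (rule measure_pair_le[OF N.prob_space_axioms R.prob_space_axioms s])
      fix \<omega> assume \<omega>: "\<omega> \<in> space N"
      show "measure R (Pair \<omega> -` U3 j) \<le> 2 * exp (- L)"
      proof (cases "f \<omega> < ((1 / 2) ^ q)\<^sup>2 \<and> g j \<omega> < \<beta>")
        case True
        then have "Pair \<omega> -` U3 j = {\<sigma> \<in> space R. 1 / 2 \<le> cmod (\<Sum>k\<in>S. cnj (w j \<omega> k) * \<sigma> k)}"
          using \<omega> unfolding U3_def V_def cin_def by (auto simp: space_pair_measure)
        moreover have "measure R {\<sigma> \<in> space R. 1 / 2 \<le> cmod (\<Sum>k\<in>S. cnj (w j \<omega> k) * \<sigma> k)}
           \<le> 2 * exp (- ((1 / 2)\<^sup>2 / (4 * (2 * \<beta>)\<^sup>2)))"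
          unfolding R_def
        proof (rule hoeffding_unimodular[where s="\<lambda>b. b"])
          have "nrm S (w j \<omega>) \<le> 2 * nrm S (\<lambda>k. H \<omega> k j)"
            unfolding w_def using True by (intro nrm_neumann_le X_le) auto
          also have "\<dots> \<le> 2 * \<beta>" using True by (simp add: g_def)
          finally show "nrm S (\<lambda>k. cnj (w j \<omega> k)) \<le> 2 * \<beta>" by (simp add: nrm_def)
        qed (use Q finite_S \<beta> in auto)
        \<comment> \<open>The identity that determines the choice of \<beta>.\<close>
        moreover have "(1 / 2)\<^sup>2 / (4 * (2 * \<beta>)\<^sup>2) = L"
          unfolding power_mult_distrib \<beta>2 using L1 by (simp add: power2_eq_square)
        ultimately show ?thesis by simp
      next
        case False
        then have "Pair \<omega> -` U3 j = {}" unfolding U3_def by auto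
        then show ?thesis by simp
      qed
    qed simp
  qed

  define E where "E = space (N \<Otimes>\<^sub>M R) - (U0 \<times> space R \<union> U1 \<times> space R \<union> (\<Union>j\<in>J. U2 j \<times> space R)
     \<union> (\<Union>j\<in>J. U3 j) \<union> space N \<times> U4)"
  have sR: "A \<times> space R \<in> sets (N \<Otimes>\<^sub>M R)" if "A \<in> sets N" for A using that by auto
  have s4: "space N \<times> U4 \<in> sets (N \<Otimes>\<^sub>M R)" using U4 by auto
  have s2: "(\<Union>j\<in>J. U2 j \<times> space R) \<in> sets (N \<Otimes>\<^sub>M R)" using J U2 by (intro sets.finite_UN) auto
  have s3: "(\<Union>j\<in>J. U3 j) \<in> sets (N \<Otimes>\<^sub>M R)" using J U3 by (intro sets.finite_UN) auto
  note fst = measure_pair_fst[OF R.prob_space_axioms]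
  have "measure (N \<Otimes>\<^sub>M R) (U0 \<times> space R \<union> U1 \<times> space R \<union> (\<Union>j\<in>J. U2 j \<times> space R)
     \<union> (\<Union>j\<in>J. U3 j) \<union> space N \<times> U4)
    \<le> measure (N \<Otimes>\<^sub>M R) (U0 \<times> space R) + measure (N \<Otimes>\<^sub>M R) (U1 \<times> space R)
     + measure (N \<Otimes>\<^sub>M R) (\<Union>j\<in>J. U2 j \<times> space R) + measure (N \<Otimes>\<^sub>M R) (\<Union>j\<in>J. U3 j)
     + measure (N \<Otimes>\<^sub>M R) (space N \<times> U4)"
    by (intro order_trans[OF measure_Un_le] add_mono order_refl sets.Un s2 s3 s4 sR U0 U1)
  also have "\<dots> \<le> 0 + real n * exp (- L) + real n * (2 * exp (- L)) + real n * (2 * exp (- L)) + 0"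
  proof (intro add_mono)
    show "measure (N \<Otimes>\<^sub>M R) (U0 \<times> space R) \<le> 0" using U0 fst[OF U0(1)] by simp
    show "measure (N \<Otimes>\<^sub>M R) (U1 \<times> space R) \<le> real n * exp (- L)" using U1 fst[OF U1(1)] by simp
    have Jn: "real (card J) * (2 * exp (- L)) \<le> real n * (2 * exp (- L))" using J by (intro mult_right_mono) auto
    have "measure (N \<Otimes>\<^sub>M R) (\<Union>j\<in>J. U2 j \<times> space R) \<le> (\<Sum>j\<in>J. measure (N \<Otimes>\<^sub>M R) (U2 j \<times> space R))"
      using J U2 by (intro NR.P.finite_measure_subadditive_finite) auto
    also have "\<dots> \<le> (\<Sum>j\<in>J. 2 * exp (- L))" using U2 fst[OF U2(1)] by (intro sum_mono) auto
    also have "\<dots> = real (card J) * (2 * exp (- L))" by simp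
    also note Jn
    finally show "measure (N \<Otimes>\<^sub>M R) (\<Union>j\<in>J. U2 j \<times> space R) \<le> real n * (2 * exp (- L))" .
    have "measure (N \<Otimes>\<^sub>M R) (\<Union>j\<in>J. U3 j) \<le> (\<Sum>j\<in>J. measure (N \<Otimes>\<^sub>M R) (U3 j))"
      using J U3 by (intro NR.P.finite_measure_subadditive_finite) auto
    also have "\<dots> \<le> (\<Sum>j\<in>J. 2 * exp (- L))" using U3 by (intro sum_mono) auto
    also have "\<dots> = real (card J) * (2 * exp (- L))" by simp
    also note Jn
    finally show "measure (N \<Otimes>\<^sub>M R) (\<Union>j\<in>J. U3 j) \<le> real n * (2 * exp (- L))" .
    show "measure (N \<Otimes>\<^sub>M R) (space N \<times> U4) \<le> 0"
      using U4 measure_pair_snd[OF N.prob_space_axioms R.prob_space_axioms U4(1)] by simp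
  qed
  \<comment> \<open>The total is 5 n exp (-L) = 5 \<epsilon> / 6.\<close>
  also have "\<dots> \<le> \<epsilon>" unfolding expL using n \<epsilon> by (simp add: field_simps)
  finally have ME: "1 - \<epsilon> \<le> measure (N \<Otimes>\<^sub>M R) E"
    unfolding E_def by (subst NR.P.prob_compl) (auto intro!: sets.Un s2 s3 s4 sR U0 U1)
  have SE: "E \<in> sets (N \<Otimes>\<^sub>M R)" unfolding E_def by (intro sets.Diff sets.top sets.Un s2 s3 s4 sR U0 U1)
  have rec: "l2norm n (\<lambda>j. signal S r (snd x) j - z j) \<le> (21 + 36 * sqrt (real (card S))) * \<eta>"
    if x: "x \<in> E" and z: "qBP_minimizer n m p (fst x) (\<lambda>rw. Amul n m (fst x) (signal S r (snd x)) rw + e rw) \<eta> z" for x z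
  proof -
    obtain \<omega> \<sigma> where x': "x = (\<omega>, \<sigma>)" by force
    have sp: "\<omega> \<in> space N" "\<sigma> \<in> space R" using x unfolding x' E_def by (auto simp: space_pair_measure)
    have g0: "row_bounded (p l) n S \<Theta> (\<omega> l)" if "l < m" for l
      using x sp that unfolding x' E_def U0_def by auto
    have g1: "f \<omega> < ((1 / 2) ^ q)\<^sup>2" using x sp unfolding x' E_def U1_def by auto
    have g2: "g j \<omega> < \<beta>" if "j \<in> J" for j using x sp that unfolding x' E_def U2_def by force
    have g3: "V j x < 1 / 2" if "j \<in> J" for j
      using x sp that g1 g2[OF that] unfolding x' E_def U3_def by (force simp: space_pair_measure)
    have g4: "cmod (\<sigma> k) = 1" if "k \<in> S" for k using x sp that unfolding x' E_def U4_def by auto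
    show ?thesis unfolding x' snd_conv
    proof (rule qBP_recovery[where m=m and Bs=\<omega> and p=p and \<Theta>=\<Theta> and e=e and r=r and \<sigma>=\<sigma> and z=z, OF S g0, folded X_def H_def])
      show "nrm S (mv S (X \<omega>) v) \<le> 1 / 2 * nrm S v" for v by (rule X_le[OF g1])
      show "nrm S (\<lambda>k. H \<omega> k j) \<le> 1 / 8" if "j \<in> {..<n} - S" for j
        using g2[of j] that \<beta> by (simp add: g_def J_def)
      show "cmod (cin S (neumann S (X \<omega>) n (\<lambda>k. H \<omega> k j)) \<sigma>) \<le> 1 / 2" if "j \<in> {..<n} - S" for j
        using g3[of j] that unfolding x' V_def w_def J_def by simp
    qed (use g4 r e z x' in \<open>auto intro: less_imp_le\<close>)
  qed
  have eq: "PiM {..<m} F \<Otimes>\<^sub>M PiM S (\<lambda>_. Q) = N \<Otimes>\<^sub>M R" by (simp add: N_def R_def PiM_M)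
  show ?thesis unfolding eq using SE ME rec by blast
qed

end

text \<open>The probability is expressed through a measurable event \<open>E\<close> contained in
  the set of good outcomes, so no measurability of that set itself has to be proved.\<close>

theorem mainTheorem3:
  shows "\<exists>C1 C2 :: real. C1 > 0 \<and> C2 > 0 \<and>
    (\<forall>(n::nat) (m::nat) (p::nat \<Rightarrow> nat) (F::nat \<Rightarrow> cmat measure) (S::nat set) (r::nat \<Rightarrow> real)
       (is_real::bool) (\<Theta>::real) (\<eta>::real) (e::nat \<times> nat \<Rightarrow> complex) (\<epsilon>::real).
       n \<ge> 1 \<longrightarrow> m \<ge> 1 \<longrightarrow> (\<forall>l<m. p l \<ge> 1) \<longrightarrow>
       (\<forall>l<m. prob_space (F l)) \<longrightarrow>
       (\<forall>l<m. \<forall>i<p l. \<forall>j<n. (\<lambda>B. B i j) \<in> borel_measurable (F l)) \<longrightarrow>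
       isotropic n m p F \<longrightarrow>
       S \<subseteq> {..<n} \<longrightarrow> (\<forall>j\<in>S. r j > 0) \<longrightarrow>
       theta_bound n m p F S \<Theta> \<longrightarrow>
       \<eta> > 0 \<longrightarrow> norm2_rows m p e \<le> \<eta> \<longrightarrow>
       0 < \<epsilon> \<longrightarrow> \<epsilon> < 1 \<longrightarrow>
       real m \<ge> 889 * \<Theta> * (ln (6 * real n / \<epsilon>))\<^sup>2 \<longrightarrow>
       (\<exists>E \<in> sets (sample_space m F S is_real).
          measure (sample_space m F S is_real) E \<ge> 1 - \<epsilon> \<and>
          (\<forall>\<omega>\<in>E. \<forall>z. qBP_minimizer n m p (fst \<omega>)
                         (\<lambda>rw. Amul n m (fst \<omega>) (signal S r (snd \<omega>)) rw + e rw) \<eta> z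
                      \<longrightarrow> l2norm n (\<lambda>j. signal S r (snd \<omega>) j - z j)
                            \<le> (C1 + C2 * sqrt (real (card S))) * \<eta>)))"
proof (rule exI[of _ 21], rule exI[of _ 36], intro conjI allI impI)
  fix n m :: nat and p :: "nat \<Rightarrow> nat" and F :: "nat \<Rightarrow> cmat measure" and S :: "nat set" and r :: "nat \<Rightarrow> real"
    and is_real :: bool and \<Theta> \<eta> :: real and e :: "nat \<times> nat \<Rightarrow> complex" and \<epsilon> :: real
  assume A: "n \<ge> 1" "m \<ge> 1" "\<forall>l<m. prob_space (F l)"
    "\<forall>l<m. \<forall>i<p l. \<forall>j<n. (\<lambda>B. B i j) \<in> borel_measurable (F l)"
    "isotropic n m p F" "S \<subseteq> {..<n}" "theta_bound n m p F S \<Theta>"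
    and B: "\<forall>j\<in>S. r j > 0" "norm2_rows m p e \<le> \<eta>" "0 < \<epsilon>" "\<epsilon> < 1"
      "real m \<ge> 889 * \<Theta> * (ln (6 * real n / \<epsilon>))\<^sup>2"
  interpret block_model n m p F S \<Theta> by (rule block_model.intro) (use A in blast)+
  have r: "\<And>k. k \<in> S \<Longrightarrow> r k > 0" using B(1) by blast
  show "\<exists>E \<in> sets (sample_space m F S is_real).
          measure (sample_space m F S is_real) E \<ge> 1 - \<epsilon> \<and>
          (\<forall>\<omega>\<in>E. \<forall>z. qBP_minimizer n m p (fst \<omega>)
                         (\<lambda>rw. Amul n m (fst \<omega>) (signal S r (snd \<omega>)) rw + e rw) \<eta> z
                      \<longrightarrow> l2norm n (\<lambda>j. signal S r (snd \<omega>) j - z j)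
                            \<le> (21 + 36 * sqrt (real (card S))) * \<eta>)"
  proof (cases is_real)
    case True
    then have sp: "sample_space m F S is_real = PiM {..<m} F \<Otimes>\<^sub>M PiM S (\<lambda>_. measure_pmf (pmf_of_set {1, -1}))"
      by (simp only: sample_space_def rademacher_seq_def if_True)
    show ?thesis unfolding sp by (rule recovery_event[OF rademacher_signs r B(2-)])
  next
    case False
    then have sp: "sample_space m F S is_real
        = PiM {..<m} F \<Otimes>\<^sub>M PiM S (\<lambda>_. distr (uniform_measure lborel {0..<2*pi}) borel (\<lambda>t. cis t))"
      by (simp only: sample_space_def steinhaus_seq_def if_False)
    show ?thesis unfolding sp by (rule recovery_event[OF steinhaus_signs(1-4) r B(2-)])
  qed
qed auto

end
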